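(* Let $\chi$ be a primitive Dirichlet character modulo $q\ge 2$, and let $\delta=0$ if $\chi$ is even and $\delta=1$ if $\chi$ is odd. If $\chi$ is even, assume moreover that $q\not\equiv0\pmod 4$. Let $k\in\mathbb{N}$ and set $\eta_{k}(s,\chi):=(\pi/q)^{-s}\Gamma(s)L_{k}(s,\chi)$. Let $(c_{j})_{j\in\mathbb{N}}$ be real numbers with $\sum_{j}|c_{j}|<\infty$, let $(\lambda_{j})_{j\in\mathbb{N}}$ be a bounded sequence of distinct real numbers attaining its bounds, and let $z$ belong to \[ \mathscr{D}_{q}:=\left\{ z\in\mathbb{C}\,:\,|\mathrm{Re}(z)|<\sqrt{\tfrac{\pi}{2q}},\ |\mathrm{Im}(z)|<\sqrt{\tfrac{\pi}{2q}}\right\}. \] Then the function \[ F_{z,k,\chi}(s)=\sum_{j=1}^{\infty}c_{j}\,\eta_{k}(s+i\lambda_{j},\chi)\Big\{ {}_{1}F_{1}\!\big(k(\tfrac12+\delta)-s-i\lambda_{j};\,k(\tfrac12+\delta);\,\tfrac{z^{2}}{4}\big)+{}_{1}F_{1}\!\big(k(\tfrac12+\delta)-\overline{s}+i\lambda_{j};\,k(\tfrac12+\delta);\,\tfrac{\overline{z}^{2}}{4}\big)\Big\} \] has infinitely many zeros on the line $\mathrm{Re}(s)=\frac{k}{2}\left(\frac{1}{2}+\delta\right)$.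
   Context: For $\mathrm{Re}(s)>\frac{k}{2}(1+\delta)$, $L_{k}(s,\chi):=\sum_{(n_{1},\dots,n_{k})\in\mathbb{Z}^{k}}\frac{n_{1}^{\delta}\chi(n_{1})\cdots n_{k}^{\delta}\chi(n_{k})}{(n_{1}^{2}+\dots+n_{k}^{2})^{s}}$ (the zero tuple contributes nothing since $\chi(0)=0$); it extends to an entire function, and $L_k(s,\chi)$ denotes this continuation. A bounded real sequence "attains its bounds" if its supremum and infimum are attained. ${}_{1}F_{1}$ is Kummer's confluent hypergeometric function. *)

theory Defs
  imports "HOL-Complex_Analysis.Complex_Analysis" "HOL-Number_Theory.Cong"
begin

definition dirichlet_character :: "nat \<Rightarrow> (int \<Rightarrow> complex) \<Rightarrow> bool" where
  "dirichlet_character q chi \<longleftrightarrow>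
     0 < q \<and>
     (\<forall>m n. chi (m * n) = chi m * chi n) \<and>
     (\<forall>n. chi (n + int q) = chi n) \<and>
     (\<forall>n. chi n = 0 \<longleftrightarrow> \<not> coprime n (int q))"

definition induced_modulus :: "nat \<Rightarrow> (int \<Rightarrow> complex) \<Rightarrow> nat \<Rightarrow> bool" where
  "induced_modulus q chi d \<longleftrightarrow>
     d dvd q \<and> (\<forall>a. coprime a (int q) \<and> [a = 1] (mod int d) \<longrightarrow> chi a = 1)"

definition primitive_character :: "nat \<Rightarrow> (int \<Rightarrow> complex) \<Rightarrow> bool" where
  "primitive_character q chi \<longleftrightarrow>
     dirichlet_character q chi \<and> (\<forall>d. induced_modulus q chi d \<longrightarrow> d = q)"

definition even_character :: "(int \<Rightarrow> complex) \<Rightarrow> bool" where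
  "even_character chi \<longleftrightarrow> chi (- 1) = 1"

text \<open>A Dirichlet character takes the value $1$ or $-1$ at $-1$, so a character that is
  not even is odd.\<close>

definition char_delta :: "(int \<Rightarrow> complex) \<Rightarrow> nat" where
  "char_delta chi = (if even_character chi then 0 else 1)"

text \<open>Elements of $\mathbf{Z}^k$ are extensional functions on \<open>{..<k}\<close>. The term of the zero
  tuple is $0$ because \<open>0 powr s = 0\<close> and division by zero gives zero.\<close>

definition Lk_series :: "nat \<Rightarrow> (int \<Rightarrow> complex) \<Rightarrow> complex \<Rightarrow> complex" where
  "Lk_series k chi s =
     (\<Sum>\<^sub>\<infinity>n \<in> ({..<k} \<rightarrow>\<^sub>E (UNIV :: int set)).
        (\<Prod>i<k. of_int (n i) ^ char_delta chi * chi (n i)) / of_int (\<Sum>i<k. (n i)\<^sup>2) powr s)"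

text \<open>The entire continuation of the series; it is unique by the identity theorem.\<close>

definition Lk :: "nat \<Rightarrow> (int \<Rightarrow> complex) \<Rightarrow> complex \<Rightarrow> complex" where
  "Lk k chi = (THE L. L holomorphic_on UNIV \<and>
     (\<forall>s. Re s > real k / 2 * (1 + real (char_delta chi)) \<longrightarrow> L s = Lk_series k chi s))"

text \<open>At the poles of the Gamma function, all in \<open>Re s \<le> 0\<close>, the library sets \<open>Gamma s = 0\<close>,
  so there \<open>eta_k\<close> is not the continuous extension of the product.\<close>

definition eta_k :: "nat \<Rightarrow> nat \<Rightarrow> (int \<Rightarrow> complex) \<Rightarrow> complex \<Rightarrow> complex" where
  "eta_k q k chi s = of_real (pi / real q) powr (- s) * Gamma s * Lk k chi s"

definition kummer_1F1 :: "complex \<Rightarrow> complex \<Rightarrow> complex \<Rightarrow> complex" where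
  "kummer_1F1 a b z = (\<Sum>n. pochhammer a n / pochhammer b n * z ^ n / fact n)"

definition D_region :: "nat \<Rightarrow> complex set" where
  "D_region q = {z. \<bar>Re z\<bar> < sqrt (pi / (2 * real q)) \<and> \<bar>Im z\<bar> < sqrt (pi / (2 * real q))}"

definition F_fun ::
  "nat \<Rightarrow> (nat \<Rightarrow> real) \<Rightarrow> (nat \<Rightarrow> real) \<Rightarrow> complex \<Rightarrow> nat \<Rightarrow> (int \<Rightarrow> complex) \<Rightarrow> complex \<Rightarrow> complex" where
  "F_fun q c lam z k chi s =
     (let b = of_real (real k * (1 / 2 + real (char_delta chi))) in
      \<Sum>j. of_real (c j) * eta_k q k chi (s + \<i> * of_real (lam j)) *
        (kummer_1F1 (b - s - \<i> * of_real (lam j)) b (z\<^sup>2 / 4) +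
         kummer_1F1 (b - cnj s + \<i> * of_real (lam j)) b ((cnj z)\<^sup>2 / 4)))"

end

theory Submission
  imports Defs "HOL-Probability.Probability" "HOL-Real_Asymp.Real_Asymp"
begin

text \<open>Let \<open>T\<close> be the \<open>k\<close>-th power of the theta series of \<open>\<chi>\<close>. The function \<open>\<eta>\<^sub>k\<close> is the Mellin transform of
  \<open>T\<close>, and the functional equation of the theta series makes \<open>F\<close>, on the critical line \<open>s = b / 2 + \<i> t\<close>,
  a constant multiple of a real continuous function \<open>f\<close> of \<open>t\<close>. Multiplication by a Kummer function on the
  Mellin side is a differential operator of infinite order acting on \<open>T\<close>. Evaluating it on the ray of
  argument \<open>\<alpha>\<close>, one finds that the integral of \<open>f t * exp (\<alpha> * t)\<close> is, up to a bounded factor, the value of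
  the transformed theta function at \<open>exp (\<i> * \<alpha>)\<close>.

  As \<open>\<alpha>\<close> tends to \<open>\<pi> / 2\<close> this point approaches \<open>\<i>\<close>, where \<open>T\<close> vanishes exponentially: for odd characters
  because the summand carries the factor \<open>n\<close>, for even ones because \<open>q\<close> is then odd (a primitive
  character has conductor odd or divisible by 4), which makes the constant term at this cusp vanish.
  Cauchy's formula writes the operator as a contour integral of \<open>T\<close> against a Kummer function, and the
  region \<open>D\<^sub>q\<close> is precisely where its steepest descent estimate still beats the growth of the kernel. Hence the
  integral of \<open>f t * exp (\<alpha> * t)\<close> is \<open>O (exp (- c / (\<pi> / 2 - \<alpha>)))\<close>.

  If \<open>f\<close> had finitely many zeros, it would have a constant sign on either side of some \<open>[- A, A]\<close>. By the flatness,
  the \<open>m\<close>-th finite differences in \<open>\<alpha>\<close>, i.e. the integrals of \<open>f t * exp (\<alpha> * t) * ((1 - exp (- h * t)) / h) ^ m\<close>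
  with \<open>\<alpha> = \<pi> / 2 - h\<close>, tend to \<open>0\<close> with \<open>h\<close>. But for \<open>m\<close> of the right parity the integrand has one sign outside \<open>[- A, A]\<close>,
  and for large \<open>m\<close> its mass on \<open>[2 A, 3 A]\<close> outweighs that on \<open>[- A, A]\<close>.\<close>

subsection \<open>Sums over the integers and Fourier series\<close>

text \<open>Near \<i> one rate governs everything, K = pi / (4 q): the phase exp (- pi \<i> n^2 / q)
  makes the weights of the theta series periodic modulo 2 q, and after Jacobi's transformation with
  modulus 2 q the lowest nonzero frequency decays like exp (- K Re (1 / \<epsilon>)) at \<i> +
  \<epsilon>. The half side sqrt (pi / (2 q)) of \<open>D_region\<close> is sqrt (2 K). Both
  summands of F have to pass through the same operator. Kummer's transformation 1F1 (b - s; b; u) =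
  exp u * 1F1 (s; b; - u) achieves this: the parameters become z^2 / 4 and - (cnj z)^2 / 4 = (\<i>
  cnj z)^2 / 4, and the square is invariant under z -> \<i> cnj z. The obstacle is the operator near
  the cusp. Cauchy estimates applied to its terms separately see only the modulus of z^2 and lose
  its phase; summing all terms under one contour integral keeps the decay of T and the growth of the
  Kummer kernel in a single exponent, where they can be balanced.\<close>

lemma holomorphic_infsum:
  fixes f :: "'a \<Rightarrow> complex \<Rightarrow> complex"
  assumes S: "open S" and f: "\<And>n. n \<in> I \<Longrightarrow> f n holomorphic_on S"
    and bd: "\<And>z. z \<in> S \<Longrightarrow> \<exists>r>0. \<exists>B. ball z r \<subseteq> S \<and> B summable_on I \<and>
               (\<forall>n\<in>I. \<forall>w\<in>ball z r. norm (f n w) \<le> B n)"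
  shows "(\<lambda>z. \<Sum>\<^sub>\<infinity>n\<in>I. f n z) holomorphic_on S"
    and "z \<in> S \<Longrightarrow> ((\<lambda>n. deriv (f n) z) has_sum deriv (\<lambda>z. \<Sum>\<^sub>\<infinity>n\<in>I. f n z) z) I"
proof -
  have main: "\<exists>r>0. ball z r \<subseteq> S \<and> uniform_limit (ball z r) (\<lambda>X w. \<Sum>n\<in>X. f n w) (\<lambda>w. \<Sum>\<^sub>\<infinity>n\<in>I. f n w) (finite_subsets_at_top I)"
    if "z \<in> S" for z
    using bd[OF that] by (blast intro: Weierstrass_m_test_general)
  have ev: "\<forall>\<^sub>F X in finite_subsets_at_top I. (\<lambda>w. \<Sum>n\<in>X. f n w) holomorphic_on S"
    by (rule eventually_finite_subsets_at_top_weakI) (auto intro!: holomorphic_on_sum f)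
  have nb: "finite_subsets_at_top I \<noteq> bot" by simp
  have "(\<lambda>z. \<Sum>\<^sub>\<infinity>n\<in>I. f n z) field_differentiable at z" if zS: "z \<in> S" for z
  proof -
    obtain r where r: "r > 0" "ball z r \<subseteq> S"
      and ul: "uniform_limit (ball z r) (\<lambda>X w. \<Sum>n\<in>X. f n w) (\<lambda>w. \<Sum>\<^sub>\<infinity>n\<in>I. f n w) (finite_subsets_at_top I)"
      using main[OF zS] by blast
    have sub: "cball z (r/2) \<subseteq> ball z r" using r by auto
    have "(\<lambda>z. \<Sum>\<^sub>\<infinity>n\<in>I. f n z) holomorphic_on ball z (r/2)"
    proof (rule holomorphic_uniform_limit[OF _ uniform_limit_on_subset[OF ul sub] nb])
      show "\<forall>\<^sub>F X in finite_subsets_at_top I. continuous_on (cball z (r/2)) (\<lambda>w. \<Sum>n\<in>X. f n w) \<and>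
              (\<lambda>w. \<Sum>n\<in>X. f n w) holomorphic_on ball z (r/2)"
        using ev
      proof eventually_elim
        case (elim X)
        have "(\<lambda>w. \<Sum>n\<in>X. f n w) holomorphic_on cball z (r/2)"
          using elim r sub by (blast intro: holomorphic_on_subset)
        moreover have "ball z (r/2) \<subseteq> cball z (r/2)" by auto
        ultimately show ?case
          by (blast intro: holomorphic_on_subset holomorphic_on_imp_continuous_on)
      qed
    qed
    thus ?thesis using r(1) by (simp add: holomorphic_on_open field_differentiable_def)
  qed
  thus "(\<lambda>z. \<Sum>\<^sub>\<infinity>n\<in>I. f n z) holomorphic_on S"
    by (simp add: holomorphic_on_def field_differentiable_at_within)
  assume zS: "z \<in> S"
  obtain r where r: "r > 0" "ball z r \<subseteq> S"
    and ul: "uniform_limit (ball z r) (\<lambda>X w. \<Sum>n\<in>X. f n w) (\<lambda>w. \<Sum>\<^sub>\<infinity>n\<in>I. f n w) (finite_subsets_at_top I)"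
    using main[OF zS] by blast
  have "((\<lambda>X. deriv (\<lambda>w. \<Sum>n\<in>X. f n w) z) \<longlongrightarrow> deriv (\<lambda>w. \<Sum>\<^sub>\<infinity>n\<in>I. f n w) z) (finite_subsets_at_top I)"
    by (rule deriv_complex_uniform_limit[OF ul _ nb])
       (use ev r in \<open>auto elim!: eventually_mono intro: holomorphic_on_subset\<close>)
  moreover have "\<forall>\<^sub>F X in finite_subsets_at_top I. deriv (\<lambda>w. \<Sum>n\<in>X. f n w) z = (\<Sum>n\<in>X. deriv (f n) z)"
  proof (rule eventually_finite_subsets_at_top_weakI)
    fix X assume X: "finite X" "X \<subseteq> I"
    show "deriv (\<lambda>w. \<Sum>n\<in>X. f n w) z = (\<Sum>n\<in>X. deriv (f n) z)"
      using X holomorphic_on_imp_differentiable_at[OF f S zS]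
      by (intro DERIV_imp_deriv DERIV_sum) (auto simp: field_differentiable_derivI)
  qed
  ultimately show "((\<lambda>n. deriv (f n) z) has_sum deriv (\<lambda>z. \<Sum>\<^sub>\<infinity>n\<in>I. f n z) z) I"
    unfolding has_sum_def by (simp add: tendsto_cong)
qed

section \<open>Gaussian majorants over the integers\<close>

lemma summable_on_int:
  fixes f :: "int \<Rightarrow> 'a::{banach}"
  assumes "(\<lambda>n::nat. f (int n)) summable_on UNIV" "(\<lambda>n::nat. f (- int n)) summable_on UNIV"
  shows "f summable_on UNIV"
proof -
  have a: "f summable_on range int"
    using assms(1) by (subst summable_on_reindex) (auto simp: o_def)
  have b: "f summable_on range (\<lambda>n. - int n)"
    using assms(2) by (subst summable_on_reindex) (auto simp: o_def inj_on_def)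
  have "f summable_on (range (\<lambda>n. - int n) - range int)"
    by (rule summable_on_subset_banach[OF b]) auto
  hence "f summable_on (range int \<union> (range (\<lambda>n. - int n) - range int))"
    by (intro summable_on_Un_disjoint a) auto
  also have "range int \<union> (range (\<lambda>n. - int n) - range int) = UNIV"
    by (auto simp: image_iff) (metis int_cases2)
  finally show ?thesis .
qed

lemma power_le_fact_exp:
  assumes "x \<ge> (0::real)"
  shows "x ^ d \<le> fact d * exp x"
proof -
  have "(\<Sum>n\<in>{d}. x ^ n /\<^sub>R fact n) \<le> (\<Sum>n. x ^ n /\<^sub>R fact n)"
    using assms by (intro sum_le_suminf summable_exp_generic) auto
  thus ?thesis by (simp add: exp_def field_simps)
qed

lemma summable_power_exp:
  assumes "c > 0"
  shows "summable (\<lambda>n::nat. real n ^ d * exp (- c * real n))"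
proof (rule summable_comparison_test')
  show "summable (\<lambda>n. (2 / c) ^ d * fact d * exp (- c / 2) ^ n)"
    using assms by (intro summable_mult summable_geometric) simp
  fix n :: nat
  have "real n ^ d = (2 / c) ^ d * (c / 2 * real n) ^ d"
    using assms by (simp add: power_mult_distrib[symmetric])
  also have "\<dots> \<le> (2 / c) ^ d * (fact d * exp (c / 2 * real n))"
    using assms by (intro mult_left_mono power_le_fact_exp) auto
  finally have "real n ^ d * exp (- c * real n) \<le> (2 / c) ^ d * (fact d * exp (c / 2 * real n)) * exp (- c * real n)"
    by (intro mult_right_mono) auto
  also have "\<dots> = (2 / c) ^ d * fact d * exp (- c / 2) ^ n"
    by (simp add: exp_of_nat_mult[symmetric] mult.assoc exp_add[symmetric] field_simps)
  finally show "norm (real n ^ d * exp (- c * real n)) \<le> (2 / c) ^ d * fact d * exp (- c / 2) ^ n"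
    by simp
qed

lemma summable_on_int_power_exp:
  assumes "c > 0"
  shows "(\<lambda>n::int. \<bar>real_of_int n\<bar> ^ d * exp (- c * \<bar>real_of_int n\<bar>)) summable_on UNIV"
proof (rule summable_on_int)
  have "(\<lambda>n. real n ^ d * exp (- c * real n)) summable_on UNIV"
    using summable_power_exp[OF assms, of d] by (intro norm_summable_imp_summable_on) simp
  thus "(\<lambda>n. \<bar>real_of_int (int n)\<bar> ^ d * exp (- c * \<bar>real_of_int (int n)\<bar>)) summable_on UNIV"
   and "(\<lambda>n. \<bar>real_of_int (- int n)\<bar> ^ d * exp (- c * \<bar>real_of_int (- int n)\<bar>)) summable_on UNIV"
    by simp_all
qed

lemma gauss_le_exp_abs:
  assumes "c > 0"
  shows "exp (C * \<bar>n\<bar> - c * n\<^sup>2) \<le> exp ((C + 1)\<^sup>2 / (4 * c)) * exp (- \<bar>n::real\<bar>)"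
proof -
  \<comment> \<open>Completing the square in |n| is the origin of the constant (C + 1)^2 / (4
    c).\<close>
  have "0 \<le> (2 * c * \<bar>n\<bar> - (C + 1))\<^sup>2 / (4 * c)" using assms by simp
  also have "\<dots> = c * n\<^sup>2 - (C + 1) * \<bar>n\<bar> + (C + 1)\<^sup>2 / (4 * c)"
    using assms by (simp add: field_simps power2_eq_square)
  finally show ?thesis
    unfolding exp_add[symmetric] by (simp add: algebra_simps)
qed

lemma summable_on_int_gauss:
  assumes "c > 0"
  shows "(\<lambda>n::int. \<bar>real_of_int n\<bar> ^ d * exp (C * \<bar>real_of_int n\<bar> - c * (real_of_int n)\<^sup>2)) summable_on UNIV"
proof -
  have "(\<lambda>n::int. exp ((C + 1)\<^sup>2 / (4 * c)) * (\<bar>real_of_int n\<bar> ^ d * exp (- 1 * \<bar>real_of_int n\<bar>))) summable_on UNIV"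
    by (intro summable_on_cmult_right summable_on_int_power_exp) simp
  thus ?thesis
  proof (rule summable_on_comparison_test)
    fix n :: int
    show "\<bar>real_of_int n\<bar> ^ d * exp (C * \<bar>real_of_int n\<bar> - c * (real_of_int n)\<^sup>2)
       \<le> exp ((C + 1)\<^sup>2 / (4 * c)) * (\<bar>real_of_int n\<bar> ^ d * exp (- 1 * \<bar>real_of_int n\<bar>))"
      using mult_left_mono[OF gauss_le_exp_abs[OF assms, of C "real_of_int n"], of "\<bar>real_of_int n\<bar> ^ d"]
      by (simp add: mult_ac)
  qed auto
qed

text \<open>Chernoff's argument: h - h 0 = D * (e - 1) with D holomorphic near the interval, so each
  coefficient of h - h 0 is a difference of neighbouring coefficients of D, and symmetric partial
  sums telescope. The two remaining coefficients of D tend to 0.\<close>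

lemma fourier_sum_at_0:
  fixes h :: "complex \<Rightarrow> complex"
  assumes h: "h holomorphic_on UNIV" and per: "\<And>z. h (z + 1) = h z"
  defines "c \<equiv> \<lambda>m::int. integral {-1/2..1/2} (\<lambda>x::real. h (of_real x) * exp (- 2 * pi * \<i> * of_int m * of_real x))"
  shows "(\<lambda>N. \<Sum>m\<in>{-int N..int N}. c m) \<longlonglongrightarrow> h 0"
proof -
  \<comment> \<open>The zeros of e - 1 are the integers, and 0 is the only one in this strip around
    the interval of integration.\<close>
  define S where "S = {z::complex. \<bar>Re z\<bar> < 1}"
  define e where "e = (\<lambda>z::complex. exp (2 * pi * \<i> * z))"
  have S: "open S" "0 \<in> S"
  proof -
    have "S = {z. Re z < 1} \<inter> {z. Re z > -1}" by (auto simp: S_def)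
    thus "open S" by (auto simp: open_halfspace_Re_lt open_halfspace_Re_gt intro!: open_Int)
  qed (auto simp: S_def)
  \<comment> \<open>Numerator and denominator have their removable singularity at 0 filled in before
    dividing; the denominator P e takes the value 2 pi \<i> there, so it has no zero in the
    strip.\<close>
  define P where "P = (\<lambda>(f::complex \<Rightarrow> complex) z. if z = 0 then deriv f 0 else (f z - f 0) / (z - 0))"
  have e_holo: "e holomorphic_on S" unfolding e_def by (intro holomorphic_intros)
  have P1: "P h holomorphic_on S" unfolding P_def
    by (rule pole_lemma) (use S h in \<open>auto simp: interior_open intro: holomorphic_on_subset\<close>)
  have P2: "P e holomorphic_on S" unfolding P_def
    by (rule pole_lemma) (use S e_holo in \<open>auto simp: interior_open\<close>)
  have e0: "e 0 = 1" by (simp add: e_def)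
  have e1: "z = 0" if ez: "e z = 1" and zS: "z \<in> S" for z
  proof -
    obtain n :: int where "Im z = 0" "Re z = of_int n"
      using ez unfolding e_def exp_eq_1 by auto
    moreover from this have "\<bar>real_of_int n\<bar> < 1" using zS by (simp add: S_def)
    ultimately show ?thesis by (simp add: complex_eq_iff)
  qed
  have de: "(e has_field_derivative 2 * pi * \<i> * e z) (at z)" for z
    unfolding e_def by (auto intro!: derivative_eq_intros)
  have P2nz: "P e z \<noteq> 0" if "z \<in> S" for z
    using that e1[OF _ that] DERIV_imp_deriv[OF de, of 0] by (auto simp: P_def e0)
  define D where "D = (\<lambda>z. P h z / P e z)"
  have D_holo: "D holomorphic_on S" unfolding D_def
    by (intro holomorphic_intros P1 P2) (use P2nz in auto)
  have D_eq: "h z - h 0 = D z * (e z - 1)" if "z \<in> S" for z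
    using P2nz[OF that] e1[OF _ that] by (auto simp: D_def P_def e0 field_simps)
  define I where "I = {-1/2..1/2::real}"
  have IS: "of_real x \<in> S" if "x \<in> I" for x using that by (auto simp: S_def I_def)
  define d where "d = (\<lambda>m::int. integral I (\<lambda>x::real. D (of_real x) * exp (- 2 * pi * \<i> * of_int m * of_real x)))"
  have contD: "continuous_on I (\<lambda>x. D (of_real x))"
    by (rule continuous_on_compose2[OF holomorphic_on_imp_continuous_on[OF D_holo]]) (auto intro!: continuous_intros IS)
  have conth: "continuous_on I (\<lambda>x. h (of_real x))"
    by (rule continuous_on_compose2[OF holomorphic_on_imp_continuous_on[OF h]]) (auto intro!: continuous_intros)
  have int1: "(\<lambda>x::real. D (of_real x) * exp (- 2 * pi * \<i> * of_int m * of_real x)) integrable_on I" for m :: int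
    unfolding I_def by (intro integrable_continuous_interval continuous_intros contD[unfolded I_def])
  define c0 where "c0 = (\<lambda>m::int. integral I (\<lambda>x::real. h 0 * exp (- 2 * pi * \<i> * of_int m * of_real x)))"
  have c0: "c0 m = (if m = 0 then h 0 else 0)" for m
  proof (cases "m = 0")
    case False
    have "((\<lambda>x. h 0 * exp (- 2 * pi * \<i> * of_int m * of_real x)) has_integral
      (h 0 * exp (- 2 * pi * \<i> * of_int m * of_real (1/2)) / (- 2 * pi * \<i> * of_int m) -
       h 0 * exp (- 2 * pi * \<i> * of_int m * of_real (-1/2)) / (- 2 * pi * \<i> * of_int m))) {-1/2..1/2::real}"
    proof (rule fundamental_theorem_of_calculus)
      fix x :: real
      have "((\<lambda>z. h 0 * exp (- 2 * pi * \<i> * of_int m * z) / (- 2 * pi * \<i> * of_int m)) has_field_derivative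
           h 0 * exp (- 2 * pi * \<i> * of_int m * of_real x)) (at (of_real x))"
        using False by (auto intro!: derivative_eq_intros simp: field_simps)
      thus "((\<lambda>x. h 0 * exp (- 2 * pi * \<i> * of_int m * of_real x) / (- 2 * pi * \<i> * of_int m)) has_vector_derivative
           h 0 * exp (- 2 * pi * \<i> * of_int m * of_real x)) (at x within {-1/2..1/2})"
        by (rule has_vector_derivative_real_field)
    qed simp
    moreover have "exp (- 2 * pi * \<i> * of_int m * of_real (1/2)) = exp (- 2 * pi * \<i> * of_int m * of_real (-1/2))"
      unfolding exp_eq by (intro exI[of _ "- m"]) simp
    ultimately have "((\<lambda>x. h 0 * exp (- 2 * pi * \<i> * of_int m * of_real x)) has_integral 0) {-1/2..1/2::real}"
      by (simp only: diff_self)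
    thus ?thesis using False unfolding c0_def I_def by (simp only: integral_unique if_False)
  qed (simp add: c0_def I_def)
  have c_split: "c m - c0 m = d (m - 1) - d m" for m
  proof -
    have "c m - c0 m = integral I (\<lambda>x. h (of_real x) * exp (- 2 * pi * \<i> * of_int m * of_real x) -
        h 0 * exp (- 2 * pi * \<i> * of_int m * of_real x))"
      unfolding c_def c0_def I_def
      by (intro integral_diff[symmetric] integrable_continuous_interval continuous_intros conth[unfolded I_def])
    also have "\<dots> = integral I (\<lambda>x. D (of_real x) * exp (- 2 * pi * \<i> * of_int (m-1) * of_real x)
        - D (of_real x) * exp (- 2 * pi * \<i> * of_int m * of_real x))"
    proof (rule integral_cong)
      fix x assume x: "x \<in> I"
      have "exp (- 2 * pi * \<i> * of_int (m-1) * of_real x) = e x * exp (- 2 * pi * \<i> * of_int m * of_real x)"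
        by (simp add: e_def exp_add[symmetric] algebra_simps)
      hence "D (of_real x) * exp (- 2 * pi * \<i> * of_int (m-1) * of_real x)
          - D (of_real x) * exp (- 2 * pi * \<i> * of_int m * of_real x)
          = (D (of_real x) * (e x - 1)) * exp (- 2 * pi * \<i> * of_int m * of_real x)"
        by (simp only: ring_distribs mult_ac mult_1_right mult_1_left)
      also have "\<dots> = (h (of_real x) - h 0) * exp (- 2 * pi * \<i> * of_int m * of_real x)"
        by (simp only: D_eq[OF IS[OF x]])
      finally show "h (of_real x) * exp (- 2 * pi * \<i> * of_int m * of_real x) - h 0 * exp (- 2 * pi * \<i> * of_int m * of_real x)
         = D (of_real x) * exp (- 2 * pi * \<i> * of_int (m-1) * of_real x)
        - D (of_real x) * exp (- 2 * pi * \<i> * of_int m * of_real x)"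
        by (simp only: left_diff_distrib)
    qed
    also have "\<dots> = d (m - 1) - d m" unfolding d_def
      by (intro integral_diff int1)
    finally show ?thesis .
  qed
  have tele: "(\<Sum>m\<in>{-int N..int N}. c m) = h 0 + d (- int N - 1) - d (int N)" for N
  proof -
    have "(\<Sum>m\<in>{-int N..int N}. d (m - 1) - d m) = d (- int N - 1) - d (int N)"
    proof (induction N)
      case (Suc N)
      have "{- int (Suc N)..int (Suc N)} = insert (int (Suc N)) (insert (- int (Suc N)) {-int N..int N})" by auto
      moreover have "d (- 1 - int N) = d (- int N - 1)" by (rule arg_cong[of _ _ d]) simp
      ultimately show ?case using Suc by (simp add: algebra_simps)
    qed simp
    moreover have "(\<Sum>m\<in>{-int N..int N}. c0 m) = h 0" by (simp add: c0)
    moreover have "(\<Sum>m\<in>{-int N..int N}. c m) = (\<Sum>m\<in>{-int N..int N}. c0 m) + (\<Sum>m\<in>{-int N..int N}. d (m - 1) - d m)"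
      by (subst sum.distrib[symmetric], intro sum.cong) (use c_split in \<open>auto simp: algebra_simps\<close>)
    ultimately show ?thesis by simp
  qed
  \<comment> \<open>One integration by parts; the boundary terms at -1/2 and 1/2 are themselves of
    order 1 / |m|.\<close>
  obtain B where B: "\<And>m. m \<noteq> 0 \<Longrightarrow> norm (d m) \<le> B / \<bar>of_int m\<bar>"
  proof -
    define D' where "D' = deriv D"
    have D'h: "D' holomorphic_on S" unfolding D'_def using D_holo S by (intro holomorphic_deriv)
    have contD': "continuous_on I (\<lambda>x. D' (of_real x))"
      by (rule continuous_on_compose2[OF holomorphic_on_imp_continuous_on[OF D'h]]) (auto intro!: continuous_intros IS)
    have "bounded ((\<lambda>x. D' (of_real x)) ` I)" "bounded ((\<lambda>x. D (of_real x)) ` I)"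
      by (intro compact_imp_bounded compact_continuous_image contD contD'; simp add: I_def)+
    then obtain B1 B2 where B1: "\<And>x. x \<in> I \<Longrightarrow> norm (D' (of_real x)) \<le> B1"
      and B2: "\<And>x. x \<in> I \<Longrightarrow> norm (D (of_real x)) \<le> B2"
      unfolding bounded_iff by fast
    have "norm (d m) \<le> (B1 + 2 * B2) / \<bar>of_int m\<bar>" if m: "m \<noteq> 0" for m
    proof -
      define w where "w = - 2 * pi * \<i> * of_int m"
      have w: "w \<noteq> 0" using m by (simp add: w_def)
      have nw: "norm w = 2 * pi * \<bar>of_int m\<bar>" by (simp add: w_def norm_mult)
      have nexp: "norm (exp (w * of_real x)) = 1" for x :: real
        by (simp add: w_def)
      have ftc: "((\<lambda>x. D (of_real x) * exp (w * of_real x) + D' (of_real x) * exp (w * of_real x) / w) has_integral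
        (D (of_real (1/2)) * exp (w * of_real (1/2)) / w - D (of_real (-1/2)) * exp (w * of_real (-1/2)) / w)) {-1/2..1/2::real}"
      proof (rule fundamental_theorem_of_calculus)
        fix x :: real assume x: "x \<in> {-1/2..1/2}"
        have [derivative_intros]: "(D has_field_derivative D' x) (at (of_real x))"
          unfolding D'_def using D_holo S IS x by (intro holomorphic_derivI[of _ S]) (auto simp: I_def)
        have "((\<lambda>z. D z * exp (w * z) / w) has_field_derivative
             D (of_real x) * exp (w * of_real x) + D' (of_real x) * exp (w * of_real x) / w) (at (of_real x))"
          using w by (auto intro!: derivative_eq_intros simp: field_simps)
        thus "((\<lambda>x. D (of_real x) * exp (w * of_real x) / w) has_vector_derivative
             D (of_real x) * exp (w * of_real x) + D' (of_real x) * exp (w * of_real x) / w) (at x within {-1/2..1/2})"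
          by (rule has_vector_derivative_real_field)
      qed simp
      have "((\<lambda>x. D' (of_real x) * exp (w * of_real x) / w) integrable_on I)"
        unfolding I_def using w by (intro integrable_continuous_interval continuous_intros contD'[unfolded I_def]) auto
      note has_integral_diff[OF ftc this[unfolded I_def, THEN integrable_integral]]
      hence "((\<lambda>x. D (of_real x) * exp (w * of_real x)) has_integral
        (D (of_real (1/2)) * exp (w * of_real (1/2)) / w - D (of_real (-1/2)) * exp (w * of_real (-1/2)) / w -
           integral I (\<lambda>x. D' (of_real x) * exp (w * of_real x) / w))) I"
        by (simp add: I_def)
      hence dm: "d m = (D (of_real (1/2)) * exp (w * of_real (1/2)) / w - D (of_real (-1/2)) * exp (w * of_real (-1/2)) / w -
           integral I (\<lambda>x. D' (of_real x) * exp (w * of_real x) / w))"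
        unfolding d_def w_def by (rule integral_unique)
      have i: "norm (integral I (\<lambda>x. D' (of_real x) * exp (w * of_real x) / w)) \<le> B1 / norm w * (1/2 - (-1/2))"
        unfolding I_def
      proof (rule integral_bound)
        show "continuous_on {-1/2..1/2} (\<lambda>x. D' (of_real x) * exp (w * of_real x) / w)"
          using w by (intro continuous_intros contD'[unfolded I_def]) auto
        fix x :: real assume "x \<in> {-1/2..1/2}"
        thus "norm (D' (of_real x) * exp (w * of_real x) / w) \<le> B1 / norm w"
          using B1[of x] by (simp add: I_def norm_mult norm_divide nexp divide_right_mono del: norm_exp_eq_Re)
      qed simp
      have j: "norm (D (of_real x) * exp (w * of_real x) / w) \<le> B2 / norm w" if "x \<in> I" for x
        using B2[OF that] by (simp add: norm_mult norm_divide nexp divide_right_mono del: norm_exp_eq_Re)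
      have "norm (d m) \<le> B2 / norm w + B2 / norm w + B1 / norm w"
        unfolding dm
        by (intro order_trans[OF norm_triangle_ineq4] add_mono j order_trans[OF i]) (auto simp: I_def)
      also have "\<dots> = (B1 + 2 * B2) / norm w" by (simp add: add_divide_distrib)
      also have "\<dots> \<le> (B1 + 2 * B2) / \<bar>of_int m\<bar>"
      proof (rule divide_left_mono)
        show "\<bar>of_int m\<bar> \<le> norm w" unfolding nw using pi_gt3 by (simp add: mult_le_cancel_right1)
        have "0 \<le> B1" "0 \<le> B2" using B1[of 0] B2[of 0] by (auto simp: I_def intro: order_trans[OF norm_ge_zero])
        thus "0 \<le> B1 + 2 * B2" by simp
      qed (use m w in auto)
      finally show ?thesis .
    qed
    thus ?thesis using that by blast
  qed
  have "(\<lambda>N. d (- int N - 1)) \<longlonglongrightarrow> 0"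
  proof (rule Lim_null_comparison)
    show "\<forall>\<^sub>F N in sequentially. norm (d (- int N - 1)) \<le> B / (real N + 1)"
      using B[of "- int N - 1" for N] by (intro always_eventually allI) (auto simp: abs_if add_ac)
  qed real_asymp
  moreover have "(\<lambda>N. d (int N)) \<longlonglongrightarrow> 0"
  proof (rule Lim_null_comparison)
    show "\<forall>\<^sub>F N in sequentially. norm (d (int N)) \<le> B / real N"
      using eventually_gt_at_top[of 0]
    proof eventually_elim
      case (elim N)
      thus ?case using B[of "int N"] by simp
    qed
  qed real_asymp
  ultimately have "(\<lambda>N. h 0 + d (- int N - 1) - d (int N)) \<longlonglongrightarrow> h 0 + 0 - 0"
    by (intro tendsto_intros)
  thus ?thesis by (simp add: tele)
qed

text \<open>Read off from the characteristic function of the standard normal distribution, after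
  scaling the variable by sqrt (2 a).\<close>

lemma gauss_fourier:
  fixes a \<xi> :: real
  assumes a: "a > 0"
  shows "integrable lborel (\<lambda>x. exp (\<i> * of_real (\<xi> * x)) * of_real (exp (- a * x\<^sup>2)))"
    and "(LBINT x. exp (\<i> * of_real (\<xi> * x)) * of_real (exp (- a * x\<^sup>2))) =
           of_real (sqrt (pi / a) * exp (- \<xi>\<^sup>2 / (4 * a)))"
proof -
  define t where "t = \<xi> / sqrt (2 * a)"
  define c where "c = sqrt (2 * a)"
  have c: "c > 0" "c\<^sup>2 = 2 * a" using a by (auto simp: c_def)
  have "integrable std_normal_distribution (\<lambda>x. iexp (t * x))"
    using real_dist_normal_dist prob_space.finite_measure
    by (intro finite_measure.integrable_const_bound[where B=1]) (auto simp: real_distribution_def)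
  hence i1: "integrable lborel (\<lambda>x. std_normal_density x *\<^sub>R iexp (t * x))"
    by (subst (asm) integrable_density) auto
  have e1: "(LBINT x. std_normal_density x *\<^sub>R iexp (t * x)) = of_real (exp (- (t\<^sup>2) / 2))"
    using fun_cong[OF char_std_normal_distribution, of t] unfolding char_def
    by (subst (asm) integral_density) auto
  have eq: "std_normal_density (0 + c * x) *\<^sub>R iexp (t * (0 + c * x)) =
     of_real (1 / sqrt (2 * pi)) * (exp (\<i> * of_real (\<xi> * x)) * of_real (exp (- a * x\<^sup>2)))" for x
  proof -
    have "(c * x)\<^sup>2 / 2 = a * x\<^sup>2" using c by (simp add: power_mult_distrib)
    hence 1: "std_normal_density (0 + c * x) = 1 / sqrt (2 * pi) * exp (- a * x\<^sup>2)"
      by (simp add: std_normal_density_def)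
    have 2: "t * (0 + c * x) = \<xi> * x" using c by (simp add: t_def c_def)
    show ?thesis unfolding 1 2
      by (simp add: scaleR_conv_of_real mult_ac)
  qed
  have "integrable lborel (\<lambda>x. std_normal_density (0 + c * x) *\<^sub>R iexp (t * (0 + c * x)))"
    by (rule lborel_integrable_real_affine[OF i1]) (use c in simp)
  hence "integrable lborel (\<lambda>x. of_real (sqrt (2 * pi)) * (of_real (1 / sqrt (2 * pi)) * (exp (\<i> * of_real (\<xi> * x)) * of_real (exp (- a * x\<^sup>2)))) :: complex)"
    unfolding eq by (rule integrable_mult_right)
  moreover have "of_real (sqrt (2 * pi)) * (of_real (1 / sqrt (2 * pi)) * z) = z" for z :: complex
    by (simp add: field_simps)
  ultimately show "integrable lborel (\<lambda>x. exp (\<i> * of_real (\<xi> * x)) * of_real (exp (- a * x\<^sup>2)))"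
    by (simp only:)
  have "(LBINT x. std_normal_density x *\<^sub>R iexp (t * x)) =
     \<bar>c\<bar> *\<^sub>R (LBINT x. std_normal_density (0 + c * x) *\<^sub>R iexp (t * (0 + c * x)))"
    using c(1) by (intro lborel_integral_real_affine) auto
  also have "\<dots> = of_real (c / sqrt (2 * pi)) * (LBINT x. exp (\<i> * of_real (\<xi> * x)) * of_real (exp (- a * x\<^sup>2)))"
    unfolding eq using c(1) by (simp add: scaleR_conv_of_real)
  finally have "of_real (c / sqrt (2 * pi)) * (LBINT x. exp (\<i> * of_real (\<xi> * x)) * of_real (exp (- a * x\<^sup>2)))
      = (of_real (exp (- (t\<^sup>2) / 2)) :: complex)" using e1 by simp
  note L = this
  have t: "- (t\<^sup>2) / 2 = - \<xi>\<^sup>2 / (4 * a)" using a by (simp add: t_def power_divide)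
  have K: "sqrt (pi / a) * (c / sqrt (2 * pi)) = 1"
    using a by (simp add: c_def real_sqrt_mult real_sqrt_divide field_simps)
  have "(LBINT x. exp (\<i> * of_real (\<xi> * x)) * of_real (exp (- a * x\<^sup>2))) =
      of_real (sqrt (pi / a) * (c / sqrt (2 * pi))) * (LBINT x. exp (\<i> * of_real (\<xi> * x)) * of_real (exp (- a * x\<^sup>2)))"
    unfolding K by simp
  also have "\<dots> = of_real (sqrt (pi / a)) * of_real (exp (- (t\<^sup>2) / 2))"
    by (simp only: of_real_mult mult.assoc L[unfolded of_real_mult])
  finally show "(LBINT x. exp (\<i> * of_real (\<xi> * x)) * of_real (exp (- a * x\<^sup>2))) =
           of_real (sqrt (pi / a) * exp (- \<xi>\<^sup>2 / (4 * a)))"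
    unfolding t of_real_mult .
qed

lemma gauss_fourier_shift:
  fixes a \<xi> b :: real
  assumes a: "a > 0"
  shows "integrable lborel (\<lambda>x. exp (\<i> * of_real (\<xi> * x)) * of_real (exp (- a * (x + b)\<^sup>2)))"
    and "(LBINT x. exp (\<i> * of_real (\<xi> * x)) * of_real (exp (- a * (x + b)\<^sup>2))) =
           of_real (sqrt (pi / a) * exp (- \<xi>\<^sup>2 / (4 * a))) * exp (- \<i> * of_real (\<xi> * b))"
proof -
  let ?f = "\<lambda>x. exp (\<i> * of_real (\<xi> * x)) * of_real (exp (- a * x\<^sup>2))"
  have eq: "exp (\<i> * of_real (\<xi> * x)) * of_real (exp (- a * (x + b)\<^sup>2)) = exp (- \<i> * of_real (\<xi> * b)) * ?f (b + 1 * x)" for x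
  proof -
    have "exp (\<i> * of_real (\<xi> * x)) = exp (- \<i> * of_real (\<xi> * b)) * exp (\<i> * of_real (\<xi> * (b + 1 * x)))"
      by (subst exp_add[symmetric]) (simp add: algebra_simps)
    thus ?thesis by (simp add: add.commute)
  qed
  have "integrable lborel (\<lambda>x. ?f (b + 1 * x))"
    by (rule lborel_integrable_real_affine[OF gauss_fourier(1)[OF a]]) simp
  thus "integrable lborel (\<lambda>x. exp (\<i> * of_real (\<xi> * x)) * of_real (exp (- a * (x + b)\<^sup>2)))"
    unfolding eq by (rule integrable_mult_right)
  have "(LBINT x. ?f x) = \<bar>1\<bar> *\<^sub>R (LBINT x. ?f (b + 1 * x))"
    by (intro lborel_integral_real_affine) auto
  thus "(LBINT x. exp (\<i> * of_real (\<xi> * x)) * of_real (exp (- a * (x + b)\<^sup>2))) =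
           of_real (sqrt (pi / a) * exp (- \<xi>\<^sup>2 / (4 * a))) * exp (- \<i> * of_real (\<xi> * b))"
    unfolding eq using gauss_fourier(2)[OF a, of \<xi>] by (simp add: mult.commute)
qed

section \<open>Theta-type series with polynomially bounded weights\<close>

lemma norm_gauss_term_le:
  fixes A B :: complex and n :: int
  assumes "c \<le> Re A" "norm B \<le> C"
  shows "norm (exp (B * of_int n - A * (of_int n)\<^sup>2)) \<le> exp (C * \<bar>of_int n\<bar> - c * (of_int n)\<^sup>2)"
proof -
  have "Re (B * of_int n) \<le> norm B * \<bar>of_int n\<bar>"
    using complex_Re_le_cmod[of "B * of_int n"] by (simp add: norm_mult)
  also have "\<dots> \<le> C * \<bar>of_int n\<bar>" using assms by (intro mult_right_mono) auto
  finally have "Re (B * of_int n) \<le> C * \<bar>of_int n\<bar>" .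
  moreover have "Re (A * (of_int n)\<^sup>2) = Re A * (of_int n)\<^sup>2"
    by (simp flip: of_int_power)
  moreover have "c * (of_int n)\<^sup>2 \<le> Re A * (of_int n)\<^sup>2"
    using assms by (intro mult_right_mono) auto
  ultimately show ?thesis by simp
qed

text \<open>The factor with exponent 0 is kept so that the majorant is visibly a sum of two
  instances of \<open>summable_on_int_gauss\<close>.\<close>

lemma norm_weighted_gauss_term_le:
  fixes A B :: complex and n :: int and a :: "int \<Rightarrow> complex"
  assumes "c \<le> Re A" "norm B \<le> C" "\<And>n. norm (a n) \<le> K * (1 + \<bar>of_int n\<bar> ^ d)"
  shows "norm (a n * exp (B * of_int n - A * (of_int n)\<^sup>2))
      \<le> K * (\<bar>of_int n\<bar> ^ 0 * exp (C * \<bar>of_int n\<bar> - c * (of_int n)\<^sup>2) + \<bar>of_int n\<bar> ^ d * exp (C * \<bar>of_int n\<bar> - c * (of_int n)\<^sup>2))"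
proof -
  have "norm (a n * exp (B * of_int n - A * (of_int n)\<^sup>2)) \<le> K * (1 + \<bar>of_int n\<bar> ^ d) * exp (C * \<bar>of_int n\<bar> - c * (of_int n)\<^sup>2)"
    unfolding norm_mult using order_trans[OF norm_ge_zero assms(3)]
    by (intro mult_mono norm_gauss_term_le assms) auto
  thus ?thesis by (simp add: algebra_simps)
qed

lemma summable_weighted_gauss_majorant:
  assumes "c > 0"
  shows "(\<lambda>n::int. K * (\<bar>of_int n\<bar> ^ 0 * exp (C * \<bar>of_int n\<bar> - c * (of_int n)\<^sup>2) + \<bar>of_int n\<bar> ^ d * exp (C * \<bar>of_int n\<bar> - c * (of_int n)\<^sup>2)) :: real) summable_on UNIV"
  by (intro summable_on_cmult_right summable_on_add summable_on_int_gauss assms)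

lemma abs_summable_weighted_gauss:
  fixes A B :: complex and a :: "int \<Rightarrow> complex"
  assumes A: "Re A > 0" and a: "\<And>n. norm (a n) \<le> K * (1 + \<bar>of_int n\<bar> ^ d)"
  shows "(\<lambda>n. norm (a n * exp (B * of_int n - A * (of_int n)\<^sup>2))) summable_on UNIV"
  by (rule summable_on_comparison_test[OF summable_weighted_gauss_majorant[OF A]])
     (use norm_weighted_gauss_term_le[OF order_refl order_refl a] in auto)

text \<open>A varying \<open>A\<close> gives holomorphy in the upper variable of a theta series, a
  varying \<open>B\<close> holomorphy in its shift. The termwise derivative serves to pass from even
  to odd characters, by differentiating in the shift.\<close>

lemma holomorphic_weighted_gauss:
  fixes A B :: "complex \<Rightarrow> complex" and a :: "int \<Rightarrow> complex"
  assumes S: "open S" and A: "A holomorphic_on S" and B: "B holomorphic_on S"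
    and pos: "\<And>z. z \<in> S \<Longrightarrow> Re (A z) > 0"
    and a: "\<And>n. norm (a n) \<le> K * (1 + \<bar>of_int n\<bar> ^ d)"
  shows "(\<lambda>z. \<Sum>\<^sub>\<infinity>n. a n * exp (B z * of_int n - A z * (of_int n)\<^sup>2)) holomorphic_on S" (is ?th1)
    and "z \<in> S \<Longrightarrow> ((\<lambda>n. deriv (\<lambda>z. a n * exp (B z * of_int n - A z * (of_int n)\<^sup>2)) z) has_sum
              deriv (\<lambda>z. \<Sum>\<^sub>\<infinity>n. a n * exp (B z * of_int n - A z * (of_int n)\<^sup>2)) z) UNIV"
proof -
  have h: "(\<lambda>z. a n * exp (B z * of_int n - A z * (of_int n)\<^sup>2)) holomorphic_on S" for n
    by (intro holomorphic_intros A B)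
  have bd: "\<exists>r>0. \<exists>M. ball z r \<subseteq> S \<and> M summable_on UNIV \<and>
               (\<forall>n\<in>UNIV. \<forall>w\<in>ball z r. norm (a n * exp (B w * of_int n - A w * (of_int n)\<^sup>2)) \<le> M n)" if z: "z \<in> S" for z
  proof -
    obtain r0 where r0: "r0 > 0" "ball z r0 \<subseteq> S" using S z openE by blast
    have "isCont A z" "isCont B z"
      using holomorphic_on_imp_differentiable_at[OF A S z] holomorphic_on_imp_differentiable_at[OF B S z]
      by (simp_all add: field_differentiable_imp_continuous_at)
    note cont = this[unfolded continuous_at_eps_delta, rule_format]
    obtain r1 where r1: "r1 > 0" "\<And>w. dist w z < r1 \<Longrightarrow> dist (A w) (A z) < Re (A z) / 2"
      using cont(1)[of "Re (A z) / 2"] pos[OF z] by (auto simp only: half_gt_zero)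
    obtain r2 where r2: "r2 > 0" "\<And>w. dist w z < r2 \<Longrightarrow> dist (B w) (B z) < 1"
      using cont(2)[of 1] by (auto simp only: zero_less_one)
    define r where "r = min r0 (min r1 r2)"
    define c where "c = Re (A z) / 2"
    define C where "C = norm (B z) + 1"
    have "c \<le> Re (A w)" "norm (B w) \<le> C" if "w \<in> ball z r" for w
    proof -
      have "dist w z < r1" "dist w z < r2" using that by (auto simp: r_def dist_commute)
      from r1(2)[OF this(1)] r2(2)[OF this(2)] show "c \<le> Re (A w)" "norm (B w) \<le> C"
        using abs_Re_le_cmod[of "A w - A z"] norm_triangle_sub[of "B w" "B z"]
        by (auto simp: c_def C_def dist_norm)
    qed
    hence "\<forall>n\<in>UNIV. \<forall>w\<in>ball z r. norm (a n * exp (B w * of_int n - A w * (of_int n)\<^sup>2)) \<le>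
       K * (\<bar>of_int n\<bar> ^ 0 * exp (C * \<bar>of_int n\<bar> - c * (of_int n)\<^sup>2) + \<bar>of_int n\<bar> ^ d * exp (C * \<bar>of_int n\<bar> - c * (of_int n)\<^sup>2))"
      by (intro ballI norm_weighted_gauss_term_le a)
    moreover have "r > 0" "ball z r \<subseteq> S" using r0 r1 r2 by (auto simp: r_def)
    ultimately show ?thesis
      using summable_weighted_gauss_majorant[of c K C d] pos[OF z] unfolding c_def by (intro exI[of _ r] conjI exI) auto
  qed
  show ?th1 by (rule holomorphic_infsum(1)[OF S h bd])
  show "z \<in> S \<Longrightarrow> ((\<lambda>n. deriv (\<lambda>z. a n * exp (B z * of_int n - A z * (of_int n)\<^sup>2)) z) has_sum
              deriv (\<lambda>z. \<Sum>\<^sub>\<infinity>n. a n * exp (B z * of_int n - A z * (of_int n)\<^sup>2)) z) UNIV"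
    by (rule holomorphic_infsum(2)[OF S h bd])
qed

subsection \<open>Jacobi's transformation\<close>

text \<open>Links the unconditional sums used for theta series with the symmetric partial sums in
  which Fourier series converge.\<close>

lemma filterlim_symmetric_interval:
  "filterlim (\<lambda>N::nat. {-int N..int N}) (finite_subsets_at_top UNIV) sequentially"
proof (unfold filterlim_finite_subsets_at_top, intro allI impI)
  fix X :: "int set" assume X: "finite X \<and> X \<subseteq> UNIV"
  then obtain B where B: "\<And>x. x \<in> X \<Longrightarrow> \<bar>x\<bar> \<le> B"
    using finite_imageI[of X abs] by (metis Max_ge imageI)
  show "\<forall>\<^sub>F N in sequentially. finite {-int N..int N} \<and> X \<subseteq> {-int N..int N} \<and> {-int N..int N} \<subseteq> UNIV"
    using eventually_ge_at_top[of "nat B"]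
  proof eventually_elim
    case (elim N)
    have "x \<in> {-int N..int N}" if "x \<in> X" for x
      using B[OF that] elim by auto
    thus ?case by auto
  qed
qed

lemma integral_symmetric_split:
  fixes F :: "real \<Rightarrow> complex"
  assumes F: "continuous_on UNIV F"
  shows "integral {-real N - 1/2..real N + 1/2} F = (\<Sum>n\<in>{-int N..int N}. integral {-1/2..1/2} (\<lambda>x. F (x + of_int n)))"
proof (induction N)
  case (Suc N)
  have sh: "integral {-1/2..1/2} (\<lambda>x. F (x + of_int n)) = integral {of_int n - 1/2..of_int n + 1/2} F" for n :: int
  proof -
    have "integral {-1/2..1/2} (F \<circ> (\<lambda>x. x + of_int n)) = integral {-1/2 + of_int n..1/2 + of_int n} F"
      by (rule integral_shift) (rule continuous_on_subset[OF F], simp)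
    thus ?thesis by (simp add: o_def add.commute)
  qed
  have int: "F integrable_on {u..v}" for u v
    by (rule integrable_continuous_interval[OF continuous_on_subset[OF F]]) simp
  have "integral {-real (Suc N) - 1/2..real (Suc N) + 1/2} F =
      integral {-real (Suc N) - 1/2..-real N - 1/2} F + (integral {-real N - 1/2..real N + 1/2} F + integral {real N + 1/2..real (Suc N) + 1/2} F)"
    by (simp add: Henstock_Kurzweil_Integration.integral_combine int)
  also have "integral {-real (Suc N) - 1/2..-real N - 1/2} F = integral {-1/2..1/2} (\<lambda>x. F (x + of_int (- int (Suc N))))"
    unfolding sh by (rule arg_cong2[of _ _ _ _ "\<lambda>u v. integral {u..v} F"]) simp_all
  also have "integral {real N + 1/2..real (Suc N) + 1/2} F = integral {-1/2..1/2} (\<lambda>x. F (x + of_int (int (Suc N))))"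
    unfolding sh by (rule arg_cong2[of _ _ _ _ "\<lambda>u v. integral {u..v} F"]) simp_all
  finally show ?case
  proof -
    assume a: "integral {-real (Suc N) - 1/2..real (Suc N) + 1/2} F =
      integral {-1/2..1/2} (\<lambda>x. F (x + of_int (- int (Suc N)))) + (integral {-real N - 1/2..real N + 1/2} F + integral {-1/2..1/2} (\<lambda>x. F (x + of_int (int (Suc N)))))"
    have s: "{- int (Suc N)..int (Suc N)} = insert (int (Suc N)) (insert (- int (Suc N)) {-int N..int N})" by auto
    show ?thesis unfolding a s Suc by (subst sum.insert sum.insert; simp)+
  qed
qed simp

lemma exp_minus_2pi_int: "exp (- 2 * pi * \<i> * of_int m * of_int n) = 1"
  unfolding exp_eq_1 by (auto intro!: exI[of _ "- m * n"])

text \<open>Poisson summation: the periodised Gaussian is evaluated at 0 by its Fourier series, and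
  unfolding turns its m-th coefficient into the Fourier transform of the Gaussian at 2 pi m. The
  shift \<beta> is put into the Gaussian, so that evaluation at 0 is enough.\<close>

lemma poisson_gauss_real:
  fixes Y \<beta> :: real
  assumes Y: "Y > 0"
  shows "(\<Sum>\<^sub>\<infinity>n::int. exp (- of_real (pi * Y) * (of_int n + of_real \<beta>)\<^sup>2)) =
     complex_of_real (1 / sqrt Y) * (\<Sum>\<^sub>\<infinity>m::int. exp (2 * pi * \<i> * of_real \<beta> * of_int m - of_real (pi / Y) * (of_int m)\<^sup>2))"
proof -
  define E where "E = (\<lambda>(n::int) z. exp (- of_real (pi * Y) * (of_int n + of_real \<beta> + z)\<^sup>2 :: complex))"
  \<comment> \<open>The periodised Gaussian with the square expanded: a Gaussian factor times a
    theta series linear in z, the form in which holomorphy is available.\<close>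
  define h where "h = (\<lambda>z::complex. exp (- of_real (pi * Y) * (of_real \<beta> + z)\<^sup>2) *
      (\<Sum>\<^sub>\<infinity>n. 1 * exp ((- 2 * of_real (pi * Y) * (of_real \<beta> + z)) * of_int n - of_real (pi * Y) * (of_int n)\<^sup>2)))"
  have pos: "Re (of_real (pi * Y)) > 0" using Y by simp
  have h_holo: "h holomorphic_on UNIV" unfolding h_def
    by (intro holomorphic_intros holomorphic_weighted_gauss[where K = 1 and d = 0]) (use pos in auto)
  have E_eq: "E n z = exp (- of_real (pi * Y) * (of_real \<beta> + z)\<^sup>2) * (1 * exp ((- 2 * of_real (pi * Y) * (of_real \<beta> + z)) * of_int n - of_real (pi * Y) * (of_int n)\<^sup>2))" for n z
    unfolding E_def mult_1_left exp_add[symmetric] by (rule arg_cong[of _ _ exp]) (simp add: power2_eq_square algebra_simps)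
  have h_E: "h z = (\<Sum>\<^sub>\<infinity>n. E n z)" for z
    unfolding h_def E_eq by (rule infsum_cmult_right'[symmetric])
  have E_summable: "(\<lambda>n. E n z) summable_on UNIV" for z
    unfolding E_eq by (intro summable_on_cmult_right abs_summable_summable[OF abs_summable_weighted_gauss[where K = 1 and d = 0]]) (use pos in auto)
  have per: "h (z + 1) = h z" for z
  proof -
    have "bij_betw (\<lambda>n. n + 1) UNIV (UNIV :: int set)"
      by (rule bij_betw_byWitness[where f' = "\<lambda>n. n - 1"]) auto
    from infsum_reindex_bij_betw[OF this, of "\<lambda>n. E n z"] show ?thesis
      unfolding h_E by (simp add: E_def algebra_simps)
  qed
  define I where "I = {-1/2..1/2::real}"
  define c where "c = (\<lambda>m::int. integral {-1/2..1/2} (\<lambda>x::real. h (of_real x) * exp (- 2 * pi * \<i> * of_int m * of_real x)))"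
  have c_eq: "c m = of_real (1 / sqrt Y) * exp (2 * pi * \<i> * of_real \<beta> * of_int m - of_real (pi / Y) * (of_int m)\<^sup>2)" for m
  proof -
    define \<xi> where "\<xi> = - 2 * pi * of_int m"
    define F where "F = (\<lambda>x::real. exp (\<i> * of_real (\<xi> * x)) * of_real (exp (- (pi * Y) * (x + \<beta>)\<^sup>2)))"
    have F_int: "integrable lborel F" and F_val: "(LBINT x. F x) = of_real (1 / sqrt Y) * exp (2 * pi * \<i> * of_real \<beta> * of_int m - of_real (pi / Y) * (of_int m)\<^sup>2)"
    proof -
      have a: "pi * Y > 0" using Y by simp
      show "integrable lborel F" unfolding F_def by (rule gauss_fourier_shift[OF a])
      have "(LBINT x. F x) = of_real (sqrt (pi / (pi * Y)) * exp (- \<xi>\<^sup>2 / (4 * (pi * Y)))) * exp (- \<i> * of_real (\<xi> * \<beta>))"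
        unfolding F_def by (rule gauss_fourier_shift[OF a])
      also have "- \<xi>\<^sup>2 / (4 * (pi * Y)) = - (pi / Y) * (of_int m)\<^sup>2" using Y by (simp add: \<xi>_def power2_eq_square)
      also have "sqrt (pi / (pi * Y)) = 1 / sqrt Y" by (simp add: real_sqrt_divide)
      also have "of_real (1 / sqrt Y * exp (- (pi / Y) * (of_int m)\<^sup>2)) * exp (- \<i> * of_real (\<xi> * \<beta>)) =
          of_real (1 / sqrt Y) * (exp (of_real (- (pi / Y) * (of_int m)\<^sup>2)) * exp (- \<i> * of_real (\<xi> * \<beta>)))"
        by (simp only: of_real_mult[of "1 / sqrt Y"] exp_of_real mult.assoc)
      also have "exp (of_real (- (pi / Y) * (of_int m)\<^sup>2)) * exp (- \<i> * of_real (\<xi> * \<beta>)) = exp (2 * pi * \<i> * of_real \<beta> * of_int m - of_real (pi / Y) * (of_int m)\<^sup>2)"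
        unfolding exp_add[symmetric] by (rule arg_cong[of _ _ exp]) (simp add: \<xi>_def)
      finally show "(LBINT x. F x) = of_real (1 / sqrt Y) * exp (2 * pi * \<i> * of_real \<beta> * of_int m - of_real (pi / Y) * (of_int m)\<^sup>2)" .
    qed
    have contF: "continuous_on UNIV F" unfolding F_def by (intro continuous_intros)
    \<comment> \<open>Translation by an integer does not affect the phase exp (- 2 pi \<i> m x), so
      all cells carry the same Fourier factor.\<close>
    have G: "F (x + of_int n) = E n (of_real x) * exp (- 2 * pi * \<i> * of_int m * of_real x)" for x n
    proof -
      have "\<i> * of_real (\<xi> * (x + of_int n)) = - 2 * pi * \<i> * of_int m * of_real x + (- 2 * pi * \<i> * of_int m * of_int n)"
        by (simp add: \<xi>_def algebra_simps)
      hence "exp (\<i> * of_real (\<xi> * (x + of_int n))) = exp (- 2 * pi * \<i> * of_int m * of_real x)"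
        by (simp only: exp_add exp_minus_2pi_int mult_1_right)
      moreover have "of_real (exp (- (pi * Y) * (x + of_int n + \<beta>)\<^sup>2)) = E n (of_real x)"
        unfolding E_def exp_of_real[symmetric] by (simp add: algebra_simps)
      ultimately show ?thesis unfolding F_def by simp
    qed
    define M where "M = (\<lambda>n::int. \<bar>of_int n\<bar> ^ 0 * exp (2 * pi * Y * (\<bar>\<beta>\<bar> + 1/2) * \<bar>of_int n\<bar> - (pi * Y) * (of_int n)\<^sup>2))"
    have M: "norm (F (x + of_int n)) \<le> M n" if "x \<in> I" for x n
    proof -
      have "norm (F (x + of_int n)) = norm (E n (of_real x))" unfolding G by (simp add: norm_mult)
      also have "\<dots> = norm (exp (- of_real (pi * Y) * (of_real \<beta> + of_real x)\<^sup>2 :: complex)) * norm (exp ((- 2 * of_real (pi * Y) * (of_real \<beta> + of_real x)) * of_int n - of_real (pi * Y) * (of_int n)\<^sup>2 :: complex))"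
        unfolding E_eq by (simp add: norm_mult)
      also have "\<dots> \<le> 1 * exp (2 * pi * Y * (\<bar>\<beta>\<bar> + 1/2) * \<bar>of_int n\<bar> - (pi * Y) * (of_int n)\<^sup>2)"
      proof (intro mult_mono norm_gauss_term_le)
        show "norm (exp (- of_real (pi * Y) * (of_real \<beta> + of_real x)\<^sup>2 :: complex)) \<le> 1"
          using Y by (simp flip: of_real_add of_real_power)
        have "\<bar>\<beta> + x\<bar> \<le> \<bar>\<beta>\<bar> + 1/2" using that by (auto simp: I_def)
        hence "2 * pi * Y * \<bar>\<beta> + x\<bar> \<le> 2 * pi * Y * (\<bar>\<beta>\<bar> + 1/2)" using Y by (intro mult_left_mono) auto
        moreover have "norm (- 2 * of_real (pi * Y) * (of_real \<beta> + of_real x) :: complex) = 2 * pi * Y * \<bar>\<beta> + x\<bar>"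
          using Y by (simp add: norm_mult abs_mult flip: of_real_add)
        ultimately show "norm (- 2 * of_real (pi * Y) * (of_real \<beta> + of_real x) :: complex) \<le> 2 * pi * Y * (\<bar>\<beta>\<bar> + 1/2)" by simp
      qed auto
      finally show ?thesis by (simp add: M_def)
    qed
    \<comment> \<open>Uniform convergence on one cell allows the sum over n to be pulled out of the
      integral; the partial sum over |n| \<le> N is the integral of F over the cells up to N, and
      exhausts the line.\<close>
    have "uniform_limit I (\<lambda>X x. \<Sum>n\<in>X. F (x + of_int n)) (\<lambda>x. \<Sum>\<^sub>\<infinity>n. F (x + of_int n)) (finite_subsets_at_top UNIV)"
      by (rule Weierstrass_m_test_general[of UNIV I _ M]) (use M summable_on_int_gauss[of "pi * Y" 0] Y in \<open>auto simp: M_def\<close>)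
    from filterlim_compose[OF this filterlim_symmetric_interval]
    have ul: "uniform_limit I (\<lambda>N x. \<Sum>n\<in>{-int N..int N}. F (x + of_int n)) (\<lambda>x. h (of_real x) * exp (- 2 * pi * \<i> * of_int m * of_real x)) sequentially"
      unfolding h_E G by (simp only: infsum_cmult_left')
    have "(\<lambda>N. integral I (\<lambda>x. \<Sum>n\<in>{-int N..int N}. F (x + of_int n))) \<longlonglongrightarrow> c m"
    proof -
      have "continuous_on (cbox (-1/2) (1/2)) (\<lambda>x. \<Sum>n\<in>{-int N..int N}. F (x + of_int n))" for N
        by (intro continuous_intros continuous_on_compose2[OF contF]) auto
      from uniform_limit_integral_cbox[OF ul[unfolded I_def, folded cbox_interval] this]
      obtain I' J where IJ: "\<And>N. ((\<lambda>x. \<Sum>n\<in>{-int N..int N}. F (x + of_int n)) has_integral I' N) {-1/2..1/2}"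
        "((\<lambda>x. h (of_real x) * exp (- 2 * pi * \<i> * of_int m * of_real x)) has_integral J) {-1/2..1/2}" "I' \<longlonglongrightarrow> J"
        by auto
      thus ?thesis unfolding c_def I_def by (simp only: integral_unique[OF IJ(1)] integral_unique[OF IJ(2)])
    qed
    moreover have "integral I (\<lambda>x. \<Sum>n\<in>{-int N..int N}. F (x + of_int n)) = integral {-real N - 1/2..real N + 1/2} F" for N
      unfolding integral_symmetric_split[OF contF] I_def
      by (rule integral_sum) (auto intro!: integrable_continuous_interval continuous_on_compose2[OF contF] continuous_intros)
    moreover have "integral {-real N - 1/2..real N + 1/2} F = (LINT x:{-real N - 1/2..real N + 1/2}|lborel. F x)" for N
      by (rule set_borel_integral_eq_integral(2)[symmetric])
         (rule set_integrable_subset[of _ UNIV]; use F_int in \<open>simp add: set_integrable_def\<close>)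
    ultimately have lim1: "(\<lambda>N. LINT x:{-real N - 1/2..real N + 1/2}|lborel. F x) \<longlonglongrightarrow> c m" by (simp only:)
    have "(\<lambda>N. LINT x:{-real N - 1/2..real N + 1/2}|lborel. F x) \<longlonglongrightarrow> (LINT x:(\<Union>N::nat. {-real N - 1/2..real N + 1/2})|lborel. F x)"
    proof (rule set_integral_cont_up)
      show "set_integrable lborel (\<Union>N::nat. {-real N - 1/2..real N + 1/2}) F"
        by (rule set_integrable_subset[of _ UNIV]) (use F_int in \<open>simp_all add: set_integrable_def\<close>)
    qed (auto simp: incseq_def)
    also have "(\<Union>N::nat. {-real N - 1/2..real N + 1/2}) = UNIV"
    proof (intro equalityI subsetI UNIV_I)
      fix x :: real
      obtain N :: nat where "\<bar>x\<bar> \<le> real N" using real_arch_simple by blast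
      thus "x \<in> (\<Union>N::nat. {-real N - 1/2..real N + 1/2})" by (intro UN_I[of N]) auto
    qed
    finally have "(\<lambda>N. LINT x:{-real N - 1/2..real N + 1/2}|lborel. F x) \<longlonglongrightarrow> (LBINT x. F x)"
      by (simp add: set_lebesgue_integral_def)
    from LIMSEQ_unique[OF lim1 this] F_val show ?thesis by simp
  qed
  have lim: "(\<lambda>N. \<Sum>m\<in>{-int N..int N}. c m) \<longlonglongrightarrow> h 0"
    unfolding c_def by (rule fourier_sum_at_0[OF h_holo per])
  have "(\<lambda>m. 1 * exp (2 * pi * \<i> * of_real \<beta> * of_int m - of_real (pi / Y) * (of_int m)\<^sup>2)) summable_on UNIV"
    by (rule abs_summable_summable[OF abs_summable_weighted_gauss[where K = 1 and d = 0]]) (use Y in auto)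
  hence "(c has_sum (complex_of_real (1 / sqrt Y) * (\<Sum>\<^sub>\<infinity>m::int. exp (2 * pi * \<i> * of_real \<beta> * of_int m - of_real (pi / Y) * (of_int m)\<^sup>2)))) UNIV"
    unfolding c_eq by (intro has_sum_cmult_right) simp
  hence "(\<lambda>N. \<Sum>m\<in>{-int N..int N}. c m) \<longlonglongrightarrow> complex_of_real (1 / sqrt Y) * (\<Sum>\<^sub>\<infinity>m::int. exp (2 * pi * \<i> * of_real \<beta> * of_int m - of_real (pi / Y) * (of_int m)\<^sup>2))"
    unfolding has_sum_def by (rule filterlim_compose[OF _ filterlim_symmetric_interval])
  from LIMSEQ_unique[OF lim this] show ?thesis
    unfolding h_E by (simp add: E_def)
qed

lemma Re_of_real_divide_pos:
  assumes "Re Y > 0" "r > 0"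
  shows "Re (of_real r / Y) > 0"
proof -
  have "Y \<noteq> 0" using assms by auto
  hence "(Re Y)\<^sup>2 + (Im Y)\<^sup>2 > 0" by (simp add: complex_neq_0)
  thus ?thesis using assms by (simp add: Re_divide)
qed

text \<open>The point 1 serves as accumulation point of positive reals in both domains of
  application, the right half-plane and the whole plane.\<close>

lemma holomorphic_eqI_of_real:
  assumes f: "f holomorphic_on S" and g: "g holomorphic_on S" and S: "open S" "connected S"
    and one: "1 \<in> S" and eq: "\<And>x::real. x > 0 \<Longrightarrow> of_real x \<in> S \<Longrightarrow> f (of_real x) = g (of_real x)"
    and w: "w \<in> S"
  shows "f w = (g w :: complex)"
proof -
  obtain e where e: "e > 0" "ball 1 e \<subseteq> S" using S one openE by blast
  have "f w - g w = 0"
  proof (rule analytic_continuation[where f="\<lambda>z. f z - g z" and S = S and U="of_real ` {x. x > 0 \<and> complex_of_real x \<in> S}" and \<xi> = 1])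
    show "1 islimpt complex_of_real ` {x. x > 0 \<and> complex_of_real x \<in> S}"
      unfolding islimpt_approachable
    proof (intro allI impI)
      fix d :: real assume d: "d > 0"
      define t where "t = min d e / 2"
      have t: "t > 0" "t < d" "t < e" using d e by (auto simp: t_def)
      have "complex_of_real (1 + t) \<in> ball 1 e" using t by (simp add: dist_norm)
      hence "complex_of_real (1 + t) \<in> of_real ` {x. x > 0 \<and> complex_of_real x \<in> S}" using e(2) t
        by (intro imageI) auto
      moreover have "complex_of_real (1 + t) \<noteq> 1" "dist (complex_of_real (1 + t)) 1 < d"
        using t by (auto simp: dist_norm)
      ultimately show "\<exists>x'\<in>complex_of_real ` {x. x > 0 \<and> complex_of_real x \<in> S}. x' \<noteq> 1 \<and> dist x' 1 < d" by blast
    qed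
  qed (use assms in \<open>auto intro!: holomorphic_intros\<close>)
  thus ?thesis by simp
qed

lemma right_halfplane: "open {x::complex. Re x > 0}" "connected {x::complex. Re x > 0}" "convex {x::complex. Re x > 0}"
proof -
  show o: "open {x::complex. Re x > 0}" by (rule open_halfspace_Re_gt)
  show c: "convex {x::complex. Re x > 0}" by (rule convex_halfspace_Re_gt)
  show "connected {x::complex. Re x > 0}" by (rule convex_connected[OF c])
qed

lemma gauss_complete_square:
  fixes Y \<beta> :: complex
  shows "exp (- (of_real pi * Y) * (of_int n + \<beta>)\<^sup>2) = exp (- (of_real pi * Y) * \<beta>\<^sup>2) *
     (1 * exp ((- 2 * of_real pi * Y * \<beta>) * of_int n - (of_real pi * Y) * (of_int n)\<^sup>2))"
  unfolding mult_1_left exp_add[symmetric]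
  by (rule arg_cong[of _ _ exp]) (simp add: power2_eq_square algebra_simps)

text \<open>Two analytic continuations from the real case: in Y for fixed real \<beta>, then in
  \<beta> for fixed Y. Both sides are written with the square expanded because that form is known to
  be holomorphic in either variable.\<close>

lemma poisson_gauss:
  fixes Y \<beta> :: complex
  assumes Y: "Re Y > 0"
  shows "exp (- (of_real pi * Y) * \<beta>\<^sup>2) * (\<Sum>\<^sub>\<infinity>n. 1 * exp ((- 2 * of_real pi * Y * \<beta>) * of_int n - (of_real pi * Y) * (of_int n)\<^sup>2)) =
     Y powr (-1/2) * (\<Sum>\<^sub>\<infinity>m. 1 * exp ((2 * pi * \<i> * \<beta>) * of_int m - (of_real pi / Y) * (of_int m)\<^sup>2))"
    (is "?L Y \<beta> = ?R Y \<beta>")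
proof -
  let ?S = "{x::complex. Re x > 0}"
  have one: "norm (1::complex) \<le> 1 * (1 + \<bar>of_int n\<bar> ^ 0)" for n :: int by simp
  have nz: "y \<notin> \<real>\<^sub>\<le>\<^sub>0" if "Re y > 0" for y using that by (auto simp: complex_nonpos_Reals_iff)
  have real: "?L (of_real y) (of_real b) = ?R (of_real y) (of_real b)" if y: "y > 0" for y b
  proof -
    have "of_real y powr (-1/2) = complex_of_real (y powr (-1/2))"
      using y by (subst powr_of_real[symmetric]) auto
    also have "y powr (-1/2) = 1 / sqrt y"
      using y by (simp add: powr_minus_divide powr_half_sqrt)
    finally have p: "of_real y powr (-1/2) = complex_of_real (1 / sqrt y)" .
    have "?L (of_real y) (of_real b) = (\<Sum>\<^sub>\<infinity>n::int. exp (- of_real (pi * y) * (of_int n + of_real b)\<^sup>2))"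
      unfolding infsum_cmult_right'[symmetric] gauss_complete_square[symmetric] by simp
    thus ?thesis unfolding poisson_gauss_real[OF y] p by simp
  qed
  have realb: "?L y (of_real b) = ?R y (of_real b)" if y: "Re y > 0" for y b
  proof (rule holomorphic_eqI_of_real[where f = "\<lambda>y. ?L y (of_real b)" and S = ?S])
    show "(\<lambda>y. ?L y (of_real b)) holomorphic_on ?S"
      by (intro holomorphic_intros holomorphic_weighted_gauss(1)[OF _ _ _ _ one] right_halfplane) auto
    show "(\<lambda>y. ?R y (of_real b)) holomorphic_on ?S"
      by (intro holomorphic_intros holomorphic_weighted_gauss(1)[OF _ _ _ _ one] right_halfplane)
         (auto intro!: Re_of_real_divide_pos simp: nz)
  qed (use y right_halfplane real in auto)
  show ?thesis
  proof (rule holomorphic_eqI_of_real[where f = "\<lambda>\<beta>. ?L Y \<beta>" and S = UNIV])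
    show "(\<lambda>\<beta>. ?L Y \<beta>) holomorphic_on UNIV"
      by (intro holomorphic_intros holomorphic_weighted_gauss(1)[OF _ _ _ _ one]) (use Y in auto)
    show "(\<lambda>\<beta>. ?R Y \<beta>) holomorphic_on UNIV"
      by (intro holomorphic_intros holomorphic_weighted_gauss(1)[OF _ _ _ _ one])
         (use Y in \<open>auto intro!: Re_of_real_divide_pos\<close>)
  qed (use realb Y in auto)
qed

text \<open>For d = 1 differentiate the case d = 0 in \<beta>: on the left each Gaussian produces -
  2 pi Y (n + \<beta>), on the right each frequency produces 2 pi \<i> m. The quotient of the
  constants is - \<i> / Y.\<close>

lemma poisson_gauss_weighted:
  fixes Y \<beta> :: complex
  assumes Y: "Re Y > 0" and d: "d \<le> 1"
  shows "((\<lambda>n. (of_int n + \<beta>) ^ d * exp (- (of_real pi * Y) * (of_int n + \<beta>)\<^sup>2)) has_sum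
     ((-\<i>) ^ d * Y powr (-1/2 - of_nat d) * (\<Sum>\<^sub>\<infinity>m. of_int m ^ d * exp ((2 * pi * \<i> * \<beta>) * of_int m - (of_real pi / Y) * (of_int m)\<^sup>2)))) UNIV"
proof -
  have one: "norm (1::complex) \<le> 1 * (1 + \<bar>of_int n\<bar> ^ 0)" for n :: int by simp
  define P where "P = (\<lambda>\<beta>. exp (- (of_real pi * Y) * \<beta>\<^sup>2))"
  define q where "q = (\<lambda>(n::int) \<beta>. 1 * exp ((- 2 * of_real pi * Y * \<beta>) * of_int n - (of_real pi * Y) * (of_int n)\<^sup>2))"
  define r where "r = (\<lambda>(m::int) \<beta>. 1 * exp ((2 * pi * \<i> * \<beta>) * of_int m - (of_real pi / Y) * (of_int m)\<^sup>2))"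
  define Q where "Q = (\<lambda>\<beta>. \<Sum>\<^sub>\<infinity>n. q n \<beta>)"
  define R where "R = (\<lambda>\<beta>. \<Sum>\<^sub>\<infinity>m. r m \<beta>)"
  have Y': "Re (of_real pi / Y) > 0" by (rule Re_of_real_divide_pos[OF Y]) simp
  have Y'': "Re (of_real pi * Y) > 0" using Y by simp
  have Q_holo: "Q holomorphic_on UNIV" unfolding Q_def q_def
    by (rule holomorphic_weighted_gauss(1)[OF _ _ _ _ one]) (use Y'' in \<open>auto intro!: holomorphic_intros\<close>)
  have R_holo: "R holomorphic_on UNIV" unfolding R_def r_def
    by (rule holomorphic_weighted_gauss(1)[OF _ _ _ _ one]) (use Y' in \<open>auto intro!: holomorphic_intros\<close>)
  have dQ: "((\<lambda>n. deriv (q n) \<beta>) has_sum deriv Q \<beta>) UNIV" unfolding Q_def q_def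
    by (rule holomorphic_weighted_gauss(2)[where S = UNIV, OF _ _ _ _ one]) (use Y'' in \<open>auto intro!: holomorphic_intros\<close>)
  have dR: "((\<lambda>n. deriv (r n) \<beta>) has_sum deriv R \<beta>) UNIV" unfolding R_def r_def
    by (rule holomorphic_weighted_gauss(2)[where S = UNIV, OF _ _ _ _ one]) (use Y' in \<open>auto intro!: holomorphic_intros\<close>)
  have PQR: "P \<beta> * Q \<beta> = Y powr (-1/2) * R \<beta>" for \<beta>
    unfolding P_def Q_def R_def q_def r_def by (rule poisson_gauss[OF Y])
  have qsum: "((\<lambda>n. q n \<beta>) has_sum Q \<beta>) UNIV" unfolding Q_def
    by (rule has_sum_infsum, rule abs_summable_summable, unfold q_def, rule abs_summable_weighted_gauss[OF Y'' one])
  have qterm: "exp (- (of_real pi * Y) * (of_int n + \<beta>)\<^sup>2) = P \<beta> * q n \<beta>" for n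
    unfolding P_def q_def by (rule gauss_complete_square)
  show ?thesis
  proof (cases "d = 0")
    case True
    have "((\<lambda>n. P \<beta> * q n \<beta>) has_sum (P \<beta> * Q \<beta>)) UNIV"
      by (intro has_sum_cmult_right qsum)
    thus ?thesis unfolding PQR qterm True R_def r_def by simp
  next
    case False
    hence d: "d = 1" using d by simp
    define K where "K = - 2 * of_real pi * Y"
    have K: "K \<noteq> 0" using Y by (auto simp: K_def)
    have Ynz: "Y \<noteq> 0" using Y by auto
    have dq: "deriv (q n) \<beta> = K * of_int n * q n \<beta>" for n
      unfolding q_def K_def by (rule DERIV_imp_deriv) (auto intro!: derivative_eq_intros)
    have dr: "deriv (r n) \<beta> = 2 * pi * \<i> * of_int n * r n \<beta>" for n
      unfolding r_def by (rule DERIV_imp_deriv) (auto intro!: derivative_eq_intros)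
    have P': "(P has_field_derivative K * \<beta> * P \<beta>) (at \<beta>)"
      unfolding P_def K_def by (auto intro!: derivative_eq_intros)
    have Q': "(Q has_field_derivative deriv Q \<beta>) (at \<beta>)" by (rule holomorphic_derivI[OF Q_holo]) auto
    have R': "(R has_field_derivative deriv R \<beta>) (at \<beta>)" by (rule holomorphic_derivI[OF R_holo]) auto
    have "((\<lambda>\<beta>. P \<beta> * Q \<beta>) has_field_derivative (K * \<beta> * P \<beta> * Q \<beta> + P \<beta> * deriv Q \<beta>)) (at \<beta>)"
      using DERIV_mult[OF P' Q'] by (simp add: mult_ac)
    moreover have "((\<lambda>\<beta>. P \<beta> * Q \<beta>) has_field_derivative (Y powr (-1/2) * deriv R \<beta>)) (at \<beta>)"
      unfolding PQR by (rule DERIV_cmult[OF R'])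
    ultimately have eq: "K * \<beta> * P \<beta> * Q \<beta> + P \<beta> * deriv Q \<beta> = Y powr (-1/2) * deriv R \<beta>"
      by (rule DERIV_unique)
    have "((\<lambda>n. K * \<beta> * P \<beta> * q n \<beta> + P \<beta> * deriv (q n) \<beta>) has_sum (K * \<beta> * P \<beta> * Q \<beta> + P \<beta> * deriv Q \<beta>)) UNIV"
      by (intro has_sum_add has_sum_cmult_right qsum dQ)
    hence "((\<lambda>n. 1 / K * (K * \<beta> * P \<beta> * q n \<beta> + P \<beta> * deriv (q n) \<beta>)) has_sum (1 / K * (Y powr (-1/2) * deriv R \<beta>))) UNIV"
      unfolding eq by (rule has_sum_cmult_right)
    also have "(\<lambda>n. 1 / K * (K * \<beta> * P \<beta> * q n \<beta> + P \<beta> * deriv (q n) \<beta>)) = (\<lambda>n. (of_int n + \<beta>) ^ d * exp (- (of_real pi * Y) * (of_int n + \<beta>)\<^sup>2))"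
      unfolding dq qterm d using K by (simp add: fun_eq_iff field_simps)
    also have "deriv R \<beta> = 2 * pi * \<i> * (\<Sum>\<^sub>\<infinity>m. of_int m * r m \<beta>)"
      using infsumI[OF dR] unfolding dr mult.assoc infsum_cmult_right' by simp
    also have "1 / K * (Y powr (-1/2) * (2 * pi * \<i> * (\<Sum>\<^sub>\<infinity>m. of_int m * r m \<beta>))) = -\<i> * (Y powr (-1/2) / Y) * (\<Sum>\<^sub>\<infinity>m. of_int m * r m \<beta>)"
      using Ynz by (simp add: K_def field_simps)
    also have "Y powr (-1/2) / Y = Y powr (-1/2 - of_nat d)"
      using powr_diff[of Y "-1/2" "of_nat 1"] powr_nat'[of Y 1] Ynz unfolding d by simp
    finally show ?thesis by (simp add: d r_def)
  qed
qed

section \<open>Periodic weights and their finite Fourier transform\<close>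

definition dft :: "nat \<Rightarrow> (int \<Rightarrow> complex) \<Rightarrow> int \<Rightarrow> complex" where
  "dft M a m = (\<Sum>r\<in>{0..<int M}. a r * exp (2 * pi * \<i> * of_int r * of_int m / of_nat M))"

lemma norm_dft_le: "norm (dft M a m) \<le> (\<Sum>r\<in>{0..<int M}. norm (a r))"
proof -
  have "norm (dft M a m) \<le> (\<Sum>r\<in>{0..<int M}. norm (a r * exp (2 * pi * \<i> * of_int r * of_int m / of_nat M)))"
    unfolding dft_def by (rule norm_sum)
  also have "\<dots> = (\<Sum>r\<in>{0..<int M}. norm (a r))"
    by (intro sum.cong refl) (simp add: norm_mult)
  finally show ?thesis .
qed

lemma periodic_add_mult:
  assumes "\<And>n. a (n + int M) = a n"
  shows "a (int M * k + n) = a n"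
proof (induction k rule: int_induct[where k = 0])
  case (step1 i)
  have "a (int M * (i + 1) + n) = a ((int M * i + n) + int M)" by (simp add: algebra_simps)
  thus ?case using assms step1 by simp
next
  case (step2 i)
  have "a (int M * i + n) = a ((int M * (i - 1) + n) + int M)" by (simp add: algebra_simps)
  thus ?case using assms step2 by simp
qed simp

lemma periodic_norm_le:
  fixes a :: "int \<Rightarrow> complex"
  assumes M: "M > 0" and per: "\<And>n. a (n + int M) = a n"
  shows "norm (a n) \<le> (\<Sum>r\<in>{0..<int M}. norm (a r))"
proof -
  have "a n = a (n mod int M)"
    using periodic_add_mult[of a M "n div int M" "n mod int M", OF per] by simp
  thus ?thesis using M by (simp, intro member_le_sum) auto
qed

lemma has_sum_sum:
  fixes f :: "'a \<Rightarrow> 'b \<Rightarrow> complex"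
  assumes "finite R" "\<And>r. r \<in> R \<Longrightarrow> (f r has_sum S r) A"
  shows "((\<lambda>x. \<Sum>r\<in>R. f r x) has_sum (\<Sum>r\<in>R. S r)) A"
  using assms by (induction R rule: finite_induct) (auto intro!: has_sum_add)

lemma abs_summable_periodic_gauss:
  fixes a :: "int \<Rightarrow> complex"
  assumes M: "M > 0" and per: "\<And>n. a (n + int M) = a n" and X: "Re X > 0"
  shows "(\<lambda>n. norm (of_int n ^ d * a n * exp (- (of_real pi * X) * (of_int n)\<^sup>2))) summable_on UNIV"
proof -
  define K where "K = (\<Sum>r\<in>{0..<int M}. norm (a r))"
  have "K \<ge> 0" by (auto simp: K_def intro!: sum_nonneg)
  moreover have "norm (a n) \<le> K" for n unfolding K_def by (rule periodic_norm_le[of M a, OF M per])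
  ultimately have "norm (of_int n ^ d * a n) \<le> K * (1 + \<bar>of_int n\<bar> ^ d)" for n :: int
    using mult_mono[of "norm (a n)" K "\<bar>of_int n\<bar> ^ d" "1 + \<bar>of_int n\<bar> ^ d"] by (simp add: norm_mult norm_power mult.commute)
  from abs_summable_weighted_gauss[of "of_real pi * X" "\<lambda>n. of_int n ^ d * a n", OF _ this, of 0] X
  show ?thesis by simp
qed

text \<open>Sorting n by its residue r modulo M gives M shifted Gaussian sums with \<beta> = r / M
  and Y = M^2 X. After Poisson summation the phases exp (2 pi \<i> r m / M) assemble to
  \<open>dft\<close>, whose sign and normalisation are chosen for this. The modulus M is q for the
  behaviour at 0 and 2 q for the cusp \<i>.\<close>

lemma theta_periodic_transform:
  fixes a :: "int \<Rightarrow> complex"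
  assumes M: "M > 0" and per: "\<And>n. a (n + int M) = a n" and X: "Re X > 0" and d: "d \<le> 1"
  shows "(\<Sum>\<^sub>\<infinity>n. of_int n ^ d * a n * exp (- (of_real pi * X) * (of_int n)\<^sup>2)) =
     of_nat M ^ d * (-\<i>) ^ d * (of_nat M ^ 2 * X) powr (-1/2 - of_nat d) *
     (\<Sum>\<^sub>\<infinity>m. of_int m ^ d * dft M a m * exp (- (of_real pi / (of_nat M ^ 2 * X)) * (of_int m)\<^sup>2))"
proof -
  define Y where "Y = of_nat M ^ 2 * X"
  have Y: "Re Y > 0" using X M by (simp add: Y_def flip: of_nat_power)
  have pY: "Re (of_real pi / Y) > 0" by (rule Re_of_real_divide_pos[OF Y]) simp
  define g where "g = (\<lambda>n. of_int n ^ d * a n * exp (- (of_real pi * X) * (of_int n)\<^sup>2))"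
  define \<phi> where "\<phi> = (\<lambda>(r, n). int M * n + r)"
  define I where "I = {0..<int M}"
  have bij: "bij_betw \<phi> (I \<times> UNIV) UNIV"
    by (rule bij_betw_byWitness[where f' = "\<lambda>m. (m mod int M, m div int M)"]) (use M in \<open>auto simp: \<phi>_def I_def\<close>)
  have g_sum: "g summable_on UNIV"
    by (rule abs_summable_summable) (unfold g_def, rule abs_summable_periodic_gauss[of M a, OF M per X])
  have g_term: "g (int M * n + r) = of_nat M ^ d * a r * ((of_int n + of_int r / of_nat M) ^ d * exp (- (of_real pi * Y) * (of_int n + of_int r / of_nat M)\<^sup>2))" for n r
  proof -
    have e: "of_int (int M * n + r) = (of_nat M * (of_int n + of_int r / of_nat M) :: complex)"
      using M by (simp add: field_simps)
    show ?thesis unfolding g_def periodic_add_mult[of a M, OF per] e Y_def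
      by (simp add: power_mult_distrib mult_ac)
  qed
  define S where "S = (\<lambda>r::int. of_nat M ^ d * a r * ((-\<i>) ^ d * Y powr (-1/2 - of_nat d) * (\<Sum>\<^sub>\<infinity>m. of_int m ^ d * exp ((2 * pi * \<i> * (of_int r / of_nat M)) * of_int m - (of_real pi / Y) * (of_int m)\<^sup>2))))"
  have inner: "(\<Sum>\<^sub>\<infinity>n. g (int M * n + r)) = S r" for r
    unfolding g_term S_def by (intro infsumI has_sum_cmult_right poisson_gauss_weighted Y d)
  have "(\<Sum>\<^sub>\<infinity>n. g n) = (\<Sum>\<^sub>\<infinity>x\<in>I \<times> UNIV. g (\<phi> x))"
    using infsum_reindex_bij_betw[OF bij, of g] by simp
  also have "\<dots> = (\<Sum>\<^sub>\<infinity>r\<in>I. \<Sum>\<^sub>\<infinity>n. g (\<phi> (r, n)))"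
    by (rule infsum_Sigma_banach[symmetric]) (use summable_on_reindex_bij_betw[OF bij, of g] g_sum in simp)
  also have "\<dots> = (\<Sum>r\<in>I. S r)"
    by (simp add: \<phi>_def inner I_def)
  also have "\<dots> = of_nat M ^ d * (-\<i>) ^ d * Y powr (-1/2 - of_nat d) * (\<Sum>r\<in>I. a r * (\<Sum>\<^sub>\<infinity>m. of_int m ^ d * exp ((2 * pi * \<i> * (of_int r / of_nat M)) * of_int m - (of_real pi / Y) * (of_int m)\<^sup>2)))"
    unfolding S_def sum_distrib_left by (intro sum.cong) (auto simp: mult_ac)
  also have "(\<Sum>r\<in>I. a r * (\<Sum>\<^sub>\<infinity>m. of_int m ^ d * exp ((2 * pi * \<i> * (of_int r / of_nat M)) * of_int m - (of_real pi / Y) * (of_int m)\<^sup>2)))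
     = (\<Sum>\<^sub>\<infinity>m. \<Sum>r\<in>I. a r * (of_int m ^ d * exp ((2 * pi * \<i> * (of_int r / of_nat M)) * of_int m - (of_real pi / Y) * (of_int m)\<^sup>2)))"
  proof (rule infsumI[symmetric], rule has_sum_sum)
    fix r
    show "((\<lambda>m. a r * (of_int m ^ d * exp ((2 * pi * \<i> * (of_int r / of_nat M)) * of_int m - (of_real pi / Y) * (of_int m)\<^sup>2))) has_sum
       (a r * (\<Sum>\<^sub>\<infinity>m. of_int m ^ d * exp ((2 * pi * \<i> * (of_int r / of_nat M)) * of_int m - (of_real pi / Y) * (of_int m)\<^sup>2)))) UNIV"
      by (rule has_sum_cmult_right, rule has_sum_infsum, rule abs_summable_summable,
          rule abs_summable_weighted_gauss[OF pY, where K = 1 and d = d]) (simp add: norm_power)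
  qed (simp add: I_def)
  also have "(\<lambda>m. \<Sum>r\<in>I. a r * (of_int m ^ d * exp ((2 * pi * \<i> * (of_int r / of_nat M)) * of_int m - (of_real pi / Y) * (of_int m)\<^sup>2)))
     = (\<lambda>m. of_int m ^ d * dft M a m * exp (- (of_real pi / Y) * (of_int m)\<^sup>2))"
  proof
    fix m :: int
    have "exp ((2 * pi * \<i> * (of_int r / of_nat M)) * of_int m - (of_real pi / Y) * (of_int m)\<^sup>2) =
        exp (2 * pi * \<i> * of_int r * of_int m / of_nat M) * exp (- (of_real pi / Y) * (of_int m)\<^sup>2)" for r
      unfolding exp_add[symmetric] by (rule arg_cong[of _ _ exp]) simp
    thus "(\<Sum>r\<in>I. a r * (of_int m ^ d * exp ((2 * pi * \<i> * (of_int r / of_nat M)) * of_int m - (of_real pi / Y) * (of_int m)\<^sup>2))) =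
       of_int m ^ d * dft M a m * exp (- (of_real pi / Y) * (of_int m)\<^sup>2)"
      unfolding dft_def I_def sum_distrib_left sum_distrib_right by (intro sum.cong) (auto simp: mult_ac)
  qed
  finally show ?thesis unfolding g_def Y_def .
qed

subsection \<open>Mellin transforms on rays\<close>

text \<open>The exponent p takes both signs, so the bound expresses rapid decay at infinity and at 0
  alike, in every closed sector inside the right half-plane.\<close>

definition sector_decay :: "(complex \<Rightarrow> complex) \<Rightarrow> bool" where
  "sector_decay T \<longleftrightarrow> T holomorphic_on {x. Re x > 0} \<and>
     (\<forall>\<sigma>>0. \<forall>p::real. \<exists>C. \<forall>x. x \<noteq> 0 \<and> \<sigma> * norm x \<le> Re x \<longrightarrow> norm (T x) \<le> C * norm x powr p)"

text \<open>Cauchy's inequality on a disc of radius proportional to |x|, which stays in a slightly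
  wider sector. The constant is independent of m, and the dependence on m is only factorial times
  geometric; this is what allows the operator of infinite order to be summed.\<close>

lemma sector_decay_deriv_bound:
  assumes T: "sector_decay T" and \<sigma>: "\<sigma> > 0"
  shows "\<exists>C\<ge>0. \<forall>m x. x \<noteq> 0 \<and> \<sigma> * norm x \<le> Re x \<longrightarrow>
           norm (x ^ m * (deriv ^^ m) T x) \<le> C * fact m / (min \<sigma> 1 / 2) ^ m * norm x powr p"
proof -
  define r where "r = min \<sigma> 1 / 2"
  \<comment> \<open>On the disc Re z \<ge> \<sigma> / 2 * |x| and |z| \<le> 3 / 2 * |x|, which puts
    z into the sector with parameter \<sigma> / 3.\<close>
  have r: "r > 0" "r \<le> \<sigma> / 2" "r \<le> 1 / 2" using \<sigma> by (auto simp: r_def)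
  obtain C0 where C0: "\<And>x. x \<noteq> 0 \<Longrightarrow> \<sigma> / 3 * norm x \<le> Re x \<Longrightarrow> norm (T x) \<le> C0 * norm x powr p"
    using T \<sigma> unfolding sector_decay_def by (meson divide_pos_pos zero_less_numeral)
  define C where "C = \<bar>C0\<bar> * 2 powr \<bar>p\<bar>"
  have "norm (x ^ m * (deriv ^^ m) T x) \<le> C * fact m / r ^ m * norm x powr p" if x: "x \<noteq> 0" "\<sigma> * norm x \<le> Re x" for m x
  proof -
    have nx: "norm x > 0" using x by simp
    have sub: "Re z > 0 \<and> norm (T z) \<le> C * norm x powr p" if "z \<in> cball x (r * norm x)" for z
    proof -
      have d: "norm (z - x) \<le> r * norm x" using that by (simp add: dist_norm norm_minus_commute)
      also have "r * norm x \<le> 1/2 * norm x" using r by (intro mult_right_mono) auto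
      finally have d': "norm (z - x) \<le> norm x / 2" by simp
      have z1: "norm z \<le> 3/2 * norm x" using d' norm_triangle_ineq[of x "z - x"] by simp
      have z2: "norm z \<ge> norm x / 2" using d' norm_triangle_ineq2[of x "x - z"] by (simp add: norm_minus_commute)
      have "Re x - Re z \<le> norm (z - x)" using abs_Re_le_cmod[of "z - x"] by simp
      also have "\<dots> \<le> \<sigma> / 2 * norm x" using d r mult_right_mono[of r "\<sigma>/2" "norm x"] by simp
      finally have "Re z \<ge> \<sigma> / 2 * norm x" using x(2) by simp
      moreover have "\<sigma> / 3 * norm z \<le> \<sigma> / 2 * norm x" using z1 \<sigma> mult_left_mono[OF z1, of "\<sigma>/3"] by simp
      moreover have "0 < \<sigma> / 2 * norm x" using \<sigma> nx by simp
      ultimately have rez: "\<sigma> / 3 * norm z \<le> Re z" "Re z > 0" by linarith+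
      have z0: "z \<noteq> 0" using rez by auto
      have "norm (T z) \<le> C0 * norm z powr p" by (rule C0[OF z0 rez(1)])
      also have "\<dots> \<le> \<bar>C0\<bar> * norm z powr p" by (intro mult_right_mono) auto
      also have "norm z powr p = (norm z / norm x) powr p * norm x powr p"
        using nx z0 by (simp add: powr_divide)
      also have "(norm z / norm x) powr p \<le> 2 powr \<bar>p\<bar>"
      proof (cases "p \<ge> 0")
        case True
        have "norm z \<le> 2 * norm x" using z1 nx by linarith
        hence "norm z / norm x \<le> 2" using nx by (simp add: field_simps)
        thus ?thesis using True nx z0 by (simp add: powr_mono2)
      next
        case False
        have "norm x \<le> 2 * norm z" using z2 by linarith
        hence "norm x / norm z \<le> 2" using z0 by (simp add: field_simps)
        hence "(norm x / norm z) powr (-p) \<le> 2 powr (-p)" using False nx z0 by (intro powr_mono2) auto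
        moreover have "(norm x / norm z) powr (-p) = (norm z / norm x) powr p"
          using nx z0 by (simp add: powr_divide powr_minus field_simps)
        ultimately show ?thesis using False by simp
      qed
      finally show ?thesis using rez by (simp add: C_def mult_left_mono mult_right_mono mult.assoc)
    qed
    have "T holomorphic_on cball x (r * norm x)"
      using T sub by (auto simp: sector_decay_def intro: holomorphic_on_subset)
    hence "norm ((deriv ^^ m) T x) \<le> fact m * (C * norm x powr p) / (r * norm x) ^ m"
      using r nx sub
      by (intro Cauchy_inequality) (auto intro: holomorphic_on_imp_continuous_on holomorphic_on_subset[OF _ ball_subset_cball] simp: dist_norm)
    hence "norm x ^ m * norm ((deriv ^^ m) T x) \<le> norm x ^ m * (fact m * (C * norm x powr p) / (r * norm x) ^ m)"
      by (rule mult_left_mono) simp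
    thus ?thesis using nx r by (simp add: norm_mult norm_power power_mult_distrib field_simps)
  qed
  moreover have "C \<ge> 0" by (simp add: C_def)
  ultimately show ?thesis unfolding r_def by blast
qed

text \<open>These operators commute with dilations, so the Mellin transform turns them into
  multiplication by polynomials in s.\<close>

definition euler :: "(complex \<Rightarrow> complex) \<Rightarrow> nat \<Rightarrow> complex \<Rightarrow> complex" where
  "euler T m x = x ^ m * (deriv ^^ m) T x"

text \<open>The logarithmic coordinate y turns Mellin integrals along a ray into Fourier-type
  integrals over the real line, and the rays into horizontal lines of a strip.\<close>

definition ray :: "real \<Rightarrow> real \<Rightarrow> complex" where
  "ray \<alpha> y = exp (of_real y + \<i> * of_real \<alpha>)"

lemma ray: "norm (ray \<alpha> y) = exp y" "Re (ray \<alpha> y) = exp y * cos \<alpha>" "ray \<alpha> y \<noteq> 0"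
  by (simp_all add: ray_def Re_exp)

lemma ray_Re_pos:
  assumes "\<bar>\<alpha>\<bar> < pi / 2"
  shows "Re (ray \<alpha> y) > 0"
proof -
  have "cos \<alpha> > 0" by (rule cos_gt_zero_pi) (use assms in linarith)+
  thus ?thesis by (simp add: ray)
qed

lemma continuous_ray [continuous_intros]: "continuous_on A (ray \<alpha>)"
  unfolding ray_def by (intro continuous_intros)

lemma ray_bound:
  assumes T: "sector_decay T" and \<alpha>0: "\<alpha>0 < pi / 2" "0 \<le> \<alpha>0" and N: "N \<ge> 0"
  shows "\<exists>r>0. \<exists>C\<ge>0. \<forall>m \<alpha> y. \<bar>\<alpha>\<bar> \<le> \<alpha>0 \<longrightarrow> norm (euler T m (ray \<alpha> y)) \<le> C * fact m / r ^ m * exp (- N * \<bar>y\<bar>)"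
proof -
  define \<sigma> where "\<sigma> = cos \<alpha>0"
  have \<sigma>: "\<sigma> > 0" unfolding \<sigma>_def by (rule cos_gt_zero_pi) (use \<alpha>0 pi_gt_zero in linarith)+
  define r where "r = min \<sigma> 1 / 2"
  have r: "r > 0" using \<sigma> by (simp add: r_def)
  \<comment> \<open>The power N of |x| controls y < 0, the power - N controls y \<ge> 0.\<close>
  obtain C1 where C1: "C1 \<ge> 0" "\<And>m x. x \<noteq> 0 \<Longrightarrow> \<sigma> * norm x \<le> Re x \<Longrightarrow> norm (x ^ m * (deriv ^^ m) T x) \<le> C1 * fact m / r ^ m * norm x powr N"
    using sector_decay_deriv_bound[OF T \<sigma>, of N] unfolding r_def by blast
  obtain C2 where C2: "C2 \<ge> 0" "\<And>m x. x \<noteq> 0 \<Longrightarrow> \<sigma> * norm x \<le> Re x \<Longrightarrow> norm (x ^ m * (deriv ^^ m) T x) \<le> C2 * fact m / r ^ m * norm x powr (-N)"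
    using sector_decay_deriv_bound[OF T \<sigma>, of "-N"] unfolding r_def by blast
  have "norm (euler T m (ray \<alpha> y)) \<le> (C1 + C2) * fact m / r ^ m * exp (- N * \<bar>y\<bar>)" if \<alpha>: "\<bar>\<alpha>\<bar> \<le> \<alpha>0" for m \<alpha> y
  proof -
    have "\<sigma> \<le> cos \<bar>\<alpha>\<bar>" unfolding \<sigma>_def using \<alpha> \<alpha>0 pi_gt_zero by (intro cos_monotone_0_pi_le) auto
    hence s: "\<sigma> * norm (ray \<alpha> y) \<le> Re (ray \<alpha> y)" by (simp add: ray mult.commute)
    have e: "exp y powr q = exp (q * y)" for q by (simp add: powr_def)
    have nn: "0 \<le> fact m / r ^ m" using r by simp
    show ?thesis
    proof (cases "y \<ge> 0")
      case True
      have "norm (euler T m (ray \<alpha> y)) \<le> C2 * (fact m / r ^ m) * exp (- N * \<bar>y\<bar>)"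
        using C2(2)[OF ray(3) s, of m] True by (simp add: euler_def ray e)
      also have "\<dots> \<le> (C1 + C2) * (fact m / r ^ m) * exp (- N * \<bar>y\<bar>)"
        using C1(1) nn by (intro mult_right_mono) auto
      finally show ?thesis by simp
    next
      case False
      have "norm (euler T m (ray \<alpha> y)) \<le> C1 * (fact m / r ^ m) * exp (- N * \<bar>y\<bar>)"
        using C1(2)[OF ray(3) s, of m] False by (simp add: euler_def ray e)
      also have "\<dots> \<le> (C1 + C2) * (fact m / r ^ m) * exp (- N * \<bar>y\<bar>)"
        using C2(1) nn by (intro mult_right_mono) auto
      finally show ?thesis by simp
    qed
  qed
  moreover have "C1 + C2 \<ge> 0" using C1 C2 by simp
  ultimately show ?thesis using r by blast
qed

section \<open>Integrals over the line with exponential decay\<close>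

lemma integrable_exp_abs: "integrable lborel (\<lambda>y::real. exp (- \<bar>y\<bar>))"
proof (rule Bochner_Integration.integrable_bound)
  have "set_integrable lborel (einterval (-\<infinity>) \<infinity>) (\<lambda>x::real. inverse (1 + x\<^sup>2))"
    by (rule integrable_inverse_1_plus_square)
  hence "integrable lborel (\<lambda>x::real. inverse (1 + x\<^sup>2))"
    by (simp add: set_integrable_def)
  thus "integrable lborel (\<lambda>x::real. 2 * inverse (1 + x\<^sup>2))" by simp
  have "exp (- \<bar>y\<bar>) \<le> 2 * inverse (1 + y\<^sup>2)" for y :: real
  proof -
    have "1 + \<bar>y\<bar> + \<bar>y\<bar>\<^sup>2 / 2 \<le> exp \<bar>y\<bar>" by (rule exp_lower_Taylor_quadratic) simp
    hence "(1 + y\<^sup>2) / 2 \<le> exp \<bar>y\<bar>" by simp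
    hence "inverse (exp \<bar>y\<bar>) \<le> inverse ((1 + y\<^sup>2) / 2)"
      by (rule le_imp_inverse_le) (auto intro: add_pos_nonneg)
    thus ?thesis by (simp only: exp_minus inverse_divide divide_inverse[of 2])
  qed
  note a = this
  show "AE x in lborel. norm (exp (- \<bar>x\<bar>)) \<le> norm (2 * inverse (1 + x\<^sup>2) :: real)"
  proof (intro AE_I2)
    fix x :: real
    show "norm (exp (- \<bar>x\<bar>)) \<le> norm (2 * inverse (1 + x\<^sup>2) :: real)"
      using order_trans[OF a[of x] abs_ge_self] by simp
  qed
qed auto

lemma integrable_exp_abs_bound:
  fixes f :: "real \<Rightarrow> complex"
  assumes "continuous_on UNIV f" "\<And>y. norm (f y) \<le> C * exp (- \<bar>y\<bar>)"
  shows "integrable lborel f"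
proof (rule Bochner_Integration.integrable_bound)
  show "integrable lborel (\<lambda>y. C * exp (- \<bar>y\<bar>))" by (intro integrable_mult_right integrable_exp_abs)
  show "f \<in> borel_measurable lborel" using borel_measurable_continuous_onI[OF assms(1)] by simp
  show "AE x in lborel. norm (f x) \<le> norm (C * exp (- \<bar>x\<bar>))"
    using order_trans[OF assms(2) abs_ge_self] by (intro AE_I2) simp
qed

lemma tendsto_exp_abs_bound:
  fixes f :: "real \<Rightarrow> complex"
  assumes "\<And>y. norm (f y) \<le> C * exp (- \<bar>y\<bar>)"
  shows "(f \<longlongrightarrow> 0) at_top" "(f \<longlongrightarrow> 0) at_bot"
proof -
  have "((\<lambda>y. C * exp (- y)) \<longlongrightarrow> C * 0) at_top" "((\<lambda>y. C * exp y) \<longlongrightarrow> C * 0) at_bot"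
    by (intro tendsto_mult tendsto_const; real_asymp)+
  hence l: "((\<lambda>y. C * exp (- y)) \<longlongrightarrow> 0) at_top" "((\<lambda>y. C * exp y) \<longlongrightarrow> 0) at_bot" by simp_all
  show "(f \<longlongrightarrow> 0) at_top"
    by (rule Lim_null_comparison[OF _ l(1)]) (use eventually_ge_at_top[of 0] in eventually_elim, use assms in \<open>metis abs_of_nonneg\<close>)
  show "(f \<longlongrightarrow> 0) at_bot"
    by (rule Lim_null_comparison[OF _ l(2)]) (use eventually_le_at_bot[of 0] in eventually_elim, use assms in \<open>metis abs_of_nonpos minus_minus\<close>)
qed

lemma integral_derivative_eq_0:
  fixes F f :: "real \<Rightarrow> complex"
  assumes F: "\<And>y. (F has_vector_derivative f y) (at y)" and f: "continuous_on UNIV f" "integrable lborel f"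
    and lim: "(F \<longlongrightarrow> 0) at_top" "(F \<longlongrightarrow> 0) at_bot"
  shows "(LBINT y. f y) = 0"
proof -
  have "(LBINT x=-\<infinity>..\<infinity>. f x) = 0 - 0"
    by (rule interval_integral_FTC_integrable[where F = F])
       (use F f lim in \<open>auto simp: ereal_tendsto_simps1 set_integrable_def continuous_on_eq_continuous_at\<close>)
  thus ?thesis by (simp add: interval_lebesgue_integral_def set_lebesgue_integral_def)
qed

definition mellin :: "(complex \<Rightarrow> complex) \<Rightarrow> complex \<Rightarrow> complex" where
  "mellin T s = (LBINT y. exp (s * of_real y) * T (ray 0 y))"

lemma norm_exp_mult_le: "norm (exp (s * of_real y)) \<le> exp (\<bar>Re s\<bar> * \<bar>y\<bar>)"
  by (simp add: abs_mult[symmetric])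

lemma higher_deriv_holomorphic_rhp:
  assumes "sector_decay T"
  shows "(deriv ^^ m) T holomorphic_on {x. Re x > 0}"
  using assms unfolding sector_decay_def by (intro holomorphic_higher_deriv open_halfspace_Re_gt) auto

lemma continuous_euler_ray:
  assumes "sector_decay T" "\<bar>\<alpha>\<bar> < pi / 2"
  shows "continuous_on UNIV (\<lambda>y. euler T m (ray \<alpha> y))"
  unfolding euler_def
  by (intro continuous_intros continuous_on_compose2[OF holomorphic_on_imp_continuous_on[OF higher_deriv_holomorphic_rhp[OF assms(1)]]])
     (use ray_Re_pos[OF assms(2)] in auto)

lemma euler_ray_bound:
  assumes T: "sector_decay T" and \<alpha>: "\<bar>\<alpha>\<bar> < pi / 2"
  shows "\<exists>r>0. \<exists>C\<ge>0. \<forall>m y. norm (exp (s * of_real y) * euler T m (ray \<alpha> y)) \<le> C * fact m / r ^ m * exp (- \<bar>y\<bar>)"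
proof -
  have "\<exists>r>0. \<exists>C\<ge>0. \<forall>m \<alpha>' y. \<bar>\<alpha>'\<bar> \<le> \<bar>\<alpha>\<bar> \<longrightarrow>
      norm (euler T m (ray \<alpha>' y)) \<le> C * fact m / r ^ m * exp (- (\<bar>Re s\<bar> + 1) * \<bar>y\<bar>)"
    by (rule ray_bound[OF T \<alpha>]) auto
  then obtain r C where rC0: "r > 0" "C \<ge> 0" and rC1: "\<forall>m \<alpha>' y. \<bar>\<alpha>'\<bar> \<le> \<bar>\<alpha>\<bar> \<longrightarrow>
      norm (euler T m (ray \<alpha>' y)) \<le> C * fact m / r ^ m * exp (- (\<bar>Re s\<bar> + 1) * \<bar>y\<bar>)"
    by (elim exE conjE) (rule that, assumption+)
  have rC: "r > 0" "C \<ge> 0" "norm (euler T m (ray \<alpha> y)) \<le> C * fact m / r ^ m * exp (- (\<bar>Re s\<bar> + 1) * \<bar>y\<bar>)" for m y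
    using rC0 rC1[rule_format, of \<alpha> m y] by simp_all
  have "norm (exp (s * of_real y) * euler T m (ray \<alpha> y)) \<le> C * fact m / r ^ m * exp (- \<bar>y\<bar>)" for m y
  proof -
    have "norm (exp (s * of_real y) * euler T m (ray \<alpha> y)) \<le> exp (\<bar>Re s\<bar> * \<bar>y\<bar>) * (C * fact m / r ^ m * exp (- (\<bar>Re s\<bar> + 1) * \<bar>y\<bar>))"
      unfolding norm_mult by (intro mult_mono norm_exp_mult_le rC) auto
    also have "\<dots> = C * fact m / r ^ m * (exp (\<bar>Re s\<bar> * \<bar>y\<bar>) * exp (- (\<bar>Re s\<bar> + 1) * \<bar>y\<bar>))" by simp
    also have "exp (\<bar>Re s\<bar> * \<bar>y\<bar>) * exp (- (\<bar>Re s\<bar> + 1) * \<bar>y\<bar>) = exp (- \<bar>y\<bar>)"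
      unfolding exp_add[symmetric] by (simp add: algebra_simps)
    finally show ?thesis .
  qed
  thus ?thesis using rC by blast
qed

lemma integrable_euler_ray:
  assumes T: "sector_decay T" and \<alpha>: "\<bar>\<alpha>\<bar> < pi / 2"
  shows "integrable lborel (\<lambda>y. exp (s * of_real y) * euler T m (ray \<alpha> y))"
proof -
  from euler_ray_bound[OF assms, of s]
  obtain r C where C: "\<forall>m y. norm (exp (s * of_real y) * euler T m (ray \<alpha> y)) \<le> C * fact m / r ^ m * exp (- \<bar>y\<bar>)"
    by (elim exE conjE) (rule that, assumption+)
  show ?thesis
  proof (rule integrable_exp_abs_bound)
    show "continuous_on UNIV (\<lambda>y. exp (s * of_real y) * euler T m (ray \<alpha> y))"
      by (intro continuous_intros continuous_euler_ray assms)
  qed (rule C[rule_format])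
qed

text \<open>Integration by parts: the derivative in y of the integrand of order m is (s + m) times
  itself plus the integrand of order m + 1, and its integral vanishes by decay at both ends.\<close>

lemma euler_Suc_integral:
  assumes T: "sector_decay T" and \<alpha>: "\<bar>\<alpha>\<bar> < pi / 2"
  shows "(LBINT y. exp (s * of_real y) * euler T (Suc m) (ray \<alpha> y)) =
     - (s + of_nat m) * (LBINT y. exp (s * of_real y) * euler T m (ray \<alpha> y))"
proof -
  let ?e = "\<lambda>m y. exp (s * of_real y) * euler T m (ray \<alpha> y)"
  have d: "((\<lambda>y. ?e m y) has_vector_derivative ((s + of_nat m) * ?e m y + ?e (Suc m) y)) (at y)" for y
  proof -
    have "(deriv ^^ m) T field_differentiable at (ray \<alpha> y)"
      by (rule holomorphic_on_imp_differentiable_at[OF higher_deriv_holomorphic_rhp[OF T] open_halfspace_Re_gt])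
         (use ray_Re_pos[OF \<alpha>] in simp)
    hence D: "((deriv ^^ m) T has_field_derivative (deriv ^^ Suc m) T (ray \<alpha> y)) (at (ray \<alpha> y))"
      by (simp add: field_differentiable_derivI)
    define R where "R = (\<lambda>w. exp (w + \<i> * of_real \<alpha>))"
    have R: "R (of_real y) = ray \<alpha> y" for y by (simp add: R_def ray_def)
    have R': "(R has_field_derivative ray \<alpha> y) (at (of_real y))"
      unfolding R_def ray_def by (auto intro!: derivative_eq_intros)
    have D': "((\<lambda>w. (deriv ^^ m) T (R w)) has_field_derivative (deriv ^^ Suc m) T (ray \<alpha> y) * ray \<alpha> y) (at (of_real y))"
      by (rule DERIV_chain2[OF _ R']) (use D R in simp)
    have P: "((\<lambda>w. R w ^ m) has_field_derivative of_nat m * ray \<alpha> y ^ m) (at (of_real y))"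
      using DERIV_power[OF R', of m] by (cases m) (simp_all add: R mult_ac)
    have S: "((\<lambda>w. exp (s * w)) has_field_derivative s * exp (s * of_real y)) (at (of_real y))"
      by (auto intro!: derivative_eq_intros)
    have "((\<lambda>w. exp (s * w) * (R w ^ m * (deriv ^^ m) T (R w))) has_field_derivative ((s + of_nat m) * ?e m y + ?e (Suc m) y)) (at (of_real y))"
      by (rule DERIV_cong[OF DERIV_mult[OF S DERIV_mult[OF P D']]]) (simp add: R euler_def algebra_simps)
    from has_vector_derivative_real_field[OF this] show ?thesis by (simp add: R euler_def)
  qed
  from euler_ray_bound[OF assms, of s]
  obtain r C where "\<forall>m y. norm (?e m y) \<le> C * fact m / r ^ m * exp (- \<bar>y\<bar>)"
    by (elim exE conjE) (rule that, assumption+)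
  note C = this[rule_format]
  have "(LBINT y. ((s + of_nat m) * ?e m y + ?e (Suc m) y)) = 0"
  proof (rule integral_derivative_eq_0[OF d])
    show "continuous_on UNIV (\<lambda>y. (s + of_nat m) * ?e m y + ?e (Suc m) y)"
      by (intro continuous_intros continuous_euler_ray assms)
    show "integrable lborel (\<lambda>y. (s + of_nat m) * ?e m y + ?e (Suc m) y)"
      by (intro Bochner_Integration.integrable_add integrable_mult_right integrable_euler_ray assms)
  qed (rule tendsto_exp_abs_bound[OF C])+
  also have "(LBINT y. ((s + of_nat m) * ?e m y + ?e (Suc m) y)) = (s + of_nat m) * (LBINT y. ?e m y) + (LBINT y. ?e (Suc m) y)"
    by (subst Bochner_Integration.integral_add, intro integrable_mult_right integrable_euler_ray assms,
        rule integrable_euler_ray[OF assms], subst integral_mult_right_zero, rule refl)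
  finally have "(LBINT y. ?e (Suc m) y) = - ((s + of_nat m) * (LBINT y. ?e m y))"
    by (simp add: add_eq_0_iff)
  thus ?thesis by (simp only: minus_mult_left)
qed

text \<open>A contour shift in the strip |Im w| < pi / 2. A primitive on the convex strip replaces
  the limit of rectangles.\<close>

lemma mellin_rotate:
  assumes T: "sector_decay T" and \<alpha>: "\<bar>\<alpha>\<bar> < pi / 2"
  shows "(LBINT y. exp (s * of_real y) * T (ray \<alpha> y)) = exp (- s * \<i> * of_real \<alpha>) * mellin T s"
proof -
  define W where "W = {w::complex. \<bar>Im w\<bar> < pi / 2}"
  have W: "open W" "convex W"
  proof -
    have "W = {w. Im w < pi/2} \<inter> {w. Im w > - (pi/2)}" by (auto simp: W_def)
    thus "open W" "convex W"
      by (simp_all only: convex_Int open_Int convex_halfspace_Im_lt convex_halfspace_Im_gt open_halfspace_Im_lt open_halfspace_Im_gt)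
  qed
  define g where "g = (\<lambda>w. exp (s * w) * T (exp w))"
  have "g holomorphic_on W" unfolding g_def
  proof (intro holomorphic_intros)
    have "exp w \<in> {x. Re x > 0}" if "w \<in> W" for w
    proof -
      have "exp w = ray (Im w) (Re w)" by (simp add: ray_def complex_eq_iff Re_exp Im_exp)
      thus ?thesis using ray_Re_pos[of "Im w" "Re w"] that by (simp add: W_def)
    qed
    note rng = this
    have "(T \<circ> exp) holomorphic_on W"
      by (rule holomorphic_on_compose_gen[of _ _ _ "{x. Re x > 0}"])
         (use T rng in \<open>auto simp: sector_decay_def intro!: holomorphic_intros\<close>)
    thus "(\<lambda>w. T (exp w)) holomorphic_on W" by (simp add: o_def)
  qed
  then obtain G where G: "\<And>w. w \<in> W \<Longrightarrow> (G has_field_derivative g w) (at w)"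
    using holomorphic_convex_primitive'[OF W(2,1)] W(1) by (metis at_within_open)
  have "\<exists>r>0. \<exists>C\<ge>0. \<forall>m \<alpha>' y. \<bar>\<alpha>'\<bar> \<le> \<bar>\<alpha>\<bar> \<longrightarrow>
      norm (euler T m (ray \<alpha>' y)) \<le> C * fact m / r ^ m * exp (- (\<bar>Re s\<bar> + 1) * \<bar>y\<bar>)"
    by (rule ray_bound[OF T \<alpha>]) auto
  then obtain r C where rC1: "\<forall>m \<alpha>' y. \<bar>\<alpha>'\<bar> \<le> \<bar>\<alpha>\<bar> \<longrightarrow>
      norm (euler T m (ray \<alpha>' y)) \<le> C * fact m / r ^ m * exp (- (\<bar>Re s\<bar> + 1) * \<bar>y\<bar>)"
    by (elim exE conjE) (rule that, assumption+)
  note rC = rC1[rule_format]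
  define B where "B = C * exp (norm s * \<bar>\<alpha>\<bar>)"
  have C0: "C \<ge> 0" using order_trans[OF norm_ge_zero rC[of 0 0 0]] by simp
  have gB: "norm (g (of_real y + \<i> * of_real \<alpha>')) \<le> B * exp (- \<bar>y\<bar>)" if "\<bar>\<alpha>'\<bar> \<le> \<bar>\<alpha>\<bar>" for \<alpha>' y
  proof -
    have "norm (exp (s * (of_real y + \<i> * of_real \<alpha>'))) = norm (exp (s * of_real y)) * norm (exp (s * \<i> * of_real \<alpha>'))"
      unfolding norm_mult[symmetric] exp_add[symmetric] by (simp add: algebra_simps)
    also have "norm (exp (s * \<i> * of_real \<alpha>')) \<le> exp (norm (s * \<i> * of_real \<alpha>'))" by (rule norm_exp)
    also have "\<dots> \<le> exp (norm s * \<bar>\<alpha>\<bar>)" using that by (simp add: norm_mult mult_left_mono)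
    also have "norm (exp (s * of_real y)) \<le> exp (\<bar>Re s\<bar> * \<bar>y\<bar>)" by (rule norm_exp_mult_le)
    finally have e: "norm (exp (s * (of_real y + \<i> * of_real \<alpha>'))) \<le> exp (\<bar>Re s\<bar> * \<bar>y\<bar>) * exp (norm s * \<bar>\<alpha>\<bar>)"
      by (simp add: mult_left_mono mult_right_mono)
    have "norm (T (ray \<alpha>' y)) \<le> C * exp (- (\<bar>Re s\<bar> + 1) * \<bar>y\<bar>)" using rC[OF that, of 0 y] by (simp add: euler_def)
    hence "norm (g (of_real y + \<i> * of_real \<alpha>')) \<le> (exp (\<bar>Re s\<bar> * \<bar>y\<bar>) * exp (norm s * \<bar>\<alpha>\<bar>)) * (C * exp (- (\<bar>Re s\<bar> + 1) * \<bar>y\<bar>))"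
      unfolding g_def norm_mult ray_def by (intro mult_mono e) auto
    also have "\<dots> = B * (exp (\<bar>Re s\<bar> * \<bar>y\<bar>) * exp (- (\<bar>Re s\<bar> + 1) * \<bar>y\<bar>))" by (simp add: B_def)
    also have "exp (\<bar>Re s\<bar> * \<bar>y\<bar>) * exp (- (\<bar>Re s\<bar> + 1) * \<bar>y\<bar>) = exp (- \<bar>y\<bar>)"
      unfolding exp_add[symmetric] by (simp add: algebra_simps)
    finally show ?thesis .
  qed
  have inW: "of_real y + \<i> * of_real \<alpha>' \<in> W" if "\<bar>\<alpha>'\<bar> \<le> \<bar>\<alpha>\<bar>" for \<alpha>' y
    using that \<alpha> by (simp add: W_def)
  define g1 where "g1 = (\<lambda>\<alpha>' y. g (of_real y + \<i> * of_real \<alpha>'))"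
  have cont1: "continuous_on UNIV (g1 \<alpha>')" if "\<bar>\<alpha>'\<bar> \<le> \<bar>\<alpha>\<bar>" for \<alpha>'
    unfolding g1_def using inW[OF that]
    by (intro continuous_on_compose2[OF holomorphic_on_imp_continuous_on[OF \<open>g holomorphic_on W\<close>]]) (auto intro!: continuous_intros)
  have int1: "integrable lborel (g1 \<alpha>')" if "\<bar>\<alpha>'\<bar> \<le> \<bar>\<alpha>\<bar>" for \<alpha>'
    using cont1[OF that] gB[OF that] by (intro integrable_exp_abs_bound) (auto simp: g1_def)
  \<comment> \<open>The integral of g over the vertical segment at abscissa y, hence small at both
    ends; its derivative in y is the difference of the two integrands.\<close>
  define F where "F = (\<lambda>y::real. G (of_real y + \<i> * of_real \<alpha>) - G (of_real y + \<i> * of_real 0))"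
  have F': "(F has_vector_derivative (g1 \<alpha> y - g1 0 y)) (at y)" for y
  proof -
    have "((\<lambda>w. G (w + \<i> * of_real \<alpha>')) has_field_derivative g (of_real y + \<i> * of_real \<alpha>') * 1) (at (of_real y))" if "\<bar>\<alpha>'\<bar> \<le> \<bar>\<alpha>\<bar>" for \<alpha>'
      by (rule DERIV_chain2[where f = G and g = "\<lambda>w. w + \<i> * of_real \<alpha>'", OF G[OF inW[OF that]]]) (auto intro!: derivative_eq_intros)
    from DERIV_diff[OF this this, of \<alpha> 0] show ?thesis unfolding F_def g1_def
      by (intro has_vector_derivative_real_field) simp
  qed
  have FB: "norm (F y) \<le> B * \<bar>\<alpha>\<bar> * exp (- \<bar>y\<bar>)" for y
  proof -
    let ?S = "closed_segment (of_real y + \<i> * of_real \<alpha>) (of_real y + \<i> * of_real 0)"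
    have seg: "\<exists>\<alpha>'. w = of_real y + \<i> * of_real \<alpha>' \<and> \<bar>\<alpha>'\<bar> \<le> \<bar>\<alpha>\<bar>" if w: "w \<in> ?S" for w
    proof -
      obtain u where u: "0 \<le> u" "u \<le> 1" "w = (1 - u) *\<^sub>R (of_real y + \<i> * of_real \<alpha>) + u *\<^sub>R (of_real y + \<i> * of_real 0)"
        using w by (auto simp: closed_segment_def)
      have "w = of_real y + \<i> * of_real ((1 - u) * \<alpha>)" unfolding u(3) by (simp add: complex_eq_iff algebra_simps)
      moreover have "\<bar>(1 - u) * \<alpha>\<bar> \<le> \<bar>\<alpha>\<bar>" using u by (simp add: abs_mult mult_left_le_one_le)
      ultimately show ?thesis by blast
    qed
    have "norm (G (of_real y + \<i> * of_real \<alpha>) - G (of_real y + \<i> * of_real 0)) \<le> B * exp (- \<bar>y\<bar>) * norm ((of_real y + \<i> * of_real \<alpha>) - (of_real y + \<i> * of_real 0))"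
    proof (rule field_differentiable_bound[of ?S])
      fix w assume "w \<in> ?S"
      from seg[OF this] inW gB G show "(G has_field_derivative g w) (at w within ?S)" "norm (g w) \<le> B * exp (- \<bar>y\<bar>)"
        by (auto intro: has_field_derivative_at_within)
    qed auto
    thus ?thesis by (simp add: F_def norm_mult mult_ac)
  qed
  have "(LBINT y. g1 \<alpha> y - g1 0 y) = 0"
    by (rule integral_derivative_eq_0[OF F'])
       (rule tendsto_exp_abs_bound[OF FB] | intro continuous_intros cont1 Bochner_Integration.integrable_diff int1 | simp)+
  hence "(LBINT y. g1 \<alpha> y) = (LBINT y. g1 0 y)"
    by (subst (asm) Bochner_Integration.integral_diff) (auto intro!: int1)
  moreover have "g1 \<alpha> y = exp (s * \<i> * of_real \<alpha>) * (exp (s * of_real y) * T (ray \<alpha> y))" for y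
    by (simp add: g1_def g_def ray_def exp_add distrib_left mult_ac)
  moreover have "(LBINT y. g1 0 y) = mellin T s"
    by (simp add: g1_def g_def mellin_def ray_def)
  ultimately have "exp (s * \<i> * of_real \<alpha>) * (LBINT y. exp (s * of_real y) * T (ray \<alpha> y)) = mellin T s"
    by simp
  hence "exp (- s * \<i> * of_real \<alpha>) * exp (s * \<i> * of_real \<alpha>) * (LBINT y. exp (s * of_real y) * T (ray \<alpha> y)) = exp (- s * \<i> * of_real \<alpha>) * mellin T s"
    by (simp only: mult.assoc)
  thus ?thesis by (simp add: exp_minus)
qed

section \<open>Kummer series and the operator of infinite order\<close>

lemma summable_power_div_pochhammer:
  assumes "\<beta> > (0::real)"
  shows "summable (\<lambda>m. t ^ m / pochhammer \<beta> m)"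
proof -
  obtain N :: nat where N: "2 * \<bar>t\<bar> \<le> real N" using real_arch_simple by blast
  show ?thesis
  proof (rule summable_ratio_test[of "1/2" N])
    fix n assume n: "n \<ge> N"
    have p: "pochhammer \<beta> n > 0" using assms by (rule pochhammer_pos)
    have "norm (t ^ Suc n / pochhammer \<beta> (Suc n)) = (\<bar>t\<bar> / (\<beta> + real n)) * norm (t ^ n / pochhammer \<beta> n)"
      using p assms by (simp add: pochhammer_Suc abs_mult power_abs)
    also have "\<dots> \<le> 1/2 * norm (t ^ n / pochhammer \<beta> n)"
      using n N assms by (intro mult_right_mono) (auto simp: field_simps)
    finally show "norm (t ^ Suc n / pochhammer \<beta> (Suc n)) \<le> 1/2 * norm (t ^ n / pochhammer \<beta> n)" .
  qed simp
qed

lemma norm_pochhammer_of_real: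
  assumes "\<beta> > (0::real)"
  shows "norm (pochhammer (complex_of_real \<beta>) m) = pochhammer \<beta> m"
  using pochhammer_pos[OF assms, of m] by (simp add: pochhammer_of_real)

lemma pochhammer_of_real_nonzero:
  assumes "\<beta> > (0::real)"
  shows "pochhammer (complex_of_real \<beta>) m \<noteq> 0"
  using pochhammer_pos[OF assms, of m] by (simp add: pochhammer_of_real)

lemma summable_kummer:
  assumes \<beta>: "\<beta> > (0::real)"
  shows "summable (\<lambda>n. norm (pochhammer a n / pochhammer (complex_of_real \<beta>) n * z ^ n / fact n))"
proof -
  \<comment> \<open>Q bounds |a + n| / (\<beta> + n) for all n; the remaining factor |z| / (n + 1)
    then brings the ratio below 1/2.\<close>
  define Q where "Q = norm a / \<beta> + 1"
  have Q: "Q > 0" using \<beta> by (simp add: Q_def add_nonneg_pos)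
  obtain N :: nat where N: "2 * Q * norm z \<le> real N" using real_arch_simple by blast
  show ?thesis
  proof (rule summable_ratio_test[of "1/2" N])
    fix n assume n: "n \<ge> N"
    have p: "pochhammer (complex_of_real \<beta>) n \<noteq> 0" by (rule pochhammer_of_real_nonzero[OF \<beta>])
    have b: "norm (complex_of_real \<beta> + of_nat n) = \<beta> + real n"
      using \<beta> by (metis abs_of_nonneg add_nonneg_nonneg less_imp_le norm_of_real of_nat_0_le_iff of_real_add of_real_of_nat_eq)
    have "pochhammer a (Suc n) / pochhammer (complex_of_real \<beta>) (Suc n) * z ^ Suc n / fact (Suc n) =
       ((a + of_nat n) / (complex_of_real \<beta> + of_nat n) * (z / of_nat (Suc n))) * (pochhammer a n / pochhammer (complex_of_real \<beta>) n * z ^ n / fact n)"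
      by (simp add: pochhammer_Suc mult_ac)
    hence s1: "norm (pochhammer a (Suc n) / pochhammer (complex_of_real \<beta>) (Suc n) * z ^ Suc n / fact (Suc n)) =
       norm (a + of_nat n) / (\<beta> + real n) * (norm z / real (Suc n)) * norm (pochhammer a n / pochhammer (complex_of_real \<beta>) n * z ^ n / fact n)"
      by (simp only: norm_mult norm_divide b norm_of_nat)
    have s2: "norm (a + of_nat n) / (\<beta> + real n) * (norm z / real (Suc n)) \<le> Q * (norm z / real (Suc n))"
    proof (rule mult_right_mono)
      have "norm (a + of_nat n) \<le> norm a + real n" using norm_triangle_ineq[of a "of_nat n"] by simp
      also have "\<dots> \<le> Q * (\<beta> + real n)" using \<beta> by (simp add: Q_def field_simps)
      finally show "norm (a + of_nat n) / (\<beta> + real n) \<le> Q" using \<beta> by (simp add: pos_divide_le_eq add_pos_nonneg)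
    qed simp
    have s3: "Q * (norm z / real (Suc n)) \<le> 1/2"
    proof -
      have "2 * (Q * norm z) \<le> real (Suc n)" using n N by simp
      thus ?thesis by (simp add: pos_divide_le_eq)
    qed
    have "norm (pochhammer a (Suc n) / pochhammer (complex_of_real \<beta>) (Suc n) * z ^ Suc n / fact (Suc n)) \<le> 1/2 * norm (pochhammer a n / pochhammer (complex_of_real \<beta>) n * z ^ n / fact n)"
      unfolding s1 using s2 s3 by (intro mult_right_mono norm_ge_zero) linarith
    thus "norm (norm (pochhammer a (Suc n) / pochhammer (complex_of_real \<beta>) (Suc n) * z ^ Suc n / fact (Suc n))) \<le> 1/2 * norm (norm (pochhammer a n / pochhammer (complex_of_real \<beta>) n * z ^ n / fact n))"
      by (simp only: real_norm_def abs_norm_cancel)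
  qed simp
qed

text \<open>The Mellin transform of \<open>x ^ m * (deriv ^^ m) T x\<close> is \<open>(- 1) ^ m * pochhammer s m\<close> times that of
  \<open>T\<close>, so this operator corresponds to multiplication by the Kummer function of \<open>s\<close>, \<open>\<beta>\<close> and \<open>- u\<close>.\<close>
definition kop :: "real \<Rightarrow> complex \<Rightarrow> (complex \<Rightarrow> complex) \<Rightarrow> complex \<Rightarrow> complex" where
  "kop \<beta> u T x = (\<Sum>m. u ^ m / (pochhammer (of_real \<beta>) m * fact m) * euler T m x)"

lemma euler_integral:
  assumes T: "sector_decay T" and \<alpha>: "\<bar>\<alpha>\<bar> < pi / 2"
  shows "(LBINT y. exp (s * of_real y) * euler T m (ray \<alpha> y)) =
     (-1) ^ m * pochhammer s m * (exp (- s * \<i> * of_real \<alpha>) * mellin T s)"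
proof (induction m)
  case 0
  thus ?case using mellin_rotate[OF assms] by (simp add: euler_def)
next
  case (Suc m)
  show ?case unfolding euler_Suc_integral[OF assms] Suc by (simp add: pochhammer_Suc algebra_simps)
qed

text \<open>One summable majorant in m, with a common factor exp (- |y|), yields continuity, decay
  and termwise integration. The sign (-1)^m of \<open>euler_integral\<close> is the reason for - u
  in the Kummer function.\<close>

lemma kop_ray:
  assumes T: "sector_decay T" and \<alpha>: "\<bar>\<alpha>\<bar> < pi / 2" and \<beta>: "\<beta> > 0"
  shows "continuous_on UNIV (\<lambda>y. exp (s * of_real y) * kop \<beta> u T (ray \<alpha> y))" (is ?th1)
    and "\<exists>C. \<forall>y. norm (exp (s * of_real y) * kop \<beta> u T (ray \<alpha> y)) \<le> C * exp (- \<bar>y\<bar>)" (is ?th2)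
    and "(LBINT y. exp (s * of_real y) * kop \<beta> u T (ray \<alpha> y)) =
           exp (- s * \<i> * of_real \<alpha>) * mellin T s * kummer_1F1 s (of_real \<beta>) (- u)" (is ?th3)
proof -
  from euler_ray_bound[OF T \<alpha>, of s]
  obtain r C where rC: "r > 0" "C \<ge> 0" and bd0: "\<forall>m y. norm (exp (s * of_real y) * euler T m (ray \<alpha> y)) \<le> C * fact m / r ^ m * exp (- \<bar>y\<bar>)"
    by (elim exE conjE) (rule that, assumption+)
  define co where "co = (\<lambda>m. u ^ m / (pochhammer (complex_of_real \<beta>) m * fact m))"
  define e where "e = (\<lambda>m y. co m * (exp (s * of_real y) * euler T m (ray \<alpha> y)))"
  \<comment> \<open>The m! of Cauchy's estimate cancels the m! in the coefficients of
    \<open>kop\<close>; convergence for every u rests on the Pochhammer symbol alone.\<close>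
  define B where "B = (\<lambda>m. C * ((norm u / r) ^ m / pochhammer \<beta> m))"
  have B_sum: "summable B" unfolding B_def by (intro summable_mult summable_power_div_pochhammer \<beta>)
  have pp: "pochhammer \<beta> m > 0" for m using \<beta> by (rule pochhammer_pos)
  have eB: "norm (e m y) \<le> B m * exp (- \<bar>y\<bar>)" for m y
  proof -
    have "norm (e m y) \<le> norm (co m) * (C * fact m / r ^ m * exp (- \<bar>y\<bar>))"
      unfolding e_def norm_mult[of "co m"] by (intro mult_left_mono bd0[rule_format]) simp
    also have "norm (co m) = norm u ^ m / (pochhammer \<beta> m * fact m)"
      by (simp add: co_def norm_divide norm_mult norm_power norm_pochhammer_of_real[OF \<beta>])
    also have "norm u ^ m / (pochhammer \<beta> m * fact m) * (C * fact m / r ^ m * exp (- \<bar>y\<bar>)) = B m * exp (- \<bar>y\<bar>)"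
      using rC pp[of m] by (simp add: B_def power_divide field_simps)
    finally show ?thesis .
  qed
  have B0: "B m \<ge> 0" for m using rC pp[of m] by (simp add: B_def)
  have eB': "norm (e m y) \<le> B m" for m y
    using order_trans[OF eB mult_left_mono[of "exp (- \<bar>y\<bar>)" 1 "B m"]] B0 by simp
  have e_sum: "summable (\<lambda>m. norm (e m y))" for y
    by (rule summable_comparison_test'[OF B_sum]) (use eB' in simp)
  have kop_e: "exp (s * of_real y) * kop \<beta> u T (ray \<alpha> y) = (\<Sum>m. e m y)" for y
  proof -
    have "e m y = exp (s * of_real y) * (co m * euler T m (ray \<alpha> y))" for m by (simp add: e_def)
    hence "(\<Sum>m. e m y) = (\<Sum>m. exp (s * of_real y) * (co m * euler T m (ray \<alpha> y)))" by simp
    also have "\<dots> = exp (s * of_real y) * (\<Sum>m. co m * euler T m (ray \<alpha> y))"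
    proof (rule suminf_mult)
      have "summable (\<lambda>m. exp (- (s * of_real y)) * e m y)" by (intro summable_mult summable_norm_cancel[OF e_sum])
      thus "summable (\<lambda>m. co m * euler T m (ray \<alpha> y))"
        by (simp add: e_def exp_minus field_simps)
    qed
    finally show ?thesis by (simp add: kop_def co_def)
  qed
  have e_cont: "continuous_on UNIV (e m)" for m
    unfolding e_def by (intro continuous_intros continuous_euler_ray T \<alpha>)
  have ul: "uniform_limit UNIV (\<lambda>n y. \<Sum>m<n. e m y) (\<lambda>y. \<Sum>m. e m y) sequentially"
    by (rule Weierstrass_m_test[OF _ B_sum]) (rule eB')
  show ?th1 unfolding kop_e
    by (rule uniform_limit_theorem[OF _ ul]) (auto intro!: always_eventually continuous_on_sum e_cont)
  have "norm (\<Sum>m. e m y) \<le> (\<Sum>m. B m) * exp (- \<bar>y\<bar>)" for y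
  proof -
    have "norm (\<Sum>m. e m y) \<le> (\<Sum>m. norm (e m y))" by (rule summable_norm[OF e_sum])
    also have "\<dots> \<le> (\<Sum>m. B m * exp (- \<bar>y\<bar>))"
      by (intro suminf_le eB e_sum summable_mult2 B_sum)
    also have "\<dots> = (\<Sum>m. B m) * exp (- \<bar>y\<bar>)" by (rule suminf_mult2[OF B_sum, symmetric])
    finally show ?thesis .
  qed
  thus ?th2 unfolding kop_e by blast
  have e_int: "integrable lborel (e m)" for m
    by (rule integrable_exp_abs_bound[OF e_cont eB])
  have "(LBINT y. \<Sum>m. e m y) = (\<Sum>m. LBINT y. e m y)"
  proof (rule integral_suminf[OF e_int])
    show "AE y in lborel. summable (\<lambda>m. norm (e m y))" using e_sum by simp
    show "summable (\<lambda>m. LBINT y. norm (e m y))"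
    proof (rule summable_comparison_test')
      show "summable (\<lambda>m. B m * (LBINT y. exp (- \<bar>y\<bar>)))" by (intro summable_mult2 B_sum)
      fix m
      have "(LBINT y. norm (e m y)) \<le> (LBINT y. B m * exp (- \<bar>y\<bar>))"
        by (intro integral_mono integrable_norm e_int eB integrable_mult_right integrable_exp_abs)
      thus "norm (LBINT y. norm (e m y)) \<le> B m * (LBINT y. exp (- \<bar>y\<bar>))"
        by (simp add: integral_nonneg_AE)
    qed
  qed
  moreover have "(LBINT y. e m y) = (exp (- s * \<i> * of_real \<alpha>) * mellin T s) * (pochhammer s m / pochhammer (of_real \<beta>) m * (- u) ^ m / fact m)" for m
    unfolding e_def co_def integral_mult_right_zero euler_integral[OF T \<alpha>]
    by (subst power_minus[of u]) (simp add: mult_ac)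
  moreover have "(\<Sum>m. (exp (- s * \<i> * of_real \<alpha>) * mellin T s) * (pochhammer s m / pochhammer (of_real \<beta>) m * (- u) ^ m / fact m)) =
     exp (- s * \<i> * of_real \<alpha>) * mellin T s * kummer_1F1 s (of_real \<beta>) (- u)"
    unfolding kummer_1F1_def by (rule suminf_mult) (rule summable_norm_cancel[OF summable_kummer[OF \<beta>]])
  ultimately show ?th3 unfolding kop_e by (simp only:)
qed

text \<open>On the logarithmic line T decays faster than every exponential, so exp (s y) may be
  expanded in powers of s and integrated termwise. The result is a power series converging for all
  s.\<close>

lemma mellin_holomorphic:
  assumes T: "sector_decay T"
  shows "mellin T holomorphic_on UNIV"
proof -
  define E where "E = (\<lambda>y. T (ray 0 y))"
  have E_cont: "continuous_on UNIV E"
    using continuous_euler_ray[OF T, of 0 0] by (simp add: E_def euler_def)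
  have E_int: "integrable lborel (\<lambda>y. exp (s * of_real y) * E y)" for s
    using integrable_euler_ray[OF T, of 0 s 0] by (simp add: E_def euler_def)
  define a where "a = (\<lambda>n. LBINT y. of_real y ^ n / fact n * E y)"
  have sums: "(\<lambda>n. a n * s ^ n) sums mellin T s" for s
  proof -
    define f where "f = (\<lambda>n y. (s * of_real y) ^ n / fact n * E y)"
    define S where "S = norm s"
    have W_int: "integrable lborel (\<lambda>y. exp (S * \<bar>y\<bar>) * norm (E y))"
    proof (rule Bochner_Integration.integrable_bound)
      show "integrable lborel (\<lambda>y. norm (exp (of_real S * of_real y) * E y) + norm (exp (of_real (- S) * of_real y) * E y))"
        by (intro Bochner_Integration.integrable_add integrable_norm E_int)
      show "(\<lambda>y. exp (S * \<bar>y\<bar>) * norm (E y)) \<in> borel_measurable lborel"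
        using borel_measurable_continuous_onI[OF E_cont] by simp
      show "AE y in lborel. norm (exp (S * \<bar>y\<bar>) * norm (E y)) \<le> norm (norm (exp (of_real S * of_real y) * E y) + norm (exp (of_real (- S) * of_real y) * E y))"
      proof (intro AE_I2)
        fix y :: real
        have "exp (S * \<bar>y\<bar>) \<le> exp (S * y) + exp (- S * y)" by (cases "y \<ge> 0") auto
        hence "exp (S * \<bar>y\<bar>) * norm (E y) \<le> (exp (S * y) + exp (- S * y)) * norm (E y)" by (intro mult_right_mono) auto
        thus "norm (exp (S * \<bar>y\<bar>) * norm (E y)) \<le> norm (norm (exp (of_real S * of_real y) * E y) + norm (exp (of_real (- S) * of_real y) * E y))"
          by (simp add: norm_mult distrib_right)
      qed
    qed
    have psum: "(\<Sum>n<N. norm (f n y)) \<le> exp (S * \<bar>y\<bar>) * norm (E y)" for N y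
    proof -
      have "(\<Sum>n<N. norm (f n y)) = (\<Sum>n<N. (S * \<bar>y\<bar>) ^ n /\<^sub>R fact n) * norm (E y)"
        unfolding sum_distrib_right by (intro sum.cong refl) (simp add: f_def S_def norm_mult norm_divide norm_power norm_inverse divide_inverse mult_ac)
      also have "\<dots> \<le> exp (S * \<bar>y\<bar>) * norm (E y)"
        unfolding exp_def by (intro mult_right_mono sum_le_suminf summable_exp_generic) (auto simp: S_def)
      finally show ?thesis .
    qed
    have f_meas: "f n \<in> borel_measurable lborel" for n
      using borel_measurable_continuous_onI[OF E_cont] unfolding f_def by simp
    have f1: "norm (f n y) \<le> exp (S * \<bar>y\<bar>) * norm (E y)" for n y
      using order_trans[OF member_le_sum[of n "{..<Suc n}" "\<lambda>n. norm (f n y)"] psum] by simp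
    have f_int: "integrable lborel (f n)" for n
      by (rule Bochner_Integration.integrable_bound[OF W_int f_meas]) (use f1 in \<open>auto intro!: AE_I2 simp: abs_mult\<close>)
    have f_summ: "summable (\<lambda>n. norm (f n y))" for y
      by (rule summableI_nonneg_bounded[where x = "exp (S * \<bar>y\<bar>) * norm (E y)"]) (use psum in auto)
    have "(\<lambda>n. LBINT y. f n y) sums (LBINT y. \<Sum>n. f n y)"
    proof (rule sums_integral[OF f_int])
      show "AE y in lborel. summable (\<lambda>n. norm (f n y))" using f_summ by simp
      show "summable (\<lambda>n. LBINT y. norm (f n y))"
      proof (rule summableI_nonneg_bounded[where x = "LBINT y. exp (S * \<bar>y\<bar>) * norm (E y)"])
        fix N
        have "(\<Sum>n<N. LBINT y. norm (f n y)) = (LBINT y. \<Sum>n<N. norm (f n y))"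
          by (rule Bochner_Integration.integral_sum[symmetric]) (intro integrable_norm f_int)
        also have "\<dots> \<le> (LBINT y. exp (S * \<bar>y\<bar>) * norm (E y))"
          by (intro integral_mono W_int psum Bochner_Integration.integrable_sum integrable_norm f_int)
        finally show "(\<Sum>n<N. LBINT y. norm (f n y)) \<le> (LBINT y. exp (S * \<bar>y\<bar>) * norm (E y))" .
      qed (simp add: integral_nonneg_AE)
    qed
    moreover have "(LBINT y. f n y) = a n * s ^ n" for n
    proof -
      have "f n = (\<lambda>y. s ^ n * (of_real y ^ n / fact n * E y))" by (simp add: f_def fun_eq_iff power_mult_distrib mult_ac)
      thus ?thesis unfolding a_def by (simp only: integral_mult_right_zero mult.commute)
    qed
    moreover have "(\<Sum>n. f n y) = exp (s * of_real y) * T (ray 0 y)" for y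
    proof -
      have "(\<lambda>n. (s * of_real y) ^ n /\<^sub>R fact n) sums exp (s * of_real y)" by (rule exp_converges)
      hence "(\<lambda>n. (s * of_real y) ^ n /\<^sub>R fact n * E y) sums (exp (s * of_real y) * E y)" by (rule sums_mult2)
      thus ?thesis by (simp add: sums_iff f_def E_def scaleR_conv_of_real divide_inverse mult_ac)
    qed
    ultimately show ?thesis by (simp add: mellin_def)
  qed
  have "mellin T holomorphic_on ball 0 R" for R
    by (rule power_series_holomorphic[where a = a]) (use sums in simp)
  hence "mellin T field_differentiable at s" for s
    by (rule holomorphic_on_imp_differentiable_at[of _ "ball 0 (norm s + 1)"]) auto
  thus ?thesis by (simp add: holomorphic_on_def field_differentiable_at_within)
qed

subsection \<open>A zero criterion\<close>

text \<open>Gaussian summation: Fubini moves the damping factor from \<phi> to \<gamma>, where its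
  Fourier transform is an approximate identity at 0.\<close>

lemma fourier_inversion_0:
  fixes \<gamma> \<phi> :: "real \<Rightarrow> complex"
  assumes int: "integrable lborel \<gamma>" and cont: "continuous_on UNIV \<gamma>" and bd: "\<And>y. norm (\<gamma> y) \<le> B"
    and int\<phi>: "integrable lborel \<phi>" and \<phi>: "\<And>t. \<phi> t = (LBINT y. \<gamma> y * exp (\<i> * of_real (t * y)))"
  shows "(LBINT t. \<phi> t) = 2 * pi * \<gamma> 0"
proof -
  \<comment> \<open>With this width the substitution y = v / (n + 1) turns every kernel into the
    same Gaussian exp (- v^2 / 2), which then serves as majorant.\<close>
  define a where "a = (\<lambda>n. 1 / (2 * (real (Suc n))\<^sup>2))"
  have a: "a n > 0" for n by (simp add: a_def)
  define K where "K = (\<lambda>n t. complex_of_real (exp (- a n * t\<^sup>2)))"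
  have K_int: "integrable lborel (K n)" for n
    using gauss_fourier(1)[OF a, of 0 n] by (simp add: K_def)
  have meas [measurable]: "\<gamma> \<in> borel_measurable borel" using borel_measurable_continuous_onI[OF cont] .
  have K_meas [measurable]: "K n \<in> borel_measurable borel" for n unfolding K_def by measurable
  have "(\<lambda>n. LBINT t. \<phi> t * K n t) \<longlonglongrightarrow> (LBINT t. \<phi> t * 1)"
  proof (rule integral_dominated_convergence[where w = "\<lambda>t. norm (\<phi> t)"])
    show "AE t in lborel. (\<lambda>n. \<phi> t * K n t) \<longlonglongrightarrow> \<phi> t * 1"
    proof (intro AE_I2 tendsto_mult tendsto_const)
      fix t :: real
      have "(\<lambda>n. exp (- a n * t\<^sup>2)) \<longlonglongrightarrow> exp (- 0 * t\<^sup>2)"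
        unfolding a_def by (intro tendsto_intros) real_asymp
      hence "(\<lambda>n. complex_of_real (exp (- a n * t\<^sup>2))) \<longlonglongrightarrow> of_real (exp (- 0 * t\<^sup>2))"
        by (rule tendsto_of_real)
      thus "(\<lambda>n. K n t) \<longlonglongrightarrow> 1" by (simp add: K_def)
    qed
    show "AE t in lborel. norm (\<phi> t * K n t) \<le> norm (\<phi> t)" for n
      using a[of n] by (intro AE_I2) (auto simp: K_def norm_mult mult_left_le)
  qed (use int\<phi> in auto)
  hence lim1: "(\<lambda>n. LBINT t. \<phi> t * K n t) \<longlonglongrightarrow> (LBINT t. \<phi> t)" by simp
  have eq: "(LBINT t. \<phi> t * K n t) = (LBINT v. \<gamma> (v / real (Suc n)) * of_real (sqrt (2 * pi) * exp (- v\<^sup>2 / 2)))" for n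
  proof -
    define f where "f = (\<lambda>t y. \<gamma> y * exp (\<i> * of_real (t * y)) * K n t)"
    have nf: "norm (f t y) = norm (K n t) * norm (\<gamma> y)" for t y by (simp add: f_def norm_mult)
    have "integrable (lborel \<Otimes>\<^sub>M lborel) (\<lambda>(t, y). f t y)"
    proof (rule lborel_pair.Fubini_integrable)
      show "(\<lambda>(t, y). f t y) \<in> borel_measurable (lborel \<Otimes>\<^sub>M lborel)"
        unfolding f_def by measurable
      show "integrable lborel (\<lambda>t. LBINT y. norm (case (t, y) of (t, y) \<Rightarrow> f t y))"
        by (simp add: nf integrable_norm K_int)
      show "AE t in lborel. integrable lborel (\<lambda>y. case (t, y) of (t, y) \<Rightarrow> f t y)"
      proof (intro AE_I2)
        fix t
        have "integrable lborel (\<lambda>y. f t y)"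
        proof (rule Bochner_Integration.integrable_bound)
          show "integrable lborel (\<lambda>y. norm (K n t) * norm (\<gamma> y))"
            by (intro integrable_mult_right integrable_norm int)
          show "(\<lambda>y. f t y) \<in> borel_measurable lborel" unfolding f_def by measurable
        qed (simp add: nf)
        thus "integrable lborel (\<lambda>y. case (t, y) of (t, y) \<Rightarrow> f t y)" by simp
      qed
    qed
    from lborel_pair.Fubini_integral[OF this]
    have sw: "(LBINT y. LBINT t. f t y) = (LBINT t. LBINT y. f t y)" .
    have "(LBINT t. \<phi> t * K n t) = (LBINT t. LBINT y. f t y)"
      unfolding f_def \<phi> by simp
    also have "\<dots> = (LBINT y. LBINT t. f t y)" using sw by simp
    also have "\<dots> = (LBINT y. \<gamma> y * of_real (sqrt (pi / a n) * exp (- y\<^sup>2 / (4 * a n))))"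
    proof (rule Bochner_Integration.integral_cong[OF refl])
      fix y
      have "f t y = \<gamma> y * (exp (\<i> * of_real (y * t)) * of_real (exp (- a n * t\<^sup>2)))" for t
        by (simp add: f_def K_def mult_ac)
      thus "(LBINT t. f t y) = \<gamma> y * of_real (sqrt (pi / a n) * exp (- y\<^sup>2 / (4 * a n)))"
        using gauss_fourier(2)[OF a, of y n] by (simp only: integral_mult_right_zero)
    qed
    also have "\<dots> = \<bar>1 / real (Suc n)\<bar> *\<^sub>R (LBINT v. \<gamma> (0 + 1 / real (Suc n) * v) * of_real (sqrt (pi / a n) * exp (- (0 + 1 / real (Suc n) * v)\<^sup>2 / (4 * a n))))"
      by (rule lborel_integral_real_affine) simp
    also have "\<dots> = (LBINT v. \<bar>1 / real (Suc n)\<bar> *\<^sub>R (\<gamma> (0 + 1 / real (Suc n) * v) * of_real (sqrt (pi / a n) * exp (- (0 + 1 / real (Suc n) * v)\<^sup>2 / (4 * a n)))))"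
      by (rule integral_scaleR_right[symmetric])
    also have "\<dots> = (LBINT v. \<gamma> (v / real (Suc n)) * of_real (sqrt (2 * pi) * exp (- v\<^sup>2 / 2)))"
    proof (rule Bochner_Integration.integral_cong[OF refl])
      fix v :: real
      define N where "N = real (Suc n)"
      have N: "N > 0" by (simp add: N_def)
      have "sqrt (pi / a n) = N * sqrt (2 * pi)"
        using N unfolding a_def N_def[symmetric] by (simp add: real_sqrt_mult)
      moreover have "(0 + 1 / N * v)\<^sup>2 / (4 * a n) = v\<^sup>2 / 2"
        using N unfolding a_def N_def[symmetric] by (simp add: power_divide)
      ultimately show "\<bar>1 / real (Suc n)\<bar> *\<^sub>R (\<gamma> (0 + 1 / real (Suc n) * v) * of_real (sqrt (pi / a n) * exp (- (0 + 1 / real (Suc n) * v)\<^sup>2 / (4 * a n))))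
         = \<gamma> (v / real (Suc n)) * of_real (sqrt (2 * pi) * exp (- v\<^sup>2 / 2))"
        using N unfolding N_def[symmetric] by (simp add: scaleR_conv_of_real)
    qed
    finally show ?thesis .
  qed
  have g_int: "integrable lborel (\<lambda>v::real. sqrt (2 * pi) * exp (- v\<^sup>2 / 2))"
    and g_val: "(LBINT v::real. sqrt (2 * pi) * exp (- v\<^sup>2 / 2)) = 2 * pi"
  proof -
    have "integrable lborel (\<lambda>v::real. complex_of_real (exp (- (1/2) * v\<^sup>2)))"
      using gauss_fourier(1)[of "1/2" 0] by simp
    hence i: "integrable lborel (\<lambda>v::real. exp (- v\<^sup>2 / 2))" by (simp add: complex_of_real_integrable_eq)
    thus "integrable lborel (\<lambda>v::real. sqrt (2 * pi) * exp (- v\<^sup>2 / 2))" by simp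
    have "(LBINT v::real. complex_of_real (exp (- (1/2) * v\<^sup>2))) = of_real (sqrt (2 * pi))"
      using gauss_fourier(2)[of "1/2" 0] by (simp add: mult.commute)
    hence "(LBINT v::real. exp (- v\<^sup>2 / 2)) = sqrt (2 * pi)"
      by (simp add: integral_complex_of_real)
    thus "(LBINT v::real. sqrt (2 * pi) * exp (- v\<^sup>2 / 2)) = 2 * pi" by simp
  qed
  have "(\<lambda>n. LBINT v. \<gamma> (v / real (Suc n)) * of_real (sqrt (2 * pi) * exp (- v\<^sup>2 / 2))) \<longlonglongrightarrow> (LBINT v. \<gamma> 0 * of_real (sqrt (2 * pi) * exp (- v\<^sup>2 / 2)))"
  proof (rule integral_dominated_convergence[where w = "\<lambda>v. B * (sqrt (2 * pi) * exp (- v\<^sup>2 / 2))"])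
    show "integrable lborel (\<lambda>v. B * (sqrt (2 * pi) * exp (- v\<^sup>2 / 2)))"
      by (intro integrable_mult_right g_int)
    show "AE v in lborel. (\<lambda>n. \<gamma> (v / real (Suc n)) * of_real (sqrt (2 * pi) * exp (- v\<^sup>2 / 2))) \<longlonglongrightarrow> \<gamma> 0 * of_real (sqrt (2 * pi) * exp (- v\<^sup>2 / 2))"
    proof (intro AE_I2 tendsto_mult tendsto_const)
      fix v :: real
      have c: "isCont \<gamma> 0" using cont by (simp add: continuous_on_eq_continuous_at)
      have l: "(\<lambda>n. v / real (Suc n)) \<longlonglongrightarrow> 0" by real_asymp
      show "(\<lambda>n. \<gamma> (v / real (Suc n))) \<longlonglongrightarrow> \<gamma> 0" by (rule isCont_tendsto_compose[OF c l])
    qed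
    show "AE v in lborel. norm (\<gamma> (v / real (Suc n)) * of_real (sqrt (2 * pi) * exp (- v\<^sup>2 / 2))) \<le> B * (sqrt (2 * pi) * exp (- v\<^sup>2 / 2))" for n
    proof (intro AE_I2)
      fix v :: real
      have "norm (\<gamma> (v / real (Suc n)) * of_real (sqrt (2 * pi) * exp (- v\<^sup>2 / 2))) = norm (\<gamma> (v / real (Suc n))) * (sqrt (2 * pi) * exp (- v\<^sup>2 / 2))"
        by (simp add: norm_mult)
      also have "\<dots> \<le> B * (sqrt (2 * pi) * exp (- v\<^sup>2 / 2))" by (intro mult_right_mono bd) simp
      finally show "norm (\<gamma> (v / real (Suc n)) * of_real (sqrt (2 * pi) * exp (- v\<^sup>2 / 2))) \<le> B * (sqrt (2 * pi) * exp (- v\<^sup>2 / 2))" .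
    qed
  qed auto
  also have "(LBINT v. \<gamma> 0 * of_real (sqrt (2 * pi) * exp (- v\<^sup>2 / 2))) = \<gamma> 0 * of_real (LBINT v::real. sqrt (2 * pi) * exp (- v\<^sup>2 / 2))"
    by (simp only: integral_mult_right_zero integral_complex_of_real)
  finally have lim2: "(\<lambda>n. LBINT v. \<gamma> (v / real (Suc n)) * of_real (sqrt (2 * pi) * exp (- v\<^sup>2 / 2))) \<longlonglongrightarrow> \<gamma> 0 * (2 * pi)"
    unfolding g_val by simp
  show ?thesis
    using LIMSEQ_unique[OF lim1 lim2[folded eq]] by (simp add: mult.commute)
qed

lemma constant_sign:
  fixes f :: "real \<Rightarrow> real"
  assumes "connected S" "continuous_on S f" "\<And>t. t \<in> S \<Longrightarrow> f t \<noteq> 0" "x \<in> S" "y \<in> S"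
  shows "f x * f y > 0"
proof (rule ccontr)
  assume n: "\<not> f x * f y > 0"
  have "connected (f ` S)" using assms by (intro connected_continuous_image)
  hence iv: "\<And>a b c. a \<in> f ` S \<Longrightarrow> b \<in> f ` S \<Longrightarrow> a \<le> c \<Longrightarrow> c \<le> b \<Longrightarrow> c \<in> f ` S"
    unfolding connected_iff_interval by blast
  have "f x \<noteq> 0" "f y \<noteq> 0" using assms by auto
  hence "f x \<le> 0 \<and> 0 \<le> f y \<or> f y \<le> 0 \<and> 0 \<le> f x"
    using n by (auto simp: zero_less_mult_iff)
  hence "0 \<in> f ` S" using iv[of "f x" "f y" 0] iv[of "f y" "f x" 0] assms(4,5) by auto
  thus False using assms(3) by auto
qed

text \<open>The difference quotient approximates t. What matters is that its lower bound 3/2 T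
  beyond 2 T exceeds its upper bound 5/4 T on [-T, T] uniformly in \<eta>. The condition 6 T \<eta>
  \<le> 1 suffices for exp (-x) \<le> 1 / (1 + x) and exp x \<le> 1 / (1 - x) to lose no more than
  these constants allow.\<close>

lemma difference_quotient_bounds:
  fixes \<eta> T t :: real
  assumes "\<eta> > 0" "T > 0" "6 * T * \<eta> \<le> 1"
  shows "2 * T \<le> t \<Longrightarrow> (1 - exp (- \<eta> * t)) / \<eta> \<ge> 3 / 2 * T"
    and "\<bar>t\<bar> \<le> T \<Longrightarrow> \<bar>(1 - exp (- \<eta> * t)) / \<eta>\<bar> \<le> 5 / 4 * T"
proof -
  assume t: "2 * T \<le> t"
  define x where "x = 2 * T * \<eta>"
  have x: "x > 0" "3 * x \<le> 1" using assms by (auto simp: x_def)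
  have "exp (- \<eta> * t) \<le> exp (- x)" unfolding x_def using t assms by (simp add: mult.commute)
  also have "exp (- x) \<le> 1 / (1 + x)"
    using exp_ge_add_one_self[of x] x by (simp add: exp_minus field_simps)
  also have "1 / (1 + x) = 1 - x / (1 + x)" using x by (simp add: field_simps)
  finally have "1 - exp (- \<eta> * t) \<ge> x / (1 + x)" by simp
  moreover have "x / (1 + x) \<ge> x * (3 / 4)"
  proof -
    have "x * (3 / 4) * (1 + x) \<le> x" using x by (simp add: field_simps)
    thus ?thesis using x by (simp add: pos_le_divide_eq)
  qed
  ultimately have "1 - exp (- \<eta> * t) \<ge> (3 / 2 * T) * \<eta>" by (simp add: x_def)
  thus "(1 - exp (- \<eta> * t)) / \<eta> \<ge> 3 / 2 * T" using assms by (simp add: pos_le_divide_eq)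
next
  assume t: "\<bar>t\<bar> \<le> T"
  define x where "x = T * \<eta>"
  have x: "x > 0" "6 * x \<le> 1" using assms by (auto simp: x_def)
  have u: "\<bar>\<eta> * t\<bar> \<le> x" using t assms by (simp add: x_def abs_mult mult.commute)
  have "1 - exp (- \<eta> * t) \<le> x" using exp_ge_add_one_self[of "- \<eta> * t"] u by simp
  hence "1 - exp (- \<eta> * t) \<le> 5 / 4 * x" using x by simp
  moreover have "exp (- \<eta> * t) - 1 \<le> 5 / 4 * x"
  proof -
    have "exp (- \<eta> * t) \<le> exp x" using u by simp
    also have "exp x \<le> 1 / (1 - x)"
      using exp_ge_add_one_self[of "-x"] x by (simp add: exp_minus field_simps)
    also have "1 / (1 - x) \<le> 1 + 5 / 4 * x"
    proof -
      have "1 \<le> (1 + 5 / 4 * x) * (1 - x)"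
      proof -
        have "x * (5 * x) \<le> x * 1" using x by (intro mult_left_mono) auto
        thus ?thesis by (simp add: algebra_simps)
      qed
      thus ?thesis using x by (simp add: pos_divide_le_eq)
    qed
    finally show ?thesis by simp
  qed
  ultimately have "\<bar>1 - exp (- \<eta> * t)\<bar> \<le> 5 / 4 * x" by (intro abs_leI) auto
  hence "\<bar>1 - exp (- \<eta> * t)\<bar> \<le> (5 / 4 * T) * \<eta>" by (simp only: x_def mult.assoc)
  thus "\<bar>(1 - exp (- \<eta> * t)) / \<eta>\<bar> \<le> 5 / 4 * T" using assms by (simp add: abs_divide pos_divide_le_eq)
qed

text \<open>Differences rather than derivatives in \<alpha> are taken because the integrals are
  known to converge for \<alpha> < pi / 2 only. The power of the difference quotient plays the part
  of t^m.\<close>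

lemma infinite_zeros_of_flat_moments:
  fixes f :: "real \<Rightarrow> real"
  assumes cont: "continuous_on UNIV f"
    and int: "\<And>\<alpha>. 0 < \<alpha> \<Longrightarrow> \<alpha> < pi / 2 \<Longrightarrow> integrable lborel (\<lambda>t. f t * exp (\<alpha> * t))"
    and flat: "c > 0" "\<alpha>0 < pi / 2"
      "\<And>\<alpha>. \<alpha>0 < \<alpha> \<Longrightarrow> \<alpha> < pi / 2 \<Longrightarrow> \<bar>LBINT t. f t * exp (\<alpha> * t)\<bar> \<le> C * exp (- c / (pi / 2 - \<alpha>))"
  shows "infinite {t. f t = 0}"
proof
  assume fin: "finite {t. f t = 0}"
  have "\<exists>T\<ge>1. \<forall>t. \<bar>t\<bar> \<ge> T \<longrightarrow> f t \<noteq> 0"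
  proof -
    have "bounded {t. f t = 0}" using fin by (rule finite_imp_bounded)
    then obtain M where M: "\<And>t. f t = 0 \<Longrightarrow> \<bar>t\<bar> \<le> M" unfolding bounded_iff by auto
    have "f t \<noteq> 0" if "\<bar>t\<bar> \<ge> \<bar>M\<bar> + 1" for t using M[of t] that by force
    thus ?thesis by (intro exI[of _ "\<bar>M\<bar> + 1"]) auto
  qed
  then obtain T where T: "T \<ge> 1" "\<And>t. \<bar>t\<bar> \<ge> T \<Longrightarrow> f t \<noteq> 0" by auto
  have s1: "f T * f t > 0" if "t \<ge> T" for t
    by (rule constant_sign[of "{T..}"]) (use that T in \<open>auto intro: continuous_on_subset[OF cont]\<close>)
  have s2: "f (-T) * f t > 0" if "t \<le> -T" for t
    by (rule constant_sign[of "{..-T}"]) (use that T in \<open>auto intro: continuous_on_subset[OF cont]\<close>)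
  define \<sigma> where "\<sigma> = sgn (f T)"
  have fT: "f T \<noteq> 0" "f (-T) \<noteq> 0" using T by auto
  have \<sigma>: "\<bar>\<sigma>\<bar> = 1" using fT by (simp add: \<sigma>_def abs_sgn_eq)
  have pos: "\<sigma> * f t = \<bar>f t\<bar>" if "t \<ge> T" for t
    using s1[OF that] by (auto simp: \<sigma>_def sgn_if zero_less_mult_iff)
  \<comment> \<open>The parity required of m: even if f has the same sign on both sides, odd
    otherwise. The kernel \<open>K\<close> below changes sign with t exactly when m is odd.\<close>
  define p :: nat where "p = (if f T * f (-T) > 0 then 0 else 1)"
  have neg: "\<sigma> * f t * (-1) ^ p = \<bar>f t\<bar>" if "t \<le> -T" for t
    using s2[OF that] fT by (auto simp: \<sigma>_def p_def sgn_if zero_less_mult_iff)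
  have "compact {2*T..3*T}" "{2*T..3*T} \<noteq> {}" using T by auto
  moreover have "continuous_on {2*T..3*T} (\<lambda>t. \<bar>f t\<bar>)" by (intro continuous_intros continuous_on_subset[OF cont]) auto
  ultimately obtain t0 where t0: "t0 \<in> {2*T..3*T}" "\<And>t. t \<in> {2*T..3*T} \<Longrightarrow> \<bar>f t0\<bar> \<le> \<bar>f t\<bar>"
    using continuous_attains_inf[of "{2*T..3*T}" "\<lambda>t. \<bar>f t\<bar>"] by auto
  define \<mu> where "\<mu> = \<bar>f t0\<bar>"
  have \<mu>: "\<mu> > 0" using T(2)[of t0] t0(1) T(1) by (auto simp: \<mu>_def)
  have "compact {-T..T}" "{-T..T} \<noteq> {}" using T by auto
  moreover have "continuous_on {-T..T} (\<lambda>t. \<bar>f t\<bar>)" by (intro continuous_intros continuous_on_subset[OF cont]) auto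
  ultimately obtain t1 where t1: "t1 \<in> {-T..T}" "\<And>t. t \<in> {-T..T} \<Longrightarrow> \<bar>f t\<bar> \<le> \<bar>f t1\<bar>"
    using continuous_attains_sup[of "{-T..T}" "\<lambda>t. \<bar>f t\<bar>"] by auto
  define \<nu> where "\<nu> = \<bar>f t1\<bar>"
  have \<nu>: "\<nu> \<ge> 0" by (simp add: \<nu>_def)
  have main: "\<mu> * (3 / 2 * T) ^ m * T \<le> \<nu> * (exp (pi / 2 * T) * (5 / 4 * T) ^ m) * (2 * T)" if par: "(-1) ^ m = ((-1) ^ p :: real)" for m
  proof -
    \<comment> \<open>The power expands into exponentials with the rates pi / 2 - (l + 1) \<eta> for
      l \<le> m. The leading factor keeps even the rate l = 0 below pi / 2.\<close>
    define K where "K = (\<lambda>\<eta> t::real. exp ((pi / 2 - \<eta>) * t) * ((1 - exp (- \<eta> * t)) / \<eta>) ^ m)"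
    define J where "J = (\<lambda>\<eta>. LBINT t. f t * K \<eta> t)"
    define L where "L = \<mu> * (3 / 2 * T) ^ m * T - \<nu> * (exp (pi / 2 * T) * (5 / 4 * T) ^ m) * (2 * T)"
    define al where "al = (\<lambda>\<eta> l. pi / 2 - \<eta> * real (Suc l))"
    \<comment> \<open>The first entry is the condition of \<open>difference_quotient_bounds\<close>;
      the second puts all rates up to l = m above both 0 and \<alpha>0.\<close>
    define \<eta>1 where "\<eta>1 = min (1 / (6 * T)) (min (pi / 2) (pi / 2 - \<alpha>0) / real (Suc (Suc m)))"
    have \<eta>1: "\<eta>1 > 0" using T(1) flat(2) pi_gt_zero by (auto simp: \<eta>1_def)
    have K_sum: "f t * K \<eta> t = (\<Sum>l\<le>m. real (m choose l) * (-1) ^ l / \<eta> ^ m * (f t * exp (al \<eta> l * t)))" if "\<eta> > 0" for \<eta> t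
    proof -
      have "(1 - exp (- \<eta> * t)) ^ m = (\<Sum>l\<le>m. of_nat (m choose l) * (- exp (- \<eta> * t)) ^ l * 1 ^ (m - l))"
        using binomial_ring[of "- exp (- \<eta> * t)" 1 m] by simp
      hence "K \<eta> t = exp ((pi / 2 - \<eta>) * t) * ((\<Sum>l\<le>m. of_nat (m choose l) * (- exp (- \<eta> * t)) ^ l * 1 ^ (m - l)) / \<eta> ^ m)"
        by (simp add: K_def power_divide)
      also have "\<dots> = (\<Sum>l\<le>m. real (m choose l) * (-1) ^ l / \<eta> ^ m * exp (al \<eta> l * t))"
        unfolding sum_divide_distrib sum_distrib_left
      proof (intro sum.cong refl)
        fix l
        have "(- exp (- \<eta> * t)) ^ l = (-1) ^ l * exp (real l * (- \<eta> * t))"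
          by (subst power_minus) (simp only: exp_of_nat_mult)
        moreover have "exp ((pi / 2 - \<eta>) * t) * exp (real l * (- \<eta> * t)) = exp (al \<eta> l * t)"
          unfolding exp_add[symmetric] by (simp add: al_def algebra_simps)
        ultimately show "exp ((pi / 2 - \<eta>) * t) * (of_nat (m choose l) * (- exp (- \<eta> * t)) ^ l * 1 ^ (m - l) / \<eta> ^ m) = real (m choose l) * (-1) ^ l / \<eta> ^ m * exp (al \<eta> l * t)"
          by (simp add: mult_ac)
      qed
      finally show ?thesis by (simp add: sum_distrib_left mult_ac)
    qed
    have al: "0 < al \<eta> l" "al \<eta> l < pi / 2" "\<alpha>0 < al \<eta> l" if "0 < \<eta>" "\<eta> < \<eta>1" "l \<le> m" for \<eta> l
    proof -
      have "\<eta> * real (Suc l) \<le> \<eta> * real (Suc (Suc m))" using that by (intro mult_left_mono) auto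
      also have "\<dots> < \<eta>1 * real (Suc (Suc m))" using that by (intro mult_strict_right_mono) auto
      also have "\<dots> \<le> (min (pi / 2) (pi / 2 - \<alpha>0) / real (Suc (Suc m))) * real (Suc (Suc m))"
        by (intro mult_right_mono) (auto simp: \<eta>1_def)
      also have "\<dots> = min (pi / 2) (pi / 2 - \<alpha>0)" by simp
      finally have "\<eta> * real (Suc l) < min (pi / 2) (pi / 2 - \<alpha>0)" .
      thus "0 < al \<eta> l" "al \<eta> l < pi / 2" "\<alpha>0 < al \<eta> l" using that(1) by (auto simp: al_def mult_pos_pos simp del: of_nat_Suc)
    qed
    have K_int: "integrable lborel (\<lambda>t. f t * K \<eta> t)" if "0 < \<eta>" "\<eta> < \<eta>1" for \<eta>
      unfolding K_sum[OF that(1)] using al[OF that]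
      by (intro Bochner_Integration.integrable_sum integrable_mult_right int) auto
    have Lle: "L \<le> \<bar>J \<eta>\<bar>" if \<eta>: "0 < \<eta>" "\<eta> < \<eta>1" for \<eta>
    proof -
      have \<eta>T: "6 * T * \<eta> \<le> 1"
      proof -
        have "\<eta> \<le> 1 / (6 * T)" using \<eta>(2) by (simp add: \<eta>1_def)
        thus ?thesis using T(1) by (simp add: field_simps)
      qed
      have \<eta>pi: "\<eta> < pi / 2" using al(1)[OF \<eta>, of 0] \<eta> by (simp add: al_def)
      note dq = difference_quotient_bounds[OF \<eta>(1) _ \<eta>T]
      define lo where "lo = (3 / 2 * T) ^ m"
      define up where "up = exp (pi / 2 * T) * (5 / 4 * T) ^ m"
      have lo: "lo \<ge> 0" and up: "up \<ge> 0" using T(1) by (auto simp: lo_def up_def)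
      let ?g = "\<lambda>t. \<mu> * lo * indicator {2*T..3*T} t - \<nu> * up * indicator {-T..T} t"
      \<comment> \<open>Outside [-T, T] the kernel and f conspire to the sign \<sigma>, so only
        [-T, T] can contribute negatively, and the contribution of [2 T, 3 T] is bounded
        below.\<close>
      have pw: "?g t \<le> \<sigma> * (f t * K \<eta> t)" for t
      proof -
        consider "t \<in> {-T..T}" | "t \<in> {2*T..3*T}" | "t > T" "t \<notin> {2*T..3*T}" | "t < -T" by force
        thus ?thesis
        proof cases
          case 1
          have n: "t \<notin> {2*T..3*T}" using 1 T(1) by auto
          have "\<bar>K \<eta> t\<bar> \<le> up" unfolding K_def up_def abs_mult power_abs
          proof (intro mult_mono power_mono dq(2))
            have "(pi / 2 - \<eta>) * t \<le> \<bar>(pi / 2 - \<eta>) * t\<bar>" by simp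
            also have "\<dots> = (pi / 2 - \<eta>) * \<bar>t\<bar>" using \<eta>pi by (simp add: abs_mult)
            also have "\<dots> \<le> pi / 2 * T" using 1 \<eta> \<eta>pi T(1) by (intro mult_mono) auto
            finally show "\<bar>exp ((pi / 2 - \<eta>) * t)\<bar> \<le> exp (pi / 2 * T)" by simp
          qed (use 1 T(1) in auto)
          hence "\<bar>\<sigma> * (f t * K \<eta> t)\<bar> \<le> \<nu> * up"
            unfolding abs_mult \<sigma> mult_1_left using t1(2)[OF 1] by (intro mult_mono) (auto simp: \<nu>_def)
          thus ?thesis using 1 n by (simp add: abs_le_iff)
        next
          case 2
          have n: "t \<notin> {-T..T}" using 2 T(1) by auto
          have "(pi / 2 - \<eta>) * t \<ge> 0" using \<eta>pi 2 T(1) by auto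
          hence "1 * lo \<le> K \<eta> t" unfolding K_def lo_def
            using dq(1)[of t] 2 T(1) by (intro mult_mono power_mono) auto
          hence "\<mu> * lo \<le> \<bar>f t\<bar> * K \<eta> t" using t0(2)[OF 2] lo by (intro mult_mono) (auto simp: \<mu>_def)
          also have "\<dots> = \<sigma> * (f t * K \<eta> t)" using pos[of t] 2 T(1) by (simp add: mult.assoc[symmetric])
          finally show ?thesis using 2 n by simp
        next
          case 3
          have n: "t \<notin> {-T..T}" using 3 by auto
          have "(1 - exp (- \<eta> * t)) / \<eta> \<ge> 0" using \<eta> 3 T(1) by (simp add: divide_nonneg_pos)
          hence "K \<eta> t \<ge> 0" by (simp add: K_def)
          hence "0 \<le> \<bar>f t\<bar> * K \<eta> t" by simp
          also have "\<dots> = \<sigma> * (f t * K \<eta> t)" using pos[of t] 3 by (simp add: mult.assoc[symmetric])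
          finally show ?thesis using 3 n by simp
        next
          case 4
          have n: "t \<notin> {-T..T}" "t \<notin> {2*T..3*T}" using 4 T(1) by auto
          have "\<eta> * t < 0" using 4 T(1) \<eta> by (intro mult_pos_neg) auto
          hence "(exp (- \<eta> * t) - 1) / \<eta> \<ge> 0" using \<eta> by (intro divide_nonneg_pos) auto
          moreover have "((1 - exp (- \<eta> * t)) / \<eta>) ^ m = (-1) ^ p * ((exp (- \<eta> * t) - 1) / \<eta>) ^ m"
          proof -
            have "(1 - exp (- \<eta> * t)) / \<eta> = - ((exp (- \<eta> * t) - 1) / \<eta>)" by (simp only: minus_divide_left minus_diff_eq)
            thus ?thesis by (simp only: power_minus[of "(exp (- \<eta> * t) - 1) / \<eta>"] par)
          qed
          ultimately have qs: "(exp (- \<eta> * t) - 1) / \<eta> \<ge> 0" "((1 - exp (- \<eta> * t)) / \<eta>) ^ m = (-1) ^ p * ((exp (- \<eta> * t) - 1) / \<eta>) ^ m" .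
          define Q where "Q = exp ((pi / 2 - \<eta>) * t) * ((exp (- \<eta> * t) - 1) / \<eta>) ^ m"
          have Q: "Q \<ge> 0" "K \<eta> t = (-1) ^ p * Q"
            unfolding K_def Q_def qs(2) using qs(1) by (simp_all only: mult_ac) simp
          have "0 \<le> \<bar>f t\<bar> * Q" using Q by simp
          also have "\<dots> = \<sigma> * (f t * K \<eta> t)" using neg[of t] 4 by (simp add: Q mult_ac)
          finally show ?thesis using n by simp
        qed
      qed
      have ind: "integrable lborel (indicat_real {a..b})" for a b :: real
        by (rule integrable_real_indicator) (auto simp: emeasure_lborel_Icc_eq)
      have "L = (LBINT t. ?g t)"
        using T(1) ind by (subst Bochner_Integration.integral_diff) (simp_all add: L_def lo_def up_def)
      also have "\<dots> \<le> (LBINT t. \<sigma> * (f t * K \<eta> t))"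
        by (intro integral_mono pw integrable_mult_right K_int \<eta> Bochner_Integration.integrable_diff ind)
      also have "\<dots> = \<sigma> * J \<eta>" by (simp add: J_def)
      also have "\<dots> \<le> \<bar>\<sigma> * J \<eta>\<bar>" by simp
      also have "\<dots> = \<bar>J \<eta>\<bar>" by (simp add: abs_mult \<sigma>)
      finally show ?thesis .
    qed
    \<comment> \<open>The rates lie at distance (l + 1) \<eta> \<le> (m + 1) \<eta> from pi /
      2.\<close>
    define c' where "c' = c / real (Suc m)"
    have c': "c' > 0" using flat(1) by (simp add: c'_def)
    define D where "D = 2 ^ m * \<bar>C\<bar> * fact (Suc m) / c' ^ Suc m"
    have Jle: "\<bar>J \<eta>\<bar> \<le> D * \<eta>" if \<eta>: "0 < \<eta>" "\<eta> < \<eta>1" for \<eta>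
    proof -
      \<comment> \<open>The power m + 1 compensates the 1 / \<eta>^m of the difference quotient and
        leaves one factor \<eta>.\<close>
      have e: "exp (- (c' / \<eta>)) \<le> fact (Suc m) * (\<eta> / c') ^ Suc m"
      proof -
        define X where "X = (c' / \<eta>) ^ Suc m"
        have "X \<le> fact (Suc m) * exp (c' / \<eta>)"
          unfolding X_def using c' \<eta> by (intro power_le_fact_exp) auto
        from mult_right_mono[OF this, of "exp (- (c' / \<eta>))"]
        have "X * exp (- (c' / \<eta>)) \<le> fact (Suc m) * (exp (c' / \<eta>) * exp (- (c' / \<eta>)))"
          by (simp only: mult.assoc) simp
        hence "exp (- (c' / \<eta>)) * X \<le> fact (Suc m)"
          by (simp only: exp_minus_inverse mult_1_right mult.commute[of X])
        moreover have "X > 0" unfolding X_def using c' \<eta> by (intro zero_less_power) auto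
        ultimately have "exp (- (c' / \<eta>)) \<le> fact (Suc m) / X"
          by (simp only: pos_le_divide_eq)
        thus ?thesis by (simp add: X_def power_divide)
      qed
      have J_l: "\<bar>LBINT t. f t * exp (al \<eta> l * t)\<bar> \<le> \<bar>C\<bar> * (fact (Suc m) * (\<eta> / c') ^ Suc m)" if l: "l \<le> m" for l
      proof -
        have "\<bar>LBINT t. f t * exp (al \<eta> l * t)\<bar> \<le> C * exp (- c / (pi / 2 - al \<eta> l))"
          by (rule flat(3)) (use al[OF \<eta> l] in auto)
        also have "\<dots> \<le> \<bar>C\<bar> * exp (- c / (pi / 2 - al \<eta> l))" by (intro mult_right_mono) auto
        also have "exp (- c / (pi / 2 - al \<eta> l)) \<le> exp (- (c' / \<eta>))"
        proof -
          have "c / (\<eta> * real (Suc l)) \<ge> c / (\<eta> * real (Suc m))"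
            using l flat(1) \<eta> by (intro divide_left_mono mult_left_mono) auto
          thus ?thesis by (simp add: al_def c'_def mult.commute)
        qed
        also note e
        finally show ?thesis by (simp add: mult_left_mono)
      qed
      have "J \<eta> = (\<Sum>l\<le>m. real (m choose l) * (-1) ^ l / \<eta> ^ m * (LBINT t. f t * exp (al \<eta> l * t)))"
        unfolding J_def K_sum[OF \<eta>(1)] using al[OF \<eta>]
        by (subst Bochner_Integration.integral_sum) (auto intro!: integrable_mult_right int simp del: integrable_mult_right_iff)
      also have "\<bar>\<dots>\<bar> \<le> (\<Sum>l\<le>m. \<bar>real (m choose l) * (-1) ^ l / \<eta> ^ m * (LBINT t. f t * exp (al \<eta> l * t))\<bar>)"
        by (rule sum_abs)
      also have "\<dots> \<le> (\<Sum>l\<le>m. real (m choose l) * (1 / \<eta> ^ m * (\<bar>C\<bar> * (fact (Suc m) * (\<eta> / c') ^ Suc m))))"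
      proof (intro sum_mono)
        fix l assume "l \<in> {..m}"
        hence "real (m choose l) * (1 / \<eta> ^ m * \<bar>LBINT t. f t * exp (al \<eta> l * t)\<bar>) \<le> real (m choose l) * (1 / \<eta> ^ m * (\<bar>C\<bar> * (fact (Suc m) * (\<eta> / c') ^ Suc m)))"
          using \<eta> J_l by (intro mult_left_mono) auto
        thus "\<bar>real (m choose l) * (-1) ^ l / \<eta> ^ m * (LBINT t. f t * exp (al \<eta> l * t))\<bar> \<le> real (m choose l) * (1 / \<eta> ^ m * (\<bar>C\<bar> * (fact (Suc m) * (\<eta> / c') ^ Suc m)))"
          using \<eta> by (simp add: abs_mult power_abs)
      qed
      also have "\<dots> = real (\<Sum>l\<le>m. m choose l) * (1 / \<eta> ^ m * (\<bar>C\<bar> * (fact (Suc m) * (\<eta> / c') ^ Suc m)))"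
        by (simp only: sum_distrib_right of_nat_sum)
      also have "\<dots> = D * \<eta>"
        unfolding choose_row_sum D_def using \<eta> c' by (simp add: power_divide field_simps)
      finally show ?thesis .
    qed
    have "L \<le> 0"
    proof (rule tendsto_lowerbound)
      have "((\<lambda>\<eta>. D * \<eta>) \<longlongrightarrow> D * 0) (at_right 0)" by (intro tendsto_intros)
      thus "((\<lambda>\<eta>. D * \<eta>) \<longlongrightarrow> 0) (at_right 0)" by simp
      show "\<forall>\<^sub>F \<eta> in at_right 0. L \<le> D * \<eta>"
        unfolding eventually_at_right_field using \<eta>1 Lle Jle by (meson order_trans)
    qed simp
    thus ?thesis by (simp add: L_def)
  qed
  \<comment> \<open>6/5 is the quotient of 3/2 and 5/4. The right-hand side is independent of m,
    while m may be any number of the right parity.\<close>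
  have "(6 / 5) ^ m \<le> exp (pi / 2 * T) * \<nu> * 2 / \<mu>" if "(-1) ^ m = ((-1) ^ p :: real)" for m
  proof -
    have "(3 / 2 * T) ^ m = (6 / 5) ^ m * (5 / 4 * T) ^ m"
      by (simp add: power_mult_distrib[symmetric])
    hence "(\<mu> * (6 / 5) ^ m) * ((5 / 4 * T) ^ m * T) \<le> (\<nu> * exp (pi / 2 * T) * 2) * ((5 / 4 * T) ^ m * T)"
      using main[OF that] by (simp add: mult_ac)
    moreover have "(5 / 4 * T) ^ m * T > 0" using T(1) by auto
    ultimately have "\<mu> * (6 / 5) ^ m \<le> \<nu> * exp (pi / 2 * T) * 2" by (rule mult_right_le_imp_le)
    thus ?thesis using \<mu> by (simp add: field_simps)
  qed
  moreover obtain n where n: "exp (pi / 2 * T) * \<nu> * 2 / \<mu> < (6 / 5) ^ n"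
    using real_arch_pow[of "6/5"] by auto
  moreover have "(6 / 5 :: real) ^ n \<le> (6 / 5) ^ (2 * n + p)" by (intro power_increasing) auto
  moreover have "(-1) ^ (2 * n + p) = ((-1) ^ p :: real)" by (simp add: power_add power_mult)
  ultimately show False by (meson not_le order_trans)
qed

subsection \<open>Flatness at the cusp\<close>

text \<open>This is 1F1 (1; \<beta>; y). It arises as the kernel of \<open>kop\<close> once Cauchy's
  formula has cancelled the m! in the coefficients.\<close>

definition kummer1 :: "real \<Rightarrow> complex \<Rightarrow> complex" where
  "kummer1 \<beta> y = (\<Sum>m. y ^ m / pochhammer (of_real \<beta>) m)"

lemma summable_kummer1:
  assumes "\<beta> > 0"
  shows "summable (\<lambda>m. norm (y ^ m / pochhammer (complex_of_real \<beta>) m))"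
  using summable_power_div_pochhammer[OF assms, of "norm y"]
  by (simp add: norm_divide norm_power norm_pochhammer_of_real[OF assms])

text \<open>Raises the parameter above 1, where the integral representation behind
  \<open>norm_kummer1_le_aux\<close> converges, at the cost of a factor y / \<beta>.\<close>

lemma kummer1_rec:
  assumes \<beta>: "\<beta> > 0"
  shows "kummer1 \<beta> y = 1 + y / of_real \<beta> * kummer1 (\<beta> + 1) y"
proof -
  have s: "summable (\<lambda>m. y ^ m / pochhammer (complex_of_real (\<beta> + 1)) m)"
    by (rule summable_norm_cancel[OF summable_kummer1]) (use \<beta> in simp)
  have "kummer1 \<beta> y = (\<Sum>m. y ^ Suc m / pochhammer (complex_of_real \<beta>) (Suc m)) + 1"
    unfolding kummer1_def using suminf_split_head[OF summable_norm_cancel[OF summable_kummer1[OF \<beta>, of y]]] by simp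
  also have "(\<Sum>m. y ^ Suc m / pochhammer (complex_of_real \<beta>) (Suc m)) = (\<Sum>m. y / of_real \<beta> * (y ^ m / pochhammer (complex_of_real (\<beta> + 1)) m))"
    by (simp add: pochhammer_rec)
  also have "\<dots> = y / of_real \<beta> * kummer1 (\<beta> + 1) y" unfolding kummer1_def by (rule suminf_mult[OF s])
  finally show ?thesis by simp
qed

text \<open>Amounts to the representation of the function as \<beta> times the integral over [0, 1]
  of t^(\<beta> - 1) exp (y (1 - t)). It is obtained from the differential equation by comparing
  derivatives, so that no singular integral at t = 0 occurs.\<close>

lemma norm_kummer1_le_aux:
  assumes \<beta>: "\<beta> > 0"
  shows "norm (kummer1 (\<beta> + 1) y) \<le> max 1 (exp (Re y))"
proof -
  define c where "c = (\<lambda>m. 1 / pochhammer (complex_of_real (\<beta> + 1)) m)"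
  define G where "G = (\<lambda>w. \<Sum>m. c m * w ^ m)"
  define G' where "G' = (\<lambda>w. \<Sum>m. diffs c m * w ^ m)"
  have \<beta>1: "\<beta> + 1 > 0" using \<beta> by simp
  have summ: "summable (\<lambda>m. c m * w ^ m)" for w
    using summable_norm_cancel[OF summable_kummer1[OF \<beta>1, of w]] by (simp add: c_def)
  have G_deriv: "(G has_field_derivative G' w) (at w)" for w
    unfolding G_def G'_def by (rule termdiffs_strong_converges_everywhere[OF summ])
  have G_eq: "G w = kummer1 (\<beta> + 1) w" for w by (simp add: G_def kummer1_def c_def)
  \<comment> \<open>The first-order differential equation of G, by comparison of
    coefficients.\<close>
  have ident: "w * G' w + of_real \<beta> * G w = of_real \<beta> + w * G w" for w
  proof -
    have "(\<lambda>n. of_nat n * c n * w ^ (n - Suc 0)) sums G' w"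
      unfolding G'_def by (rule diffs_equiv) (rule termdiff_converges_all[OF summ])
    hence "(\<lambda>n. w * (of_nat n * c n * w ^ (n - Suc 0)) + of_real \<beta> * (c n * w ^ n)) sums (w * G' w + of_real \<beta> * G w)"
      unfolding G_def by (intro sums_add sums_mult summable_sums summ)
    also have "(\<lambda>n. w * (of_nat n * c n * w ^ (n - Suc 0)) + of_real \<beta> * (c n * w ^ n)) = (\<lambda>n. (of_nat n + of_real \<beta>) * c n * w ^ n)"
    proof
      fix n show "w * (of_nat n * c n * w ^ (n - Suc 0)) + of_real \<beta> * (c n * w ^ n) = (of_nat n + of_real \<beta>) * c n * w ^ n"
        by (cases n) (simp_all add: algebra_simps)
    qed
    finally have 1: "(\<lambda>n. (of_nat n + of_real \<beta>) * c n * w ^ n) sums (w * G' w + of_real \<beta> * G w)" .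
    have "(\<lambda>n. (of_nat (Suc n) + of_real \<beta>) * c (Suc n) * w ^ Suc n) sums (w * G w)"
    proof -
      have "(of_nat (Suc n) + of_real \<beta>) * c (Suc n) * w ^ Suc n = w * (c n * w ^ n)" for n
      proof -
        have "complex_of_real \<beta> + 1 + of_nat n \<noteq> 0"
        proof -
          have "Re (complex_of_real \<beta> + 1 + of_nat n) > 0" using \<beta> by (simp add: add_pos_nonneg)
          thus ?thesis by (metis less_irrefl zero_complex.sel(1))
        qed
        hence "(of_nat (Suc n) + of_real \<beta>) * c (Suc n) = c n"
          by (simp add: c_def pochhammer_Suc add_ac)
        thus ?thesis by (simp add: mult_ac)
      qed
      thus ?thesis unfolding G_def by (simp only:) (intro sums_mult summable_sums summ)
    qed
    hence "(\<lambda>n. (of_nat n + of_real \<beta>) * c n * w ^ n) sums (w * G w + of_real \<beta>)"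
      by (subst (asm) sums_Suc_iff) (simp add: c_def)
    from sums_unique2[OF 1 this] show ?thesis by simp
  qed
  define M where "M = max 1 (exp (- Re y))"
  \<comment> \<open>By the differential equation its derivative is \<beta> t^(\<beta> - 1) exp (- y
    t), in which G no longer occurs.\<close>
  define \<phi> where "\<phi> = (\<lambda>t::real. exp (- y * of_real t) * of_real (t powr \<beta>) * G (of_real t * y))"
  have "norm (\<phi> 1 - \<phi> 0) \<le> M * 1 powr \<beta> - M * 0 powr \<beta>"
  proof (rule differentiable_bound_general[of 0 1 \<phi> "\<lambda>t. M * t powr \<beta>"])
    have cG: "continuous_on UNIV G" using G_deriv by (auto intro!: continuous_at_imp_continuous_on DERIV_isCont)
    show "continuous_on {0..1} \<phi>" unfolding \<phi>_def
      by (intro continuous_intros continuous_on_compose2[OF cG] continuous_on_powr') (use \<beta> in auto)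
    show "continuous_on {0..1} (\<lambda>t. M * t powr \<beta>)"
      by (intro continuous_intros continuous_on_powr') (use \<beta> in auto)
    fix t :: real assume t: "0 < t" "t < 1"
    define p where "p = t powr (\<beta> - 1)"
    have tp: "t powr \<beta> = t * p" using t by (simp add: p_def powr_diff)
    have dp: "((\<lambda>t. t powr \<beta>) has_real_derivative \<beta> * p) (at t)"
      using t unfolding p_def by (auto intro!: derivative_eq_intros simp: powr_diff)
    show "((\<lambda>t. M * t powr \<beta>) has_vector_derivative M * (\<beta> * p)) (at t)"
      using DERIV_cmult[OF dp, of M] by (simp add: has_real_derivative_iff_has_vector_derivative)
    have d1: "((\<lambda>t. complex_of_real (t powr \<beta>)) has_vector_derivative of_real (\<beta> * p)) (at t)"
      using has_vector_derivative_of_real[OF dp] .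
    have d2: "((\<lambda>t. exp (- y * of_real t) * G (of_real t * y)) has_vector_derivative
        (exp (- y * of_real t) * (y * G' (of_real t * y)) + (- y) * exp (- y * of_real t) * G (of_real t * y))) (at t)"
    proof -
      have c: "((\<lambda>w. G (w * y)) has_field_derivative G' (of_real t * y) * y) (at (of_real t))"
        by (rule DERIV_chain2[OF G_deriv]) (auto intro!: derivative_eq_intros)
      have e: "((\<lambda>w. exp (- y * w)) has_field_derivative (- y) * exp (- y * of_real t)) (at (of_real t))"
        by (auto intro!: derivative_eq_intros)
      from has_vector_derivative_real_field[OF DERIV_mult[OF e c]] show ?thesis
        by (simp add: algebra_simps)
    qed
    define d where "d = of_real (t powr \<beta>) * (exp (- y * of_real t) * (y * G' (of_real t * y)) + (- y) * exp (- y * of_real t) * G (of_real t * y))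
         + of_real (\<beta> * p) * (exp (- y * of_real t) * G (of_real t * y))"
    have "((\<lambda>t. of_real (t powr \<beta>) * (exp (- y * of_real t) * G (of_real t * y))) has_vector_derivative d) (at t)"
      unfolding d_def by (rule has_vector_derivative_mult[OF d1 d2])
    thus "(\<phi> has_vector_derivative d) (at t)"
      by (simp add: \<phi>_def mult_ac)
    have "d = of_real p * exp (- y * of_real t) * ((of_real t * y) * G' (of_real t * y) + of_real \<beta> * G (of_real t * y) - (of_real t * y) * G (of_real t * y))"
      unfolding d_def tp by (simp add: algebra_simps)
    also have "\<dots> = of_real (p * \<beta>) * exp (- y * of_real t)"
      unfolding ident by simp
    finally have "norm d = (p * \<beta>) * exp (- Re y * t)" using \<beta> by (simp add: norm_mult p_def)
    also have "exp (- Re y * t) \<le> M"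
    proof (cases "Re y \<ge> 0")
      case True
      hence "- Re y * t \<le> 0" using t by simp
      hence "exp (- Re y * t) \<le> 1" by (simp only: exp_le_one_iff)
      also have "1 \<le> M" by (simp add: M_def)
      finally show ?thesis .
    next
      case False
      hence "- Re y * t \<le> - Re y * 1" using t by (intro mult_left_mono) auto
      hence "exp (- Re y * t) \<le> exp (- Re y)" by simp
      also have "\<dots> \<le> M" by (simp add: M_def)
      finally show ?thesis .
    qed
    hence "(p * \<beta>) * exp (- Re y * t) \<le> M * (\<beta> * p)" using \<beta> by (subst mult.commute) (auto intro!: mult_mono simp: p_def M_def mult.commute)
    finally show "norm d \<le> M * (\<beta> * p)" .
  qed simp
  hence "norm (exp (- y) * G y) \<le> M" using \<beta> by (simp add: \<phi>_def)
  hence "exp (Re y) * norm (exp (- y) * G y) \<le> exp (Re y) * M" by (intro mult_left_mono) auto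
  moreover have "exp (Re y) * norm (exp (- y) * G y) = norm (G y)"
    by (simp add: norm_mult norm_inverse exp_minus)
  moreover have "exp (Re y) * M = max 1 (exp (Re y))"
    by (cases "Re y \<ge> 0") (auto simp: M_def max_def simp flip: exp_add)
  ultimately show ?thesis by (simp add: G_eq)
qed

lemma norm_kummer1_le:
  assumes \<beta>: "\<beta> > 0"
  shows "norm (kummer1 \<beta> y) \<le> 1 + norm y / \<beta> * max 1 (exp (Re y))"
proof -
  have "norm (kummer1 \<beta> y) \<le> norm (1::complex) + norm (y / of_real \<beta> * kummer1 (\<beta> + 1) y)"
    unfolding kummer1_rec[OF \<beta>] by (rule norm_triangle_ineq)
  also have "norm (y / of_real \<beta> * kummer1 (\<beta> + 1) y) = norm y / \<beta> * norm (kummer1 (\<beta> + 1) y)"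
    using \<beta> by (simp add: norm_mult norm_divide)
  also have "\<dots> \<le> norm y / \<beta> * max 1 (exp (Re y))"
    using \<beta> by (intro mult_left_mono norm_kummer1_le_aux) auto
  finally show ?thesis by simp
qed

text \<open>Cauchy's formula for the derivatives turns the series into a contour integral against
  \<open>kummer1\<close>; the circle need not be centred at \<open>x\<close>, which is what makes a steepest-descent
  choice possible.\<close>
lemma norm_derivative_series_le:
  assumes f: "f holomorphic_on S" "cball c R \<subseteq> S" and x: "x \<in> ball c R" and \<beta>: "\<beta> > 0"
    and B: "\<And>\<zeta>. norm (\<zeta> - c) = R \<Longrightarrow> norm (f \<zeta> * kummer1 \<beta> (v / (\<zeta> - x))) \<le> B * norm (\<zeta> - x)"
  shows "norm (\<Sum>m. v ^ m / (pochhammer (of_real \<beta>) m * fact m) * (deriv ^^ m) f x) \<le> B * R"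
proof -
  have R: "R > 0" using x by (metis ball_eq_empty empty_iff not_le)
  define g where "g = (\<lambda>m \<zeta>. v ^ m / pochhammer (complex_of_real \<beta>) m * (f \<zeta> / (\<zeta> - x) ^ Suc m))"
  define a where "a = (\<lambda>m. v ^ m / (pochhammer (complex_of_real \<beta>) m * fact m) * (deriv ^^ m) f x)"
  have fc: "continuous_on (cball c R) f" using f holomorphic_on_imp_continuous_on holomorphic_on_subset by blast
  have fh: "f holomorphic_on ball c R" using f ball_subset_cball holomorphic_on_subset by blast
  have g_int: "(g m has_contour_integral (2 * pi * \<i> * a m)) (circlepath c R)" for m
  proof -
    have "(g m has_contour_integral v ^ m / pochhammer (complex_of_real \<beta>) m * ((2 * pi * \<i>) / fact m * (deriv ^^ m) f x)) (circlepath c R)"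
      unfolding g_def
      by (intro has_contour_integral_lmul Cauchy_has_contour_integral_higher_derivative_circlepath fc fh x)
    thus ?thesis by (simp add: a_def mult_ac)
  qed
  define d where "d = R - dist c x"
  have d: "d > 0" using x by (simp add: d_def)
  have dd: "norm (\<zeta> - x) \<ge> d" if "\<zeta> \<in> sphere c R" for \<zeta>
  proof -
    have "R = dist c \<zeta>" using that by simp
    also have "\<dots> \<le> dist c x + dist x \<zeta>" by (rule dist_triangle)
    finally show ?thesis by (simp add: d_def dist_norm norm_minus_commute)
  qed
  have "compact (f ` sphere c R)"
    by (intro compact_continuous_image continuous_on_subset[OF fc]) auto
  then obtain F where F: "\<And>\<zeta>. \<zeta> \<in> sphere c R \<Longrightarrow> norm (f \<zeta>) \<le> F"
    by (meson bounded_iff compact_imp_bounded imageI)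
  have g_eq: "g m \<zeta> = f \<zeta> / (\<zeta> - x) * ((v / (\<zeta> - x)) ^ m / pochhammer (complex_of_real \<beta>) m)" for m \<zeta>
    by (simp add: g_def power_divide mult_ac)
  have ul: "uniform_limit (sphere c R) (\<lambda>n \<zeta>. \<Sum>m<n. g m \<zeta>) (\<lambda>\<zeta>. \<Sum>m. g m \<zeta>) sequentially"
  proof (rule Weierstrass_m_test)
    show "summable (\<lambda>m. F / d * ((norm v / d) ^ m / pochhammer \<beta> m))"
      by (intro summable_mult summable_power_div_pochhammer \<beta>)
    fix m \<zeta> assume z: "\<zeta> \<in> sphere c R"
    have z0: "norm (\<zeta> - x) > 0" by (rule less_le_trans[OF d dd[OF z]])
    have "norm (g m \<zeta>) = norm (f \<zeta>) / norm (\<zeta> - x) * ((norm v / norm (\<zeta> - x)) ^ m / pochhammer \<beta> m)"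
      unfolding g_eq by (simp add: norm_mult norm_divide norm_power norm_pochhammer_of_real[OF \<beta>])
    also have "\<dots> \<le> F / d * ((norm v / d) ^ m / pochhammer \<beta> m)"
      using F[OF z] dd[OF z] d z0 pochhammer_pos[OF \<beta>, of m] order_trans[OF norm_ge_zero F[OF z]]
      by (intro mult_mono frac_le divide_right_mono power_mono divide_left_mono) auto
    finally show "norm (g m \<zeta>) \<le> F / d * ((norm v / d) ^ m / pochhammer \<beta> m)" .
  qed
  define k where "k = (\<lambda>\<zeta>. \<Sum>m. g m \<zeta>)"
  have k_eq: "k \<zeta> = f \<zeta> / (\<zeta> - x) * kummer1 \<beta> (v / (\<zeta> - x))" for \<zeta>
    unfolding k_def g_eq kummer1_def by (rule suminf_mult[OF summable_norm_cancel[OF summable_kummer1[OF \<beta>]]])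
  have sum_int: "((\<lambda>\<zeta>. \<Sum>m<n. g m \<zeta>) has_contour_integral (\<Sum>m<n. 2 * pi * \<i> * a m)) (circlepath c R)" for n
    by (intro has_contour_integral_sum g_int) auto
  have lim: "k contour_integrable_on circlepath c R"
       "(\<lambda>n. contour_integral (circlepath c R) (\<lambda>\<zeta>. \<Sum>m<n. g m \<zeta>)) \<longlonglongrightarrow> contour_integral (circlepath c R) k"
    unfolding k_def
    by (rule contour_integral_uniform_limit_circlepath[OF _ ul _ R];
        auto intro!: always_eventually has_contour_integral_integrable[OF sum_int])+
  have "(\<lambda>m. 2 * pi * \<i> * a m) sums contour_integral (circlepath c R) k"
    using lim(2) unfolding contour_integral_unique[OF sum_int] sums_def .
  hence "(\<lambda>m. a m) sums (contour_integral (circlepath c R) k / (2 * pi * \<i>))"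
    using sums_divide[of "\<lambda>m. 2 * pi * \<i> * a m" _ "2 * pi * \<i>"] by simp
  hence a: "(\<Sum>m. a m) = contour_integral (circlepath c R) k / (2 * pi * \<i>)" by (rule sums_unique[symmetric])
  have kB: "norm (k \<zeta>) \<le> B" if "norm (\<zeta> - c) = R" for \<zeta>
  proof -
    have z: "\<zeta> \<in> sphere c R" using that by (simp add: dist_norm norm_minus_commute)
    have z0: "norm (\<zeta> - x) > 0" by (rule less_le_trans[OF d dd[OF z]])
    have "norm (k \<zeta>) = norm (f \<zeta> * kummer1 \<beta> (v / (\<zeta> - x))) / norm (\<zeta> - x)"
      by (simp add: k_eq norm_mult norm_divide)
    also have "\<dots> \<le> B" using B[OF that] z0 by (simp add: pos_divide_le_eq)
    finally show ?thesis .
  qed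
  have "norm (contour_integral (circlepath c R) k) \<le> B * (2 * pi * R)"
  proof (rule has_contour_integral_bound_circlepath[OF has_contour_integral_integral[OF lim(1)] _ R kB])
    show "0 \<le> B" using kB[of "c + of_real R"] R by (auto intro: order_trans[OF norm_ge_zero])
  qed
  hence "norm (\<Sum>m. a m) \<le> B * R"
    unfolding a by (simp add: norm_divide norm_mult field_simps)
  thus ?thesis by (simp add: a_def)
qed

definition cusp_decay :: "real \<Rightarrow> (complex \<Rightarrow> complex) \<Rightarrow> bool" where
  "cusp_decay K T \<longleftrightarrow> (\<forall>K'. 0 \<le> K' \<and> K' < K \<longrightarrow> (\<forall>\<sigma>>0. \<exists>C. \<forall>\<epsilon>. \<epsilon> \<noteq> 0 \<and> norm \<epsilon> \<le> 1 \<and> \<sigma> * norm \<epsilon> \<le> Re \<epsilon> \<longrightarrow>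
     norm (T (\<i> + \<epsilon>)) \<le> C * exp (- K' * Re (1 / \<epsilon>))))"

text \<open>Half of the rate pays for the factor 1 / t, which enters through |y| in
  \<open>norm_kummer1_le\<close>.\<close>

lemma exp_neg_inverse_absorb:
  assumes "c > 0" "t > (0::real)"
  shows "1 / t * exp (- c / t) \<le> 2 / c * exp (- (c / 2) / t)"
proof -
  have "c / 2 / t \<le> exp (c / 2 / t)" using exp_ge_add_one_self[of "c / 2 / t"] by linarith
  hence "1 / t \<le> 2 / c * exp (c / 2 / t)" using assms by (simp add: field_simps)
  hence "1 / t * exp (- c / t) \<le> 2 / c * exp (c / 2 / t) * exp (- c / t)" by (intro mult_right_mono) auto
  also have "\<dots> = 2 / c * exp (- (c / 2) / t)"
    unfolding mult.assoc exp_add[symmetric] by (simp add: field_simps)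
  finally show ?thesis .
qed

lemma norm_exp_i_minus_1_le: "norm (exp (\<i> * of_real t) - 1) \<le> \<bar>t\<bar>"
proof -
  have "norm (exp (\<i> * of_real t) - exp (\<i> * of_real 0)) \<le> 1 * norm (\<i> * of_real t - \<i> * of_real 0 :: complex)"
  proof (rule field_differentiable_bound[where S = "{w. Re w = 0}" and f' = exp])
    show "convex {w::complex. Re w = 0}"
    proof -
      have "{w::complex. Re w = 0} = {w. Re w \<le> 0} \<inter> {w. Re w \<ge> 0}" by auto
      thus ?thesis by (simp only: convex_Int convex_halfspace_Re_le convex_halfspace_Re_ge)
    qed
  qed (auto intro!: derivative_eq_intros)
  thus ?thesis by (simp add: norm_mult)
qed

text \<open>With \<open>\<zeta> = \<i> + \<epsilon> \<omega>\<close> and \<open>\<kappa> = 1 - 1 / \<omega>\<close>, the circle \<open>\<bar>\<kappa>\<bar> = \<rho>\<close> around \<open>\<zeta> = \<i> + \<epsilon>\<close> passes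
  through the saddle points of the exponent \<open>(1 - \<kappa>) (\<i> u / \<kappa> - K') / \<epsilon>\<close>.\<close>
lemma kop_flat:
  assumes hol: "T holomorphic_on {x. Re x > 0}" and cusp: "cusp_decay K T" and \<beta>: "\<beta> > 0"
    and K': "0 < K'" "K' < K" and \<rho>: "0 < \<rho>" "\<rho> < 1" and c0: "c0 > 0"
    and saddle: "\<And>\<kappa>. norm \<kappa> = \<rho> \<Longrightarrow> Re ((1 - \<kappa>) * (\<i> * u / \<kappa> - of_real K')) \<le> - c0"
  shows "\<exists>C c h0. c > 0 \<and> h0 > 0 \<and> (\<forall>h. 0 < h \<and> h < h0 \<longrightarrow> norm (kop \<beta> u T (ray (pi / 2 - h) 0)) \<le> C * exp (- c / h))"
proof -
  \<comment> \<open>On the disc bounded by the contour Re \<omega> \<ge> 1 / (1 + \<rho>) and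
    |\<omega>| \<le> 1 / (1 - \<rho>), with quotient s. Multiplication by \<epsilon> turns the cone
    by the angle h / 2, hence s / 2 below.\<close>
  define s where "s = (1 - \<rho>) / (1 + \<rho>)"
  have s: "0 < s" "s < 1" using \<rho> by (auto simp: s_def)
  from cusp less_imp_le[OF K'(1)] K'(2) have "\<forall>\<sigma>>0. \<exists>C. \<forall>\<epsilon>. \<epsilon> \<noteq> 0 \<and> norm \<epsilon> \<le> 1 \<and> \<sigma> * norm \<epsilon> \<le> Re \<epsilon> \<longrightarrow> norm (T (\<i> + \<epsilon>)) \<le> C * exp (- K' * Re (1 / \<epsilon>))"
    unfolding cusp_decay_def by blast
  moreover have "s / 2 > 0" using s by simp
  ultimately obtain C0 where C0: "\<forall>\<epsilon>. \<epsilon> \<noteq> 0 \<and> norm \<epsilon> \<le> 1 \<and> s / 2 * norm \<epsilon> \<le> Re \<epsilon> \<longrightarrow> norm (T (\<i> + \<epsilon>)) \<le> C0 * exp (- K' * Re (1 / \<epsilon>))"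
    by meson
  \<comment> \<open>The first entry is what a perturbation by c0 / 2 leaves of the saddle bound; the
    second is the decay of T alone, which decides where Re y < 0.\<close>
  define c1 where "c1 = min (c0 / 2) (K' * (1 - \<rho>) / 2)"
  have c1: "c1 > 0" using c0 K'(1) \<rho> by (auto simp: c1_def)
  \<comment> \<open>A h bounds the change of the exponent, up to the factor 1 / e, when
    \<open>x\<close> is replaced by \<i> and \<open>\<tau>\<close> by 1.\<close>
  define A where "A = 3 * norm u / \<rho> + K'"
  have A: "A > 0" using K'(1) \<rho> by (auto simp: A_def intro!: add_nonneg_pos)
  \<comment> \<open>The entries serve in turn the cone condition, the bounds |\<epsilon> \<omega>|
    \<le> 1 and Re ((1 - \<kappa>) \<tau>) \<ge> (1 - \<rho>) / 2, and A h \<le> c0 / 2.\<close>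
  define h0 where "h0 = min s (min ((1 - \<rho>) / 2) (c0 / (2 * A)))"
  have h0: "h0 > 0" using s \<rho> c0 A by (auto simp: h0_def)
  define C where "C = \<bar>C0\<bar> * (1 + 2 * norm u / (\<rho> * \<beta>) * (2 / c1)) * (2 / (1 - \<rho>\<^sup>2))"
  have \<rho>2: "1 - \<rho>\<^sup>2 > 0" using \<rho> by (simp add: power_less_one_iff abs_square_less_1)
  have "norm (kop \<beta> u T (ray (pi / 2 - h) 0)) \<le> C * exp (- (c1 / 2) / h)" if h: "0 < h" "h < h0" for h
  proof -
    define x where "x = ray (pi / 2 - h) 0"
    \<comment> \<open>x - \<i> is a chord of the unit circle, of length 2 sin (h / 2) and direction
      exp (- \<i> h / 2).\<close>
    define e where "e = 2 * sin (h / 2)"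
    define \<epsilon> where "\<epsilon> = of_real e * exp (- \<i> * of_real (h / 2))"
    have h1: "h < s" "h < (1 - \<rho>) / 2" "h < c0 / (2 * A)" "h < 1" using h s by (auto simp: h0_def)
    have e: "e > 0" "e \<le> h"
    proof -
      have "sin (h / 2) > 0" using h h1 pi_gt3 by (intro sin_gt_zero) auto
      thus "e > 0" by (simp add: e_def)
      have "sin (h / 2) \<le> h / 2" using h by (intro sin_x_le_x) auto
      thus "e \<le> h" by (simp add: e_def)
    qed
    have n\<epsilon>: "norm \<epsilon> = e" using e by (simp add: \<epsilon>_def norm_mult)
    have \<epsilon>0: "\<epsilon> \<noteq> 0" using n\<epsilon> e by auto
    have x_eq: "x = \<i> + \<epsilon>"
    proof -
      have "\<epsilon> = \<i> * (exp (- \<i> * of_real h) - 1)"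
      proof -
        have "exp (- \<i> * of_real (h / 2)) * (exp (- \<i> * of_real (h / 2)) - exp (\<i> * of_real (h / 2))) = exp (- \<i> * of_real h) - 1"
          by (simp add: right_diff_distrib exp_add[symmetric] flip: exp_add)
        moreover have "exp (- \<i> * of_real (h / 2)) - exp (\<i> * of_real (h / 2)) = - 2 * \<i> * of_real (sin (h / 2))"
          by (simp add: complex_eq_iff Re_exp Im_exp)
        ultimately have "exp (- \<i> * of_real h) - 1 = exp (- \<i> * of_real (h / 2)) * (- 2 * \<i> * of_real (sin (h / 2)))" by simp
        thus ?thesis by (simp add: \<epsilon>_def e_def mult_ac)
      qed
      moreover have "x = \<i> * exp (- \<i> * of_real h)"
      proof -
        have "x = exp (\<i> * of_real (pi / 2)) * exp (- \<i> * of_real h)"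
          unfolding x_def ray_def exp_add[symmetric] by (simp add: algebra_simps)
        also have "exp (\<i> * of_real (pi / 2)) = \<i>" by (simp add: complex_eq_iff Re_exp Im_exp)
        finally show ?thesis .
      qed
      ultimately show ?thesis by (simp add: algebra_simps)
    qed
    define \<tau> where "\<tau> = exp (\<i> * of_real (h / 2))"
    have \<tau>: "1 / \<epsilon> = \<tau> / of_real e" "norm \<tau> = 1" "norm (\<tau> - 1) \<le> h / 2"
      using norm_exp_i_minus_1_le[of "h / 2"] h by (auto simp: \<epsilon>_def \<tau>_def exp_minus field_simps)
    have nx: "norm x = 1" by (simp add: x_def ray)
    \<comment> \<open>The condition |\<kappa>| = \<rho> reads |\<omega> - 1| = \<rho> |\<omega>|,
      the Apollonius circle with centre 1 / (1 - \<rho>^2) and radius \<rho> / (1 - \<rho>^2). Its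
      image under \<omega> -> \<i> + \<epsilon> \<omega> has centre \<open>cc\<close> and radius
      \<open>R\<close>.\<close>
    define cc where "cc = \<i> + \<epsilon> / of_real (1 - \<rho>\<^sup>2)"
    define R where "R = e * \<rho> / (1 - \<rho>\<^sup>2)"
    have R: "R > 0" using e \<rho> \<rho>2 by (simp add: R_def)
    have \<omega>: "\<exists>\<omega>. \<zeta> = \<i> + \<epsilon> * \<omega> \<and> norm (\<omega> - of_real (1 / (1 - \<rho>\<^sup>2))) = norm (\<zeta> - cc) / e" for \<zeta>
    proof (intro exI conjI)
      show "\<zeta> = \<i> + \<epsilon> * ((\<zeta> - \<i>) / \<epsilon>)" using \<epsilon>0 by simp
      have "(\<zeta> - \<i>) / \<epsilon> - of_real (1 / (1 - \<rho>\<^sup>2)) = (\<zeta> - cc) / \<epsilon>"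
        using \<epsilon>0 by (simp add: cc_def field_simps)
      thus "norm ((\<zeta> - \<i>) / \<epsilon> - of_real (1 / (1 - \<rho>\<^sup>2))) = norm (\<zeta> - cc) / e"
        by (simp add: norm_divide n\<epsilon>)
    qed
    have fac: "1 - \<rho>\<^sup>2 = (1 - \<rho>) * (1 + \<rho>)" by (simp add: power2_eq_square algebra_simps)
    have cone: "s * norm \<omega> \<le> Re \<omega>" "norm \<omega> \<le> 1 / (1 - \<rho>)" "Re \<omega> \<ge> 1 / 2"
      if w: "norm (\<omega> - of_real (1 / (1 - \<rho>\<^sup>2))) \<le> \<rho> / (1 - \<rho>\<^sup>2)" for \<omega>
    proof -
      have "1 / (1 - \<rho>\<^sup>2) - Re \<omega> \<le> \<rho> / (1 - \<rho>\<^sup>2)"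
        using abs_Re_le_cmod[of "\<omega> - of_real (1 / (1 - \<rho>\<^sup>2))"] w by simp
      moreover have "1 / (1 - \<rho>\<^sup>2) - \<rho> / (1 - \<rho>\<^sup>2) = 1 / (1 + \<rho>)"
        unfolding diff_divide_distrib[symmetric] fac using \<rho> by simp
      ultimately have re: "Re \<omega> \<ge> 1 / (1 + \<rho>)" by simp
      have "norm \<omega> \<le> norm (of_real (1 / (1 - \<rho>\<^sup>2)) :: complex) + \<rho> / (1 - \<rho>\<^sup>2)"
        using norm_triangle_sub[of \<omega> "of_real (1 / (1 - \<rho>\<^sup>2))"] w by simp
      also have "norm (of_real (1 / (1 - \<rho>\<^sup>2)) :: complex) = 1 / (1 - \<rho>\<^sup>2)" by (simp only: norm_of_real) (use \<rho>2 in simp)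
      also have "1 / (1 - \<rho>\<^sup>2) + \<rho> / (1 - \<rho>\<^sup>2) = 1 / (1 - \<rho>)"
        unfolding add_divide_distrib[symmetric] fac using \<rho> by simp
      finally show n: "norm \<omega> \<le> 1 / (1 - \<rho>)" .
      have "s * norm \<omega> \<le> s * (1 / (1 - \<rho>))" using n s by (intro mult_left_mono) auto
      also have "\<dots> = 1 / (1 + \<rho>)" using \<rho> by (simp add: s_def)
      finally show "s * norm \<omega> \<le> Re \<omega>" using re by simp
      have "1 / 2 \<le> 1 / (1 + \<rho>)" using \<rho> by (simp add: field_simps)
      thus "Re \<omega> \<ge> 1 / 2" using re by simp
    qed
    have cone': "s / 2 * norm (\<epsilon> * \<omega>) \<le> Re (\<epsilon> * \<omega>)" "\<omega> \<noteq> 0" "norm (\<epsilon> * \<omega>) \<le> 1"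
      if w: "norm (\<omega> - of_real (1 / (1 - \<rho>\<^sup>2))) \<le> \<rho> / (1 - \<rho>\<^sup>2)" for \<omega>
    proof -
      note cw = cone[OF w]
      show "\<omega> \<noteq> 0" using cw(3) by auto
      have "\<epsilon> * \<omega> = of_real e * (\<omega> + (exp (\<i> * of_real (- (h / 2))) - 1) * \<omega>)"
        by (simp add: \<epsilon>_def algebra_simps)
      hence "Re (\<epsilon> * \<omega>) = e * (Re \<omega> + Re ((exp (\<i> * of_real (- (h / 2))) - 1) * \<omega>))" by simp
      also have "\<dots> \<ge> e * (s * norm \<omega> - h / 2 * norm \<omega>)"
      proof (intro mult_left_mono)
        have "- Re ((exp (\<i> * of_real (- (h / 2))) - 1) * \<omega>) \<le> norm ((exp (\<i> * of_real (- (h / 2))) - 1) * \<omega>)"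
          using abs_Re_le_cmod[of "(exp (\<i> * of_real (- (h / 2))) - 1) * \<omega>"] by simp
        also have "\<dots> \<le> h / 2 * norm \<omega>" unfolding norm_mult
          using norm_exp_i_minus_1_le[of "- (h / 2)"] h by (intro mult_right_mono) auto
        finally show "s * norm \<omega> - h / 2 * norm \<omega> \<le> Re \<omega> + Re ((exp (\<i> * of_real (- (h / 2))) - 1) * \<omega>)"
          using cw(1) by simp
      qed (use e in simp)
      also have "e * (s * norm \<omega> - h / 2 * norm \<omega>) \<ge> s / 2 * norm (\<epsilon> * \<omega>)"
      proof -
        have "h / 2 * norm \<omega> \<le> s / 2 * norm \<omega>" using h1 by (intro mult_right_mono) auto
        hence "e * (s / 2 * norm \<omega>) \<le> e * (s * norm \<omega> - h / 2 * norm \<omega>)" using e by (intro mult_left_mono) auto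
        thus ?thesis by (simp add: norm_mult n\<epsilon> mult_ac)
      qed
      finally show "s / 2 * norm (\<epsilon> * \<omega>) \<le> Re (\<epsilon> * \<omega>)" .
      have "norm (\<epsilon> * \<omega>) \<le> h * (1 / (1 - \<rho>))" unfolding norm_mult n\<epsilon> using cw(2) e h by (intro mult_mono) auto
      also have "\<dots> \<le> 1" using h1 \<rho> by (simp add: field_simps)
      finally show "norm (\<epsilon> * \<omega>) \<le> 1" .
    qed
    have sub: "cball cc R \<subseteq> {x. Re x > 0}"
    proof
      fix \<zeta> assume "\<zeta> \<in> cball cc R"
      hence nz: "norm (\<zeta> - cc) \<le> R" by (simp add: dist_norm norm_minus_commute)
      obtain \<omega> where w: "\<zeta> = \<i> + \<epsilon> * \<omega>" "norm (\<omega> - of_real (1 / (1 - \<rho>\<^sup>2))) = norm (\<zeta> - cc) / e"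
        using \<omega> by blast
      have "norm (\<zeta> - cc) / e \<le> R / e" using nz e by (intro divide_right_mono) auto
      also have "R / e = \<rho> / (1 - \<rho>\<^sup>2)" using e by (simp add: R_def)
      finally have w': "norm (\<omega> - of_real (1 / (1 - \<rho>\<^sup>2))) \<le> \<rho> / (1 - \<rho>\<^sup>2)" using w(2) by simp
      have "norm (\<epsilon> * \<omega>) > 0" using cone'(2)[OF w'] \<epsilon>0 by simp
      hence "0 < s / 2 * norm (\<epsilon> * \<omega>)" using s by simp
      also have "\<dots> \<le> Re (\<epsilon> * \<omega>)" by (rule cone'(1)[OF w'])
      finally show "\<zeta> \<in> {x. Re x > 0}" by (simp add: w(1))
    qed
    \<comment> \<open>x corresponds to \<omega> = 1, at distance \<rho>^2 / (1 - \<rho>^2) from the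
      centre, less than the radius as \<rho> < 1.\<close>
    have x_in: "x \<in> ball cc R"
    proof -
      have "cc - x = \<epsilon> * of_real (\<rho>\<^sup>2 / (1 - \<rho>\<^sup>2))"
      proof -
        have "complex_of_real (1 - \<rho>\<^sup>2) \<noteq> 0" using \<rho>2 by (simp only: of_real_eq_0_iff)
        thus ?thesis by (simp add: cc_def x_eq field_simps)
      qed
      hence "dist cc x = e * (\<rho>\<^sup>2 / (1 - \<rho>\<^sup>2))" using \<rho>2 by (simp add: dist_norm norm_mult n\<epsilon> norm_divide del: of_real_divide of_real_diff)
      also have "\<dots> < R"
      proof -
        have "e * \<rho>\<^sup>2 < e * \<rho>" using e \<rho> by (simp add: power2_eq_square)
        thus ?thesis unfolding R_def using \<rho>2 by (simp add: divide_strict_right_mono)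
      qed
      finally show ?thesis by simp
    qed
    define E where "E = exp (- c1 / e)"
    define B where "B = \<bar>C0\<bar> * (E + 2 * norm u / (\<rho> * \<beta>) * (1 / e * E)) * (2 / (e * \<rho>))"
    have bound: "norm (T \<zeta> * kummer1 \<beta> (u * x / (\<zeta> - x))) \<le> B * norm (\<zeta> - x)" if z: "norm (\<zeta> - cc) = R" for \<zeta>
    proof -
      obtain \<omega> where w: "\<zeta> = \<i> + \<epsilon> * \<omega>" "norm (\<omega> - of_real (1 / (1 - \<rho>\<^sup>2))) = norm (\<zeta> - cc) / e"
        using \<omega> by blast
      have weq: "norm (\<omega> - of_real (1 / (1 - \<rho>\<^sup>2))) = \<rho> / (1 - \<rho>\<^sup>2)" using w(2) z e by (simp add: R_def)
      hence w': "norm (\<omega> - of_real (1 / (1 - \<rho>\<^sup>2))) \<le> \<rho> / (1 - \<rho>\<^sup>2)" by simp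
      have w0: "\<omega> \<noteq> 0" by (rule cone'(2)[OF w'])
      have apoll: "norm (\<omega> - 1) = \<rho> * norm \<omega>"
      proof -
        define c where "c = 1 / (1 - \<rho>\<^sup>2)"
        have cr: "c * (1 - \<rho>\<^sup>2) = 1" using \<rho>2 by (simp add: c_def)
        have "(norm (\<omega> - of_real c))\<^sup>2 = (\<rho> * c)\<^sup>2" using weq by (simp add: c_def)
        hence q: "(Re \<omega> - c)\<^sup>2 + (Im \<omega>)\<^sup>2 = (\<rho> * c)\<^sup>2" by (simp add: cmod_power2)
        have "(1 - \<rho>\<^sup>2) * ((Re \<omega>)\<^sup>2 + (Im \<omega>)\<^sup>2) = 2 * Re \<omega> - 1"
        proof -
          have "(Re \<omega>)\<^sup>2 + (Im \<omega>)\<^sup>2 = 2 * c * Re \<omega> - c * (c * (1 - \<rho>\<^sup>2))"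
            using q by (simp add: power2_eq_square algebra_simps)
          hence A: "(Re \<omega>)\<^sup>2 + (Im \<omega>)\<^sup>2 = c * (2 * Re \<omega> - 1)"
            unfolding cr by (simp add: algebra_simps)
          have "(1 - \<rho>\<^sup>2) * ((Re \<omega>)\<^sup>2 + (Im \<omega>)\<^sup>2) = (c * (1 - \<rho>\<^sup>2)) * (2 * Re \<omega> - 1)"
            unfolding A by (simp only: mult_ac)
          thus ?thesis unfolding cr by simp
        qed
        hence "(Re \<omega> - 1)\<^sup>2 + (Im \<omega>)\<^sup>2 = \<rho>\<^sup>2 * ((Re \<omega>)\<^sup>2 + (Im \<omega>)\<^sup>2)"
          by (simp add: power2_eq_square algebra_simps)
        hence "(norm (\<omega> - 1))\<^sup>2 = (\<rho> * norm \<omega>)\<^sup>2" by (simp add: cmod_power2 power_mult_distrib)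
        thus ?thesis using \<rho> by (simp add: power2_eq_iff_nonneg)
      qed
      define \<kappa> where "\<kappa> = 1 - 1 / \<omega>"
      have \<kappa>_eq: "\<kappa> = (\<omega> - 1) / \<omega>" using w0 by (simp add: \<kappa>_def field_simps)
      have n\<kappa>: "norm \<kappa> = \<rho>" using apoll w0 by (simp add: \<kappa>_eq norm_divide)
      have \<kappa>0: "\<kappa> \<noteq> 0" using n\<kappa> \<rho> by auto
      have w1: "\<omega> \<noteq> 1" using \<kappa>0 by (auto simp: \<kappa>_eq)
      have n1\<kappa>: "norm (1 - \<kappa>) \<le> 2" using norm_triangle_ineq4[of 1 \<kappa>] n\<kappa> \<rho> by simp
      have zx: "\<zeta> - x = \<epsilon> * (\<omega> - 1)" by (simp add: w(1) x_eq algebra_simps)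
      define y where "y = u * x / (\<zeta> - x)"
      have y_eq: "y = (1 - \<kappa>) * (u * x / \<kappa>) * \<tau> / of_real e"
      proof -
        have "y = u * x / (\<omega> - 1) * (1 / \<epsilon>)" by (simp add: y_def zx)
        also have "1 / (\<omega> - 1) = (1 - \<kappa>) / \<kappa>" using w0 w1 by (simp add: \<kappa>_eq \<kappa>_def field_simps)
        hence "u * x / (\<omega> - 1) = (1 - \<kappa>) * (u * x / \<kappa>)"
          by (metis (no_types, lifting) mult.commute mult.right_neutral times_divide_eq_right mult.assoc)
        finally show ?thesis by (simp add: \<tau>(1))
      qed
      have ny: "norm y \<le> 2 * norm u / \<rho> / e"
      proof -
        have "norm y = norm (1 - \<kappa>) * (norm u / \<rho>) / e"
          unfolding y_eq using e by (simp add: norm_mult norm_divide nx n\<kappa> \<tau>(2))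
        also have "\<dots> \<le> 2 * (norm u / \<rho>) / e"
          using n1\<kappa> \<rho> e by (intro divide_right_mono mult_right_mono) auto
        finally show ?thesis by simp
      qed
      have inv: "1 / (\<epsilon> * \<omega>) = (1 - \<kappa>) * \<tau> / of_real e"
        using \<tau>(1) by (simp add: \<kappa>_def) (metis (no_types, opaque_lifting) divide_divide_eq_left mult.commute times_divide_eq_left mult_1)
      have T: "norm (T \<zeta>) \<le> \<bar>C0\<bar> * exp (- K' * Re (1 / (\<epsilon> * \<omega>)))"
      proof -
        have "norm (T (\<i> + \<epsilon> * \<omega>)) \<le> C0 * exp (- K' * Re (1 / (\<epsilon> * \<omega>)))"
          using C0[rule_format, of "\<epsilon> * \<omega>"] cone'[OF w'] \<epsilon>0 by simp
        also have "\<dots> \<le> \<bar>C0\<bar> * exp (- K' * Re (1 / (\<epsilon> * \<omega>)))" by (intro mult_right_mono) auto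
        finally show ?thesis by (simp add: w(1))
      qed
      have ex1: "- K' * Re (1 / (\<epsilon> * \<omega>)) \<le> - c1 / e"
      proof -
        have "Re ((1 - \<kappa>) * \<tau>) = Re (1 - \<kappa>) + Re ((1 - \<kappa>) * (\<tau> - 1))" by (simp add: algebra_simps)
        moreover have "Re (1 - \<kappa>) \<ge> 1 - \<rho>" using complex_Re_le_cmod[of \<kappa>] n\<kappa> by simp
        moreover have "\<bar>Re ((1 - \<kappa>) * (\<tau> - 1))\<bar> \<le> 2 * (h / 2)"
          by (rule order_trans[OF abs_Re_le_cmod]) (unfold norm_mult, intro mult_mono n1\<kappa> \<tau>(3), auto)
        hence "Re ((1 - \<kappa>) * (\<tau> - 1)) \<ge> - h" unfolding abs_le_iff by auto
        moreover have "(1 - \<rho>) / 2 \<le> a" if "a = b + c" "1 - \<rho> \<le> b" "- h \<le> c" for a b c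
        proof -
          have "2 * h < 1 - \<rho>" using h1(2) by (simp add: field_simps)
          hence "1 - \<rho> \<le> 2 * a" using that by simp
          thus ?thesis by simp
        qed
        ultimately have "Re ((1 - \<kappa>) * \<tau>) \<ge> (1 - \<rho>) / 2" by blast
        hence "K' * Re ((1 - \<kappa>) * \<tau>) \<ge> K' * ((1 - \<rho>) / 2)" using K'(1) by (intro mult_left_mono) auto
        hence "K' * Re ((1 - \<kappa>) * \<tau>) \<ge> c1" by (simp add: c1_def)
        hence "c1 / e \<le> K' * Re ((1 - \<kappa>) * \<tau>) / e" using e by (intro divide_right_mono) auto
        thus ?thesis unfolding inv by (simp only: Re_divide_of_real) simp
      qed
      have ex2: "- K' * Re (1 / (\<epsilon> * \<omega>)) + Re y \<le> - c1 / e"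
      proof -
        \<comment> \<open>P is the form that the exponent Q takes for x = \<i> and \<tau> = 1; the
          saddle hypothesis speaks about P.\<close>
        define P where "P = (1 - \<kappa>) * (\<i> * u / \<kappa> - of_real K')"
        define Q where "Q = (1 - \<kappa>) * (u * x / \<kappa> - of_real K') * \<tau>"
        have "Q - P = (1 - \<kappa>) * (u / \<kappa> * (x * \<tau> - \<i>) - of_real K' * (\<tau> - 1))"
          by (simp add: P_def Q_def algebra_simps)
        hence "norm (Q - P) \<le> norm (1 - \<kappa>) * (norm (u / \<kappa> * (x * \<tau> - \<i>)) + norm (of_real K' * (\<tau> - 1)))"
          unfolding \<open>Q - P = _\<close> norm_mult[of "1 - \<kappa>"] by (intro mult_left_mono norm_triangle_ineq4) auto
        also have "\<dots> \<le> 2 * (norm u / \<rho> * (3 / 2 * h) + K' * (h / 2))"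
        proof (intro mult_mono add_mono n1\<kappa>)
          have "x * \<tau> - \<i> = x * (\<tau> - 1) + \<epsilon>" by (simp add: x_eq algebra_simps)
          hence "norm (x * \<tau> - \<i>) \<le> norm (x * (\<tau> - 1)) + norm \<epsilon>" by (simp add: norm_triangle_ineq)
          also have "\<dots> \<le> h / 2 + h" using \<tau>(3) e by (simp add: norm_mult nx n\<epsilon>)
          finally have "norm (x * \<tau> - \<i>) \<le> 3 / 2 * h" by simp
          hence "norm u / \<rho> * norm (x * \<tau> - \<i>) \<le> norm u / \<rho> * (3 / 2 * h)" using \<rho> by (intro mult_left_mono) auto
          thus "norm (u / \<kappa> * (x * \<tau> - \<i>)) \<le> norm u / \<rho> * (3 / 2 * h)" by (simp add: norm_mult norm_divide n\<kappa>)
          show "norm (of_real K' * (\<tau> - 1)) \<le> K' * (h / 2)"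
            unfolding norm_mult using \<tau>(3) K' by (intro mult_mono) auto
        qed (auto intro!: add_nonneg_nonneg)
        also have "\<dots> = A * h" by (simp add: A_def algebra_simps)
        also have "\<dots> \<le> c0 / 2"
        proof -
          have "h \<le> c0 / (2 * A)" using h1 by simp
          thus ?thesis using A by (simp add: field_simps)
        qed
        finally have "norm (Q - P) \<le> c0 / 2" .
        hence "Re Q - Re P \<le> c0 / 2" using complex_Re_le_cmod[of "Q - P"] by simp
        moreover have "Re P \<le> - c0" unfolding P_def by (rule saddle[OF n\<kappa>])
        ultimately have "Re Q \<le> - c1" by (simp add: c1_def min_def)
        moreover have "- K' * Re (1 / (\<epsilon> * \<omega>)) + Re y = Re Q / e"
        proof -
          have "of_real (- K') * (1 / (\<epsilon> * \<omega>)) + y = Q / of_real e"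
            unfolding inv y_eq Q_def by (simp add: diff_divide_distrib add_divide_distrib algebra_simps)
          hence "Re (of_real (- K') * (1 / (\<epsilon> * \<omega>)) + y) = Re Q / e" by (simp only: Re_divide_of_real)
          thus ?thesis by (simp only: plus_complex.sel Re_complex_of_real times_complex.sel) simp
        qed
        moreover have "Re Q / e \<le> (- c1) / e" if "Re Q \<le> - c1" using that e by (intro divide_right_mono) auto
        ultimately show ?thesis by simp
      qed
      \<comment> \<open>The maximum in the bound for the Kummer kernel splits into two cases:
        \<open>ex2\<close> covers the growing kernel, \<open>ex1\<close> the bounded one.\<close>
      have M: "exp (- K' * Re (1 / (\<epsilon> * \<omega>))) * max 1 (exp (Re y)) \<le> E"
      proof (cases "Re y \<ge> 0")
        case True
        hence "max 1 (exp (Re y)) = exp (Re y)" by (simp add: max_def)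
        thus ?thesis using ex2 by (simp add: E_def flip: exp_add)
      next
        case False
        hence "max 1 (exp (Re y)) = 1" by (simp add: max_def)
        thus ?thesis using ex1 by (simp add: E_def)
      qed
      have nzx: "norm (\<zeta> - x) \<ge> e * \<rho> / 2"
      proof -
        have "norm \<omega> \<ge> 1 / 2" using complex_Re_le_cmod[of \<omega>] cone(3)[OF w'] by simp
        hence "e * (\<rho> * (1 / 2)) \<le> e * (\<rho> * norm \<omega>)" using e \<rho> by (intro mult_left_mono) auto
        thus ?thesis by (simp add: zx norm_mult n\<epsilon> apoll)
      qed
      have "norm (T \<zeta> * kummer1 \<beta> y) \<le> (\<bar>C0\<bar> * exp (- K' * Re (1 / (\<epsilon> * \<omega>)))) * (1 + norm y / \<beta> * max 1 (exp (Re y)))"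
        unfolding norm_mult by (intro mult_mono T norm_kummer1_le \<beta>) auto
      also have "\<dots> = \<bar>C0\<bar> * (exp (- K' * Re (1 / (\<epsilon> * \<omega>))) + norm y / \<beta> * (exp (- K' * Re (1 / (\<epsilon> * \<omega>))) * max 1 (exp (Re y))))"
        by (simp only: ring_distribs mult_1_right mult_ac)
      also have "\<dots> \<le> \<bar>C0\<bar> * (E + (2 * norm u / \<rho> / e) / \<beta> * E)"
      proof (intro mult_left_mono add_mono mult_mono divide_right_mono M ny)
        show "exp (- K' * Re (1 / (\<epsilon> * \<omega>))) \<le> E" using ex1 by (simp add: E_def)
      qed (use \<beta> \<rho> e in \<open>auto simp: E_def\<close>)
      also have "\<dots> = B * (e * \<rho> / 2)" using e \<rho> by (simp add: B_def field_simps)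
      also have "\<dots> \<le> B * norm (\<zeta> - x)"
        using nzx e \<rho> \<beta> by (intro mult_left_mono) (auto simp: B_def E_def)
      finally show ?thesis by (simp add: y_def)
    qed
    have "kop \<beta> u T x = (\<Sum>m. (u * x) ^ m / (pochhammer (of_real \<beta>) m * fact m) * (deriv ^^ m) T x)"
      unfolding kop_def euler_def by (intro suminf_cong) (simp add: power_mult_distrib)
    hence "norm (kop \<beta> u T x) \<le> B * R"
      using norm_derivative_series_le[OF hol sub x_in \<beta> bound] by simp
    also have "B * R = \<bar>C0\<bar> * (E + 2 * norm u / (\<rho> * \<beta>) * (1 / e * E)) * (2 / (1 - \<rho>\<^sup>2))"
    proof -
      have "2 / (e * \<rho>) * (e * \<rho> / (1 - \<rho>\<^sup>2)) = 2 / (1 - \<rho>\<^sup>2)" using e \<rho> by simp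
      thus ?thesis by (simp only: B_def R_def mult.assoc)
    qed
    also have "\<dots> \<le> \<bar>C0\<bar> * (exp (- (c1 / 2) / h) + 2 * norm u / (\<rho> * \<beta>) * (2 / c1 * exp (- (c1 / 2) / h))) * (2 / (1 - \<rho>\<^sup>2))"
    proof (intro mult_right_mono mult_left_mono add_mono)
      have eh: "exp (- (c1 / 2) / e) \<le> exp (- (c1 / 2) / h)"
        using e h c1 by (simp add: frac_le)
      have "- c1 / e \<le> - (c1 / 2) / e" using c1 e by (simp add: field_simps)
      thus "E \<le> exp (- (c1 / 2) / h)" unfolding E_def using eh by (meson exp_le_cancel_iff order_trans)
      have "1 / e * E \<le> 2 / c1 * exp (- (c1 / 2) / e)" unfolding E_def by (rule exp_neg_inverse_absorb[OF c1 e(1)])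
      also have "\<dots> \<le> 2 / c1 * exp (- (c1 / 2) / h)" using eh c1 by (intro mult_left_mono) auto
      finally show "1 / e * E \<le> 2 / c1 * exp (- (c1 / 2) / h)" .
    qed (use \<rho> \<beta> \<rho>2 in auto)
    also have "\<dots> = C * exp (- (c1 / 2) / h)" by (simp add: C_def algebra_simps)
    finally show ?thesis by (simp add: x_def)
  qed
  thus ?thesis using c1 h0 by (intro exI[of _ C] exI[of _ "c1 / 2"] exI[of _ h0]) auto
qed

text \<open>\<open>w = (1 + \<i>) z / (2 \<surd>2)\<close> is a square root of \<open>\<i> z\<^sup>2 / 4\<close>, and the square
  \<open>\<bar>Re z\<bar>, \<bar>Im z\<bar> < \<surd>(2 K)\<close> is exactly the region \<open>\<bar>Re w\<bar> + \<bar>Im w\<bar> < \<surd>K\<close>.\<close>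
lemma saddle_condition:
  assumes z: "\<bar>Re z\<bar> < sqrt (2 * K)" "\<bar>Im z\<bar> < sqrt (2 * K)" and K: "K > 0"
  shows "\<exists>K' \<rho> c0. 0 < K' \<and> K' < K \<and> 0 < \<rho> \<and> \<rho> < 1 \<and> c0 > 0 \<and>
     (\<forall>\<kappa>. norm \<kappa> = \<rho> \<longrightarrow> Re ((1 - \<kappa>) * (\<i> * (z\<^sup>2 / 4) / \<kappa> - of_real K')) \<le> - c0)"
proof (cases "z = 0")
  \<comment> \<open>The circle through the saddles would shrink to a point here. The exponent is
    just - (1 - \<kappa>) K', so any radius below 1 serves.\<close>
  case True
  have "Re ((1 - \<kappa>) * (\<i> * (z\<^sup>2 / 4) / \<kappa> - of_real (K / 2))) \<le> - (K / 4)" if "norm \<kappa> = 1 / 2" for \<kappa>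
    using complex_Re_le_cmod[of \<kappa>] that K True by (simp add: field_simps)
  thus ?thesis using K by (intro exI[of _ "K / 2"] exI[of _ "1 / 2"] exI[of _ "K / 4"]) auto
next
  case False
  define w where "w = Complex ((Re z - Im z) / (2 * sqrt 2)) ((Re z + Im z) / (2 * sqrt 2))"
  have w2: "w\<^sup>2 = \<i> * (z\<^sup>2 / 4)"
    by (simp add: w_def complex_eq_iff power2_eq_square field_simps)
  have w0: "w \<noteq> 0" using w2 False by auto
  define S where "S = \<bar>Re w\<bar> + \<bar>Im w\<bar>"
  have "S = (\<bar>Re z - Im z\<bar> + \<bar>Re z + Im z\<bar>) / (2 * sqrt 2)"
    by (simp add: S_def w_def abs_divide flip: add_divide_distrib)
  also have "\<dots> < (2 * sqrt (2 * K)) / (2 * sqrt 2)"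
    by (intro divide_strict_right_mono) (use z in \<open>auto simp: abs_if split: if_splits\<close>)
  also have "\<dots> = sqrt K" by (simp add: real_sqrt_mult)
  finally have S: "S < sqrt K" .
  have S0: "S \<ge> 0" by (simp add: S_def)
  \<comment> \<open>Any r strictly between S and sqrt K would do: r < sqrt K makes the rate r^2
    admissible, and r > S makes \<open>c0\<close> positive.\<close>
  define r where "r = (S + sqrt K) / 2"
  have r: "S < r" "r < sqrt K" "r > 0" using S S0 by (auto simp: r_def)
  define K' where "K' = r\<^sup>2"
  have K': "0 < K'" "K' < K"
  proof -
    show "0 < K'" using r by (simp add: K'_def)
    have "r\<^sup>2 < (sqrt K)\<^sup>2" using r by (intro power_strict_mono) auto
    thus "K' < K" using K by (simp add: K'_def)
  qed
  \<comment> \<open>With w^2 = \<i> z^2 / 4 the exponent is w^2 / \<kappa> + r^2 \<kappa> - w^2 -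
    r^2, whose critical points are \<kappa> = w / r and \<kappa> = - w / r.\<close>
  define \<rho> where "\<rho> = norm w / r"
  have nw: "norm w \<le> S" unfolding S_def by (rule cmod_le)
  have \<rho>: "0 < \<rho>" "\<rho> < 1" using w0 r nw by (auto simp: \<rho>_def)
  \<comment> \<open>On the circle \<kappa> = w t / r with |t| = 1 the exponent equals 2 r w Re t -
    w^2 - r^2. Its real part is affine in Re t, and its maximum over -1 \<le> Re t \<le> 1 is -
    c0.\<close>
  define c0 where "c0 = (r - \<bar>Re w\<bar>)\<^sup>2 - (Im w)\<^sup>2"
  have c0: "c0 > 0"
  proof -
    have "\<bar>Im w\<bar>\<^sup>2 < (r - \<bar>Re w\<bar>)\<^sup>2" using r(1) by (intro power_strict_mono) (auto simp: S_def)
    thus ?thesis by (simp add: c0_def)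
  qed
  have "Re ((1 - \<kappa>) * (\<i> * (z\<^sup>2 / 4) / \<kappa> - of_real K')) \<le> - c0" if k: "norm \<kappa> = \<rho>" for \<kappa>
  proof -
    define t where "t = \<kappa> * of_real r / w"
    have \<kappa>: "\<kappa> = w * t / of_real r" using w0 r by (simp add: t_def)
    have nt: "norm t = 1" using k w0 r by (simp add: t_def norm_mult norm_divide \<rho>_def)
    have t0: "t \<noteq> 0" using nt by auto
    have ct: "1 / t = cnj t"
    proof -
      have "t * cnj t = 1" using nt by (simp add: complex_norm_square[symmetric])
      thus ?thesis using t0 by (simp add: field_simps)
    qed
    have "w\<^sup>2 / \<kappa> = of_real r * w * (1 / t)" using w0 r t0 by (simp add: \<kappa> power2_eq_square field_simps)
    hence a: "w\<^sup>2 / \<kappa> = of_real r * w * cnj t" unfolding ct .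
    have b: "of_real K' * \<kappa> = of_real r * w * t" using r by (simp add: \<kappa> K'_def power2_eq_square)
    have \<kappa>0: "\<kappa> \<noteq> 0" using k \<rho> by auto
    have "(1 - \<kappa>) * (w\<^sup>2 / \<kappa> - of_real K') = w\<^sup>2 / \<kappa> + of_real K' * \<kappa> - w\<^sup>2 - of_real K'"
      using \<kappa>0 by (simp add: field_simps)
    also have "\<dots> = of_real r * w * (t + cnj t) - w\<^sup>2 - of_real K'"
      unfolding a b by (simp add: algebra_simps)
    also have "t + cnj t = of_real (2 * Re t)" by (rule complex_add_cnj)
    finally have "Re ((1 - \<kappa>) * (w\<^sup>2 / \<kappa> - of_real K')) = 2 * r * (Re w * Re t) - ((Re w)\<^sup>2 - (Im w)\<^sup>2) - K'"
      by (simp add: power2_eq_square)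
    moreover have "Re w * Re t \<le> \<bar>Re w\<bar>"
    proof -
      have "Re w * Re t \<le> \<bar>Re w\<bar> * \<bar>Re t\<bar>" by (metis abs_ge_self abs_mult)
      also have "\<dots> \<le> \<bar>Re w\<bar> * 1" using abs_Re_le_cmod[of t] nt by (intro mult_left_mono) auto
      finally show ?thesis by simp
    qed
    hence "2 * r * (Re w * Re t) \<le> 2 * r * \<bar>Re w\<bar>" using r by (intro mult_left_mono) auto
    moreover have "2 * r * \<bar>Re w\<bar> - ((Re w)\<^sup>2 - (Im w)\<^sup>2) - K' = - c0"
      by (simp add: c0_def K'_def power2_eq_square algebra_simps)
    ultimately show ?thesis unfolding w2[symmetric] by linarith
  qed
  thus ?thesis using K' \<rho> c0 by (intro exI[of _ K'] exI[of _ \<rho>] exI[of _ c0]) auto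
qed

subsection \<open>Characters and theta series\<close>

lemma dirichlet_character_cong:
  assumes "dirichlet_character q chi" "[a = b] (mod int q)"
  shows "chi a = chi b"
proof -
  have per: "\<And>n. chi (n + int q) = chi n" using assms(1) by (simp add: dirichlet_character_def)
  obtain k where "a = b + int q * k" using cong_sym[OF assms(2)] unfolding cong_iff_lin by (elim exE)
  hence "a = int q * k + b" by simp
  thus ?thesis using periodic_add_mult[of chi q k b, OF per] by simp
qed

lemma dirichlet_character_1:
  assumes "dirichlet_character q chi"
  shows "chi 1 = 1"
proof -
  have "chi (1 * 1) = chi 1 * chi 1" using assms unfolding dirichlet_character_def by blast
  moreover have "chi 1 \<noteq> 0" using assms unfolding dirichlet_character_def by auto
  ultimately show ?thesis by simp
qed

text \<open>A value of modulus above 1 would have unbounded powers, all of them values of a periodic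
  function.\<close>

lemma norm_dirichlet_character_le:
  assumes "dirichlet_character q chi"
  shows "norm (chi n) \<le> 1"
proof (rule ccontr)
  assume "\<not> norm (chi n) \<le> 1"
  hence gt: "norm (chi n) > 1" by simp
  have q: "q > 0" and per: "\<And>n. chi (n + int q) = chi n" using assms by (auto simp: dirichlet_character_def)
  define B where "B = (\<Sum>r\<in>{0..<int q}. norm (chi r))"
  obtain k where k: "B < norm (chi n) ^ k" using real_arch_pow[OF gt] by blast
  have "norm (chi n) ^ k = norm (chi (n ^ k))"
  proof (induction k)
    case 0 thus ?case using dirichlet_character_1[OF assms] by simp
  next
    case (Suc k)
    have "chi (n * n ^ k) = chi n * chi (n ^ k)" using assms by (simp add: dirichlet_character_def)
    thus ?case using Suc by (simp add: norm_mult)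
  qed
  also have "\<dots> \<le> B" unfolding B_def by (rule periodic_norm_le[of q chi, OF q per])
  finally show False using k by simp
qed

lemma norm_dirichlet_character_coprime:
  assumes chi: "dirichlet_character q chi" and n: "coprime n (int q)"
  shows "norm (chi n) = 1"
proof -
  obtain n' where "[n * n' = 1] (mod int q)" using cong_solve_coprime_int[OF n] by auto
  hence "chi n * chi n' = 1"
    using dirichlet_character_cong[OF chi] dirichlet_character_1[OF chi] chi by (metis dirichlet_character_def)
  hence "norm (chi n) * norm (chi n') = 1" by (metis norm_mult norm_one)
  moreover have "norm (chi n) * norm (chi n') \<le> norm (chi n) * 1"
    by (intro mult_left_mono norm_dirichlet_character_le[OF chi]) auto
  ultimately show ?thesis using norm_dirichlet_character_le[OF chi, of n] by simp
qed

lemma sum_periodic_mult_coprime: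
  fixes g :: "int \<Rightarrow> complex"
  assumes q: "q > 0" and per: "\<And>n. g (n + int q) = g n" and a: "coprime a (int q)"
  shows "(\<Sum>r\<in>{0..<int q}. g (a * r)) = (\<Sum>r\<in>{0..<int q}. g r)"
proof -
  define f where "f = (\<lambda>r. (a * r) mod int q)"
  have inj: "inj_on f {0..<int q}"
  proof (rule inj_onI)
    fix x y assume xy: "x \<in> {0..<int q}" "y \<in> {0..<int q}" "f x = f y"
    hence "[a * x = a * y] (mod int q)" by (simp add: f_def cong_def)
    hence "[x = y] (mod int q)" using a by (simp add: cong_mult_lcancel)
    thus "x = y" using xy by (simp add: cong_def)
  qed
  have sub: "f ` {0..<int q} \<subseteq> {0..<int q}" using q by (auto simp: f_def)
  have "f ` {0..<int q} = {0..<int q}" by (rule endo_inj_surj[OF _ sub inj]) simp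
  hence "(\<Sum>r\<in>{0..<int q}. g r) = (\<Sum>r\<in>{0..<int q}. g (f r))"
    using sum.reindex[OF inj, of g] by (simp add: o_def)
  moreover have "g (f r) = g (a * r)" for r
    using periodic_add_mult[of g q "(a * r) div int q" "(a * r) mod int q", OF per] by (simp add: f_def)
  ultimately show ?thesis by simp
qed

lemma exp_2pi_int_div_periodic:
  assumes "q > 0"
  shows "exp (2 * pi * \<i> * of_int (r + int q) * of_int m / of_nat q) = exp (2 * pi * \<i> * of_int r * of_int m / of_nat q)"
  unfolding exp_eq by (rule exI[of _ m]) (use assms in \<open>simp add: field_simps\<close>)

lemma dft_character_shift:
  assumes chi: "dirichlet_character q chi" and a: "coprime a (int q)"
  shows "dft q chi m = chi a * dft q chi (a * m)"
proof -
  have q: "q > 0" and per: "\<And>n. chi (n + int q) = chi n" and mu: "\<And>m n. chi (m * n) = chi m * chi n"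
    using chi by (auto simp: dirichlet_character_def)
  define g where "g = (\<lambda>r. chi r * exp (2 * pi * \<i> * of_int r * of_int m / of_nat q))"
  have "g (n + int q) = g n" for n unfolding g_def per exp_2pi_int_div_periodic[OF q] ..
  from sum_periodic_mult_coprime[of q g, OF q this a]
  have "dft q chi m = (\<Sum>r\<in>{0..<int q}. g (a * r))" by (simp add: dft_def g_def)
  also have "\<dots> = chi a * dft q chi (a * m)"
    unfolding dft_def g_def sum_distrib_left by (intro sum.cong refl) (simp add: mu mult_ac)
  finally show ?thesis .
qed

lemma dft_cong:
  assumes q: "q > 0" and "[m = n] (mod int q)"
  shows "dft q a m = dft q a n"
proof -
  obtain k where k: "m = n + int q * k" using cong_sym[OF assms(2)] unfolding cong_iff_lin by (elim exE)
  have "exp (2 * pi * \<i> * of_int r * of_int m / of_nat q) = exp (2 * pi * \<i> * of_int r * of_int n / of_nat q)" for r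
    unfolding exp_eq by (rule exI[of _ "r * k"]) (use q in \<open>simp add: k field_simps\<close>)
  thus ?thesis by (simp add: dft_def)
qed

text \<open>Separability of Gauss sums. For m coprime to q substitute r -> m r. Otherwise q / gcd
  (m, q) is a proper divisor of q, so primitivity yields some a congruent to 1 modulo it with chi a
  different from 1; then a m and m agree modulo q, and the sum equals chi a times itself, hence
  0.\<close>

lemma dft_primitive:
  assumes prim: "primitive_character q chi"
  shows "dft q chi m = cnj (chi m) * dft q chi 1"
proof -
  have chi: "dirichlet_character q chi" using prim by (simp add: primitive_character_def)
  have q: "q > 0" using chi by (simp add: dirichlet_character_def)
  show ?thesis
  proof (cases "coprime m (int q)")
    case True
    have "chi m * cnj (chi m) = 1"
      using norm_dirichlet_character_coprime[OF chi True] by (simp add: complex_norm_square[symmetric])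
    moreover have "dft q chi 1 = chi m * dft q chi m" using dft_character_shift[OF chi True, of 1] by simp
    ultimately show ?thesis by (metis mult.assoc mult.commute mult_1)
  next
    case False
    define g where "g = gcd m (int q)"
    have g: "g > 0" "g \<noteq> 1" "g dvd m" "g dvd int q" using q False by (auto simp: g_def coprime_iff_gcd_eq_1)
    define d where "d = nat (int q div g)"
    have dg: "int d * g = int q" using g q by (simp add: d_def pos_imp_zdiv_nonneg_iff)
    have d_ne: "d \<noteq> q"
    proof
      assume "d = q"
      hence "int q * g = int q * 1" using dg by simp
      thus False using q g(2) by simp
    qed
    have "d dvd q" using dg by (metis dvd_triv_left int_dvd_int_iff)
    hence "\<not> (\<forall>a. coprime a (int q) \<and> [a = 1] (mod int d) \<longrightarrow> chi a = 1)"
      using prim d_ne unfolding primitive_character_def induced_modulus_def by blast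
    then obtain a where a: "coprime a (int q)" "[a = 1] (mod int d)" "chi a \<noteq> 1" by blast
    have "int d dvd a - 1" using a(2) by (simp add: cong_iff_dvd_diff)
    hence "int d * g dvd (a - 1) * m" using g(3) by (rule mult_dvd_mono)
    hence "[a * m = m] (mod int q)" unfolding dg by (simp add: cong_iff_dvd_diff algebra_simps)
    hence "dft q chi m = chi a * dft q chi m"
      using dft_character_shift[OF chi a(1), of m] dft_cong[OF q] by metis
    hence "(1 - chi a) * dft q chi m = 0" by (simp add: algebra_simps)
    hence "dft q chi m = 0" using a(3) by simp
    moreover have "chi m = 0" using False chi by (simp add: dirichlet_character_def)
    ultimately show ?thesis by simp
  qed
qed

text \<open>If q = 2 m with m odd, then every a coprime to q is odd, so a is congruent to 1 modulo q
  as soon as it is so modulo m. Thus m would be an induced modulus, against primitivity.\<close>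

lemma primitive_odd:
  assumes prim: "primitive_character q chi" and q4: "\<not> [q = 0] (mod 4)"
  shows "odd q"
proof
  assume "even q"
  then obtain m where m: "q = 2 * m" by blast
  have chi: "dirichlet_character q chi" using prim by (simp add: primitive_character_def)
  have q: "q > 0" using chi by (simp add: dirichlet_character_def)
  have "odd m"
  proof
    assume "even m"
    then obtain l where "m = 2 * l" by blast
    hence "q = 4 * l" using m by simp
    thus False using q4 by (simp add: cong_def)
  qed
  have "chi a = 1" if a: "coprime a (int q)" "[a = 1] (mod int m)" for a
  proof -
    have "odd a" using a(1) m by auto
    hence "[a = 1] (mod 2)" by (simp add: cong_def odd_iff_mod_2_eq_one)
    moreover have "coprime (2::int) (int m)" using \<open>odd m\<close> by simp
    ultimately have "[a = 1] (mod 2 * int m)" using a(2) by (intro coprime_cong_mult)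
    hence "[a = 1] (mod int q)" by (simp add: m)
    thus ?thesis using dirichlet_character_cong[OF chi] dirichlet_character_1[OF chi] by metis
  qed
  hence "induced_modulus q chi m" by (auto simp: induced_modulus_def m)
  hence "m = q" using prim by (simp add: primitive_character_def)
  thus False using m q by simp
qed

text \<open>Dividing by q makes x -> 1 / x the involution of the functional equation. Summing over
  all integers makes the k-th power a sum over the index set of \<open>Lk_series\<close>.\<close>

definition theta :: "nat \<Rightarrow> (int \<Rightarrow> complex) \<Rightarrow> complex \<Rightarrow> complex" where
  "theta q chi x = (\<Sum>\<^sub>\<infinity>n. of_int n ^ char_delta chi * chi n * exp (- (of_real pi * (x / of_nat q)) * (of_int n)\<^sup>2))"

lemma char_delta_le: "char_delta chi \<le> 1"
  by (simp add: char_delta_def)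

text \<open>Without the term at 0 the series decays like its terms at 1 and -1: exp (- pi Re X) is
  split off first, and Re X is replaced by c0 only in the remaining exponent with n^2 - 1 \<ge>
  0.\<close>

lemma gauss_series_bound:
  fixes w :: "int \<Rightarrow> complex"
  assumes w: "\<And>n. norm (w n) \<le> K * \<bar>of_int n\<bar> ^ d" "w 0 = 0" and c0: "c0 > 0"
  shows "\<exists>C\<ge>0. \<forall>X. c0 \<le> Re X \<longrightarrow> norm (\<Sum>\<^sub>\<infinity>n. w n * exp (- (of_real pi * X) * (of_int n)\<^sup>2)) \<le> C * exp (- pi * Re X)"
proof -
  have K: "K \<ge> 0" using order_trans[OF norm_ge_zero w(1)[of 1]] by simp
  define M where "M = (\<lambda>n::int. K * exp (pi * c0) * (\<bar>of_int n\<bar> ^ d * exp (0 * \<bar>of_int n\<bar> - (pi * c0) * (of_int n)\<^sup>2)))"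
  have M: "M summable_on UNIV" unfolding M_def by (intro summable_on_cmult_right summable_on_int_gauss) (use c0 in simp)
  have M0: "M n \<ge> 0" for n using K by (simp add: M_def)
  have bound: "norm (w n * exp (- (of_real pi * X) * (of_int n)\<^sup>2)) \<le> exp (- pi * Re X) * M n" if X: "c0 \<le> Re X" for X n
  proof (cases "n = 0")
    case True thus ?thesis using w(2) M0[of 0] by simp
  next
    case False
    have "(1::int) \<le> n\<^sup>2" using False by (metis int_one_le_iff_zero_less zero_less_power2)
    hence n2: "1 \<le> (real_of_int n)\<^sup>2" by (metis of_int_1_le_iff of_int_power)
    have "norm (w n * exp (- (of_real pi * X) * (of_int n)\<^sup>2)) \<le> (K * \<bar>of_int n\<bar> ^ d) * exp (- (pi * Re X) * (of_int n)\<^sup>2)"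
      unfolding norm_mult by (intro mult_mono w(1)) (auto intro!: K mult_nonneg_nonneg simp flip: of_int_power)
    also have "\<dots> \<le> (K * \<bar>of_int n\<bar> ^ d) * (exp (- pi * Re X) * (exp (pi * c0) * exp (- (pi * c0) * (of_int n)\<^sup>2)))"
    proof (rule mult_left_mono)
      have "pi * c0 * ((of_int n)\<^sup>2 - 1) \<le> pi * Re X * ((of_int n)\<^sup>2 - 1)"
        using X n2 by (intro mult_right_mono mult_left_mono) auto
      thus "exp (- (pi * Re X) * (of_int n)\<^sup>2) \<le> exp (- pi * Re X) * (exp (pi * c0) * exp (- (pi * c0) * (of_int n)\<^sup>2))"
        unfolding exp_add[symmetric] by (simp add: algebra_simps)
    qed (use K in simp)
    finally show ?thesis by (simp add: M_def mult_ac)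
  qed
  have "norm (\<Sum>\<^sub>\<infinity>n. w n * exp (- (of_real pi * X) * (of_int n)\<^sup>2)) \<le> (\<Sum>\<^sub>\<infinity>n. M n) * exp (- pi * Re X)" if X: "c0 \<le> Re X" for X
  proof -
    have s: "(\<lambda>n. exp (- pi * Re X) * M n) summable_on UNIV" by (intro summable_on_cmult_right M)
    have "(\<lambda>n. norm (w n * exp (- (of_real pi * X) * (of_int n)\<^sup>2))) summable_on UNIV"
      by (rule summable_on_comparison_test[OF s]) (use bound[OF X] in auto)
    hence "(\<lambda>n. w n * exp (- (of_real pi * X) * (of_int n)\<^sup>2)) summable_on UNIV" by (rule abs_summable_summable)
    from norm_infsum_le[OF has_sum_infsum[OF this] has_sum_infsum[OF s] bound[OF X]]
    show ?thesis unfolding infsum_cmult_right' by (simp only: mult.commute[of _ "exp (- pi * Re X)"])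
  qed
  moreover have "(\<Sum>\<^sub>\<infinity>n. M n) \<ge> 0" by (intro infsum_nonneg M0)
  ultimately show ?thesis by blast
qed

lemma powr_exp_bounded:
  assumes c: "c > (0::real)"
  shows "\<exists>C\<ge>0. \<forall>t\<ge>1. t powr a * exp (- c * t) \<le> C"
proof -
  obtain N :: nat where N: "a \<le> real N" using real_arch_simple by blast
  have "t powr a * exp (- c * t) \<le> fact N / c ^ N" if t: "t \<ge> 1" for t
  proof -
    have "(c * t) ^ N \<le> fact N * exp (c * t)" using c t by (intro power_le_fact_exp) auto
    hence "t ^ N \<le> fact N / c ^ N * exp (c * t)" using c by (simp add: power_mult_distrib field_simps)
    moreover have "t powr a \<le> t ^ N" using t N by (subst powr_realpow[symmetric]) (auto intro: powr_mono)
    ultimately have "t powr a * exp (- c * t) \<le> (fact N / c ^ N * exp (c * t)) * exp (- c * t)" by (intro mult_right_mono) auto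
    also have "\<dots> = fact N / c ^ N" by (simp add: mult.assoc flip: exp_add)
    finally show ?thesis .
  qed
  thus ?thesis using c by (intro exI[of _ "fact N / c ^ N"]) auto
qed

lemma norm_powr_half:
  fixes z :: complex
  assumes "z \<noteq> 0"
  shows "norm (z powr (-1/2 - of_nat d)) = norm z powr (- (1/2 + real d))"
proof -
  have "-1/2 - of_nat d = complex_of_real (- (1/2 + real d))" by simp
  hence "norm (z powr (-1/2 - of_nat d)) = exp (Re (complex_of_real (- (1/2 + real d)) * Ln z))"
    using assms by (simp only: powr_def if_False norm_exp_eq_Re)
  thus ?thesis using assms by (simp add: powr_def)
qed

lemma cone_inverse:
  assumes x: "x \<noteq> 0" and s: "\<sigma> * norm x \<le> Re x"
  shows "\<sigma> / norm x \<le> Re (1 / x)"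
proof -
  have n: "norm x > 0" using x by simp
  have "Re (1 / x) = Re x / (norm x)\<^sup>2" by (simp add: Re_divide cmod_power2)
  moreover have "\<sigma> / norm x = (\<sigma> * norm x) / (norm x)\<^sup>2" using n by (simp add: power2_eq_square)
  ultimately show ?thesis using s by (simp add: divide_right_mono)
qed

lemma theta_transform:
  assumes chi: "dirichlet_character q chi" and x: "Re x > 0"
  shows "theta q chi x = of_nat q ^ char_delta chi * (-\<i>) ^ char_delta chi * (of_nat q * x) powr (-1/2 - of_nat (char_delta chi)) *
     (\<Sum>\<^sub>\<infinity>m. of_int m ^ char_delta chi * dft q chi m * exp (- (of_real pi / (of_nat q * x)) * (of_int m)\<^sup>2))"
proof -
  have q: "q > 0" and per: "\<And>n. chi (n + int q) = chi n" using chi by (auto simp: dirichlet_character_def)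
  have "of_nat q ^ 2 * (x / of_nat q) = of_nat q * x" using q by (simp add: power2_eq_square)
  moreover have "Re (x / of_nat q) > 0" using q x by simp
  ultimately show ?thesis
    unfolding theta_def using theta_periodic_transform[of q chi "x / of_nat q" "char_delta chi", OF q per _ char_delta_le] by simp
qed

text \<open>For |x| \<ge> 1 the series itself decays, for |x| < 1 its Jacobi transform. Neither has
  a term at 0: chi 0 = 0 since q > 1, and then the finite Fourier transform vanishes at 0 by
  \<open>dft_primitive\<close>.\<close>

lemma theta_sector_decay:
  assumes prim: "primitive_character q chi" and q2: "q \<ge> 2"
  shows "sector_decay (theta q chi)"
  unfolding sector_decay_def
proof (intro conjI allI impI)
  have chi: "dirichlet_character q chi" using prim by (simp add: primitive_character_def)
  have q: "real q > 0" using q2 by simp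
  define D where "D = char_delta chi"
  define w where "w = (\<lambda>n::int. of_int n ^ D * chi n)"
  have chi0: "chi 0 = 0" using chi q2 by (simp add: dirichlet_character_def)
  have w: "norm (w n) \<le> 1 * \<bar>of_int n\<bar> ^ D" for n
    using mult_left_mono[OF norm_dirichlet_character_le[OF chi, of n], of "\<bar>of_int n\<bar> ^ D"] by (simp add: w_def norm_mult norm_power)
  have w0: "w 0 = 0" using chi0 by (simp add: w_def)
  have theta_w: "theta q chi x = (\<Sum>\<^sub>\<infinity>n. w n * exp (- (of_real pi * (x / of_nat q)) * (of_int n)\<^sup>2))" for x
    by (simp add: theta_def w_def D_def)
  have "(\<lambda>x. \<Sum>\<^sub>\<infinity>n. w n * exp ((0::complex) * of_int n - (of_real pi * (x / of_nat q)) * (of_int n)\<^sup>2)) holomorphic_on {x. Re x > 0}"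
  proof (rule holomorphic_weighted_gauss(1))
    show "norm (w n) \<le> 1 * (1 + \<bar>of_int n\<bar> ^ D)" for n using w[of n] by simp
  qed (use q in \<open>auto intro!: holomorphic_intros right_halfplane\<close>)
  thus "theta q chi holomorphic_on {x. Re x > 0}" unfolding theta_w[abs_def] by (simp add: theta_w[abs_def])
  fix \<sigma> p :: real assume \<sigma>: "\<sigma> > 0"
  have c0: "\<sigma> / real q > 0" using \<sigma> q by simp
  obtain C1 where C1: "C1 \<ge> 0" "\<forall>X. \<sigma> / real q \<le> Re X \<longrightarrow> norm (\<Sum>\<^sub>\<infinity>n. w n * exp (- (of_real pi * X) * (of_int n)\<^sup>2)) \<le> C1 * exp (- pi * Re X)"
    using gauss_series_bound[OF w w0 c0] by (elim exE conjE) (rule that, assumption+)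
  define K where "K = (\<Sum>r\<in>{0..<int q}. norm (chi r))"
  define v where "v = (\<lambda>m::int. of_int m ^ D * dft q chi m)"
  have v: "norm (v n) \<le> K * \<bar>of_int n\<bar> ^ D" for n
    using mult_left_mono[OF norm_dft_le[of q chi n], of "\<bar>of_int n\<bar> ^ D"] by (simp add: v_def K_def norm_mult norm_power mult.commute)
  have v0: "v 0 = 0" using dft_primitive[OF prim, of 0] chi0 by (simp add: v_def)
  obtain C2 where C2: "C2 \<ge> 0" "\<forall>X. \<sigma> / real q \<le> Re X \<longrightarrow> norm (\<Sum>\<^sub>\<infinity>n. v n * exp (- (of_real pi * X) * (of_int n)\<^sup>2)) \<le> C2 * exp (- pi * Re X)"
    using gauss_series_bound[OF v v0 c0] by (elim exE conjE) (rule that, assumption+)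
  define c where "c = pi * (\<sigma> / real q)"
  have c: "c > 0" unfolding c_def by (intro mult_pos_pos pi_gt_zero c0)
  obtain A1 where A1: "A1 \<ge> 0" "\<forall>t\<ge>1. t powr (-p) * exp (- c * t) \<le> A1" using powr_exp_bounded[OF c, of "-p"] by (elim exE conjE) (rule that, assumption+)
  obtain A2 where A2: "A2 \<ge> 0" "\<forall>t\<ge>1. t powr (1/2 + real D + p) * exp (- c * t) \<le> A2" using powr_exp_bounded[OF c, of "1/2 + real D + p"] by (elim exE conjE) (rule that, assumption+)
  define Q where "Q = real q ^ D * real q powr (- (1/2 + real D))"
  have Q: "Q \<ge> 0" by (simp add: Q_def)
  have "norm (theta q chi x) \<le> (C1 * A1 + Q * C2 * A2) * norm x powr p" if x: "x \<noteq> 0 \<and> \<sigma> * norm x \<le> Re x" for x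
  proof -
    have nx: "norm x > 0" using x by simp
    hence "\<sigma> * norm x > 0" using \<sigma> by simp
    hence rex: "Re x > 0" using x by linarith
    show ?thesis
    proof (cases "norm x \<ge> 1")
      case True
      have "\<sigma> * 1 \<le> \<sigma> * norm x" using True \<sigma> by (intro mult_left_mono) auto
      hence "\<sigma> / real q \<le> Re (x / of_nat q)" using x q by (simp add: divide_right_mono)
      hence "norm (theta q chi x) \<le> C1 * exp (- pi * Re (x / of_nat q))" unfolding theta_w using C1(2) by blast
      also have "exp (- pi * Re (x / of_nat q)) \<le> exp (- c * norm x)"
        using x q by (simp add: c_def divide_right_mono)
      also have "exp (- c * norm x) \<le> A1 * norm x powr p"
      proof -
        have "exp (- c * norm x) = norm x powr p * (norm x powr (-p) * exp (- c * norm x))"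
          using nx by (simp add: mult.assoc[symmetric] flip: powr_add)
        also have "\<dots> \<le> norm x powr p * A1"
          using A1(2) True by (intro mult_left_mono) auto
        finally show ?thesis by (simp only: mult.commute)
      qed
      finally have "norm (theta q chi x) \<le> C1 * A1 * norm x powr p" using C1(1) by (simp add: mult_left_mono mult.assoc)
      also have "\<dots> \<le> (C1 * A1 + Q * C2 * A2) * norm x powr p" using Q C2(1) A2(1) by (intro mult_right_mono) auto
      finally show ?thesis .
    next
      case False
      define t where "t = 1 / norm x"
      have t: "t \<ge> 1" using False nx by (simp add: t_def)
      have ci: "\<sigma> * t \<le> Re (1 / x)" using cone_inverse[of x \<sigma>] x by (simp add: t_def)
      have "\<sigma> * 1 \<le> \<sigma> * t" using t \<sigma> by (intro mult_left_mono) auto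
      hence "\<sigma> \<le> Re (1 / x)" using ci by simp
      have X: "1 / (of_nat q * x) = (1 / x) / of_real (real q)" by simp
      have reX: "Re (1 / (of_nat q * x)) = Re (1 / x) / real q" unfolding X by (simp only: Re_divide_of_real)
      have "\<sigma> / real q \<le> Re (1 / (of_nat q * x))" unfolding reX using \<open>\<sigma> \<le> Re (1 / x)\<close> q by (simp add: divide_right_mono)
      hence S: "norm (\<Sum>\<^sub>\<infinity>n. v n * exp (- (of_real pi * (1 / (of_nat q * x))) * (of_int n)\<^sup>2)) \<le> C2 * exp (- pi * Re (1 / (of_nat q * x)))"
        using C2(2) by blast
      have e: "exp (- pi * Re (1 / (of_nat q * x))) \<le> exp (- c * t)"
        unfolding reX using ci q by (simp add: c_def divide_right_mono)
      have "norm (theta q chi x) = Q * norm x powr (- (1/2 + real D)) * norm (\<Sum>\<^sub>\<infinity>n. v n * exp (- (of_real pi * (1 / (of_nat q * x))) * (of_int n)\<^sup>2))"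
      proof -
        have "theta q chi x = of_nat q ^ D * (-\<i>) ^ D * (of_nat q * x) powr (-1/2 - of_nat D) *
            (\<Sum>\<^sub>\<infinity>n. v n * exp (- (of_real pi * (1 / (of_nat q * x))) * (of_int n)\<^sup>2))"
          unfolding theta_transform[OF chi rex] D_def v_def by simp
        hence "norm (theta q chi x) = norm (of_nat q ^ D * (-\<i>) ^ D * (of_nat q * x) powr (-1/2 - of_nat D) *
            (\<Sum>\<^sub>\<infinity>n. v n * exp (- (of_real pi * (1 / (of_nat q * x))) * (of_int n)\<^sup>2)))" by (rule arg_cong)
        also have "\<dots> = real q ^ D * norm ((of_nat q * x) powr (-1/2 - of_nat D)) *
            norm (\<Sum>\<^sub>\<infinity>n. v n * exp (- (of_real pi * (1 / (of_nat q * x))) * (of_int n)\<^sup>2))"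
          by (simp only: norm_mult norm_power norm_of_nat norm_minus_cancel norm_ii power_one mult_1_right)
        also have "norm ((of_nat q * x) powr (-1/2 - of_nat D)) = norm (of_nat q * x) powr (- (1/2 + real D))"
          by (rule norm_powr_half) (use q x in simp)
        also have "\<dots> = real q powr (- (1/2 + real D)) * norm x powr (- (1/2 + real D))"
          by (simp only: norm_mult norm_of_nat powr_mult)
        finally show ?thesis by (simp only: Q_def mult.assoc)
      qed
      also have "\<dots> \<le> Q * norm x powr (- (1/2 + real D)) * (C2 * exp (- c * t))"
        using S e C2(1) Q by (intro mult_left_mono order_trans[OF S] mult_left_mono) auto
      also have "norm x powr (- (1/2 + real D)) = t powr (1/2 + real D)"
        using nx by (simp add: t_def powr_divide powr_minus field_simps)
      also have "Q * t powr (1/2 + real D) * (C2 * exp (- c * t)) = Q * C2 * (t powr (1/2 + real D + p) * exp (- c * t)) * norm x powr p"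
      proof -
        have "t powr p * norm x powr p = 1" using nx by (simp add: t_def powr_divide)
        moreover have "t powr (1/2 + real D + p) = t powr (1/2 + real D) * t powr p" by (rule powr_add)
        ultimately show ?thesis by (simp add: mult_ac)
      qed
      also have "\<dots> \<le> Q * C2 * A2 * norm x powr p"
        using A2(2) t Q C2(1) by (intro mult_right_mono mult_left_mono) auto
      also have "\<dots> \<le> (C1 * A1 + Q * C2 * A2) * norm x powr p" using C1(1) A1(1) by (intro mult_right_mono) auto
      finally show ?thesis .
    qed
  qed
  thus "\<exists>C. \<forall>x. x \<noteq> 0 \<and> \<sigma> * norm x \<le> Re x \<longrightarrow> norm (theta q chi x) \<le> C * norm x powr p" by blast
qed

lemma sum_antiperiodic:
  fixes b :: "int \<Rightarrow> complex"
  assumes "\<And>r. b (r + int q) = - b r"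
  shows "(\<Sum>r\<in>{0..<int (2 * q)}. b r) = 0"
proof -
  have "{0..<int (2 * q)} = {0..<int q} \<union> {int q..<int (2 * q)}" by auto
  hence "(\<Sum>r\<in>{0..<int (2 * q)}. b r) = (\<Sum>r\<in>{0..<int q}. b r) + (\<Sum>r\<in>{int q..<int (2 * q)}. b r)"
    by (simp only:) (rule sum.union_disjoint, auto)
  also have "(\<Sum>r\<in>{int q..<int (2 * q)}. b r) = (\<Sum>r\<in>{0..<int q}. b (r + int q))"
    by (rule sum.reindex_bij_witness[of _ "\<lambda>r. r + int q" "\<lambda>r. r - int q"]) auto
  also have "\<dots> = - (\<Sum>r\<in>{0..<int q}. b r)" by (simp add: assms sum_negf)
  finally show ?thesis by simp
qed

text \<open>The phase exp (- pi \<i> n^2 / q) is absorbed into weights of period 2 q. Their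
  transform has no term at frequency 0: for odd characters because of the factor m, for even ones
  because q is odd, which makes the weights antiperiodic modulo q.\<close>

lemma theta_cusp_decay:
  assumes prim: "primitive_character q chi" and q2: "q \<ge> 2"
    and q4: "even_character chi \<Longrightarrow> \<not> [q = 0] (mod 4)"
    and K': "K' < pi / (4 * real q)" and \<sigma>: "\<sigma> > 0"
  shows "\<exists>C. \<forall>\<epsilon>. \<epsilon> \<noteq> 0 \<and> norm \<epsilon> \<le> 1 \<and> \<sigma> * norm \<epsilon> \<le> Re \<epsilon> \<longrightarrow>
     norm (theta q chi (\<i> + \<epsilon>)) \<le> C * exp (- K' * Re (1 / \<epsilon>))"
proof -
  have chi: "dirichlet_character q chi" using prim by (simp add: primitive_character_def)
  have q: "real q > 0" "q > 0" using q2 by auto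
  have per: "\<And>n. chi (n + int q) = chi n" using chi by (auto simp: dirichlet_character_def)
  define D where "D = char_delta chi"
  define a where "a = (\<lambda>n::int. chi n * exp (- (pi * \<i> / of_nat q) * (of_int n)\<^sup>2))"
  have a_shift: "a (n + int q) = (if even q then a n else - a n)" for n
  proof -
    have "- (pi * \<i> / of_nat q) * (of_int (n + int q))\<^sup>2 = - (pi * \<i> / of_nat q) * (of_int n)\<^sup>2 + (of_int (- n) * (2 * pi * \<i>) - of_nat q * (pi * \<i>))"
      using q by (simp add: power2_eq_square field_simps)
    moreover have "exp (of_int (- n) * (2 * pi * \<i>)) = (1 :: complex)"
      unfolding exp_eq_1 by (auto intro!: exI[of _ "- n"])
    moreover have "exp (of_nat q * (pi * \<i>)) = (-1 :: complex) ^ q"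
      by (simp only: exp_of_nat_mult exp_pi_i)
    ultimately have "exp (- (pi * \<i> / of_nat q) * (of_int (n + int q))\<^sup>2) = exp (- (pi * \<i> / of_nat q) * (of_int n)\<^sup>2) / (-1) ^ q"
      by (simp only: exp_add exp_diff) simp
    thus ?thesis by (simp only: a_def per) auto
  qed
  have a_per: "a (n + int (2 * q)) = a n" for n
    using a_shift[of n] a_shift[of "n + int q"] by (simp add: add.assoc)
  have theta_a: "theta q chi (\<i> + \<epsilon>) = (\<Sum>\<^sub>\<infinity>n. of_int n ^ D * a n * exp (- (of_real pi * (\<epsilon> / of_nat q)) * (of_int n)\<^sup>2))" for \<epsilon>
  proof -
    have "exp (- (of_real pi * ((\<i> + \<epsilon>) / of_nat q)) * (of_int n)\<^sup>2) = exp (- (pi * \<i> / of_nat q) * (of_int n)\<^sup>2) * exp (- (of_real pi * (\<epsilon> / of_nat q)) * (of_int n)\<^sup>2)" for n :: int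
      unfolding exp_add[symmetric] by (rule arg_cong[of _ _ exp]) (use q in \<open>simp add: field_simps\<close>)
    thus ?thesis unfolding theta_def D_def a_def by (simp only: mult_ac)
  qed
  define K where "K = (\<Sum>r\<in>{0..<int (2 * q)}. norm (a r))"
  define v where "v = (\<lambda>m::int. of_int m ^ D * dft (2 * q) a m)"
  have v: "norm (v n) \<le> K * \<bar>of_int n\<bar> ^ D" for n
    using mult_left_mono[OF norm_dft_le[of "2 * q" a n], of "\<bar>of_int n\<bar> ^ D"] by (simp add: v_def K_def norm_mult norm_power mult.commute)
  have v0: "v 0 = 0"
  proof (cases "even_character chi")
    case True
    hence "odd q" using primitive_odd[OF prim q4] by blast
    hence "(\<Sum>r\<in>{0..<int (2 * q)}. a r) = 0" by (intro sum_antiperiodic) (simp add: a_shift)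
    thus ?thesis by (simp add: v_def dft_def)
  next
    case False
    thus ?thesis by (simp add: v_def D_def char_delta_def)
  qed
  define c0 where "c0 = \<sigma> / (4 * real q)"
  have c0: "c0 > 0" using \<sigma> q by (simp add: c0_def)
  obtain C2 where C2: "C2 \<ge> 0" "\<forall>X. c0 \<le> Re X \<longrightarrow> norm (\<Sum>\<^sub>\<infinity>n. v n * exp (- (of_real pi * X) * (of_int n)\<^sup>2)) \<le> C2 * exp (- pi * Re X)"
    using gauss_series_bound[OF v v0 c0] by (elim exE conjE) (rule that, assumption+)
  \<comment> \<open>The gap between pi / (4 q) and K' pays for the power of 1 / |\<epsilon>| from
    Jacobi's transformation.\<close>
  define c where "c = (pi / (4 * real q) - K') * \<sigma>"
  have c: "c > 0" using K' \<sigma> by (simp add: c_def)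
  obtain A where A: "A \<ge> 0" "\<forall>t\<ge>1. t powr (1/2 + real D) * exp (- c * t) \<le> A" using powr_exp_bounded[OF c, of "1/2 + real D"] by (elim exE conjE) (rule that, assumption+)
  define Q where "Q = real (2 * q) ^ D * (4 * real q) powr (- (1/2 + real D))"
  have Q: "Q \<ge> 0" by (simp add: Q_def)
  have "norm (theta q chi (\<i> + \<epsilon>)) \<le> (Q * C2 * A) * exp (- K' * Re (1 / \<epsilon>))" if e: "\<epsilon> \<noteq> 0 \<and> norm \<epsilon> \<le> 1 \<and> \<sigma> * norm \<epsilon> \<le> Re \<epsilon>" for \<epsilon>
  proof -
    have ne: "norm \<epsilon> > 0" using e by simp
    hence "\<sigma> * norm \<epsilon> > 0" using \<sigma> by simp
    hence re: "Re \<epsilon> > 0" using e by linarith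
    define t where "t = 1 / norm \<epsilon>"
    have t: "t \<ge> 1" using e ne by (simp add: t_def)
    have ci: "\<sigma> * t \<le> Re (1 / \<epsilon>)" using cone_inverse[of \<epsilon> \<sigma>] e by (simp add: t_def)
    define X where "X = 1 / (4 * of_nat q * \<epsilon>)"
    have "X = (1 / \<epsilon>) / of_real (4 * real q)" by (simp add: X_def)
    hence reX: "Re X = Re (1 / \<epsilon>) / (4 * real q)" by (simp only: Re_divide_of_real)
    have "c0 \<le> c0 * t" using t c0 by simp
    also have "\<dots> \<le> Re X" unfolding reX c0_def using ci q by (simp add: divide_right_mono)
    finally have S: "norm (\<Sum>\<^sub>\<infinity>n. v n * exp (- (of_real pi * X) * (of_int n)\<^sup>2)) \<le> C2 * exp (- pi * Re X)"
      using C2(2) by blast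
    \<comment> \<open>Modulus 2 q and scaling 1 / q combine to 4 q, the origin of the rate pi / (4
      q).\<close>
    have M: "of_nat (2 * q) ^ 2 * (\<epsilon> / of_nat q) = 4 * of_nat q * \<epsilon>" using q by (simp add: power2_eq_square)
    have "theta q chi (\<i> + \<epsilon>) = of_nat (2 * q) ^ D * (-\<i>) ^ D * (4 * of_nat q * \<epsilon>) powr (-1/2 - of_nat D) *
       (\<Sum>\<^sub>\<infinity>m. of_int m ^ D * dft (2 * q) a m * exp (- (of_real pi / (4 * of_nat q * \<epsilon>)) * (of_int m)\<^sup>2))"
      unfolding theta_a M[symmetric]
      by (rule theta_periodic_transform[of "2 * q" a]) (use q re a_per char_delta_le in \<open>auto simp: D_def\<close>)
    also have "of_real pi / (4 * of_nat q * \<epsilon>) = of_real pi * X" by (simp add: X_def)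
    also have "of_nat (2 * q) ^ D * (-\<i>) ^ D * (4 * of_nat q * \<epsilon>) powr (-1/2 - of_nat D) *
       (\<Sum>\<^sub>\<infinity>m. of_int m ^ D * dft (2 * q) a m * exp (- (of_real pi * X) * (of_int m)\<^sup>2)) =
       of_nat (2 * q) ^ D * (-\<i>) ^ D * (4 * of_nat q * \<epsilon>) powr (-1/2 - of_nat D) * (\<Sum>\<^sub>\<infinity>m. v m * exp (- (of_real pi * X) * (of_int m)\<^sup>2))"
      by (simp add: v_def)
    finally have "norm (theta q chi (\<i> + \<epsilon>)) = real (2 * q) ^ D * norm (4 * of_nat q * \<epsilon>) powr (- (1/2 + real D)) * norm (\<Sum>\<^sub>\<infinity>m. v m * exp (- (of_real pi * X) * (of_int m)\<^sup>2))"
    proof -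
      assume th: "theta q chi (\<i> + \<epsilon>) = of_nat (2 * q) ^ D * (-\<i>) ^ D * (4 * of_nat q * \<epsilon>) powr (-1/2 - of_nat D) * (\<Sum>\<^sub>\<infinity>m. v m * exp (- (of_real pi * X) * (of_int m)\<^sup>2))"
      have n1: "norm ((4 * of_nat q * \<epsilon>) powr (-1/2 - of_nat D)) = norm (4 * of_nat q * \<epsilon>) powr (- (1/2 + real D))"
        by (rule norm_powr_half) (use q e in simp)
      show ?thesis unfolding th norm_mult[of _ "\<Sum>\<^sub>\<infinity>m. v m * exp (- (of_real pi * X) * (of_int m)\<^sup>2)"] norm_mult[of _ "(4 * of_nat q * \<epsilon>) powr (-1/2 - of_nat D)"] n1
        by (simp only: norm_mult[of "of_nat (2 * q) ^ D"] norm_power norm_of_nat norm_minus_cancel norm_ii power_one mult_1_right)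
    qed
    also have "norm (4 * of_nat q * \<epsilon>) powr (- (1/2 + real D)) = (4 * real q) powr (- (1/2 + real D)) * t powr (1/2 + real D)"
    proof -
      have "norm (4 * of_nat q * \<epsilon>) = (4 * real q) * norm \<epsilon>" by (simp add: norm_mult)
      moreover have "norm \<epsilon> powr (- (1/2 + real D)) = t powr (1/2 + real D)"
        using ne by (simp add: t_def powr_divide powr_minus field_simps)
      ultimately show ?thesis using ne by (simp only: powr_mult)
    qed
    finally have "norm (theta q chi (\<i> + \<epsilon>)) = Q * t powr (1/2 + real D) * norm (\<Sum>\<^sub>\<infinity>m. v m * exp (- (of_real pi * X) * (of_int m)\<^sup>2))"
      by (simp only: Q_def mult.assoc)
    also have "\<dots> \<le> Q * t powr (1/2 + real D) * (C2 * exp (- pi * Re X))"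
      using S Q by (intro mult_left_mono) auto
    also have "exp (- pi * Re X) \<le> exp (- c * t) * exp (- K' * Re (1 / \<epsilon>))"
    proof -
      have "(pi / (4 * real q) - K') * (\<sigma> * t) \<le> (pi / (4 * real q) - K') * Re (1 / \<epsilon>)"
        using ci K' by (intro mult_left_mono) auto
      hence "c * t + K' * Re (1 / \<epsilon>) \<le> pi * Re X" by (simp add: c_def reX algebra_simps)
      thus ?thesis by (simp flip: exp_add)
    qed
    hence "Q * t powr (1/2 + real D) * (C2 * exp (- pi * Re X)) \<le> Q * t powr (1/2 + real D) * (C2 * (exp (- c * t) * exp (- K' * Re (1 / \<epsilon>))))"
      using Q C2(1) by (intro mult_left_mono) auto
    also have "\<dots> = Q * C2 * (t powr (1/2 + real D) * exp (- c * t)) * exp (- K' * Re (1 / \<epsilon>))" by (simp only: mult_ac)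
    also have "\<dots> \<le> Q * C2 * A * exp (- K' * Re (1 / \<epsilon>))"
      using A(2) t Q C2(1) by (intro mult_right_mono mult_left_mono) auto
    finally show ?thesis .
  qed
  thus ?thesis by blast
qed

text \<open>The Gauss sum separates off as a constant and leaves the conjugate character. As the
  exponentials are real for real x, its theta series is the complex conjugate of the original
  one.\<close>

lemma theta_functional_equation:
  assumes prim: "primitive_character q chi"
  shows "\<exists>C. \<forall>x>0. theta q chi (of_real (1 / x)) = C * of_real (x powr (1/2 + real (char_delta chi))) * cnj (theta q chi (of_real x))"
proof -
  have chi: "dirichlet_character q chi" using prim by (simp add: primitive_character_def)
  have q: "real q > 0" using chi by (auto simp: dirichlet_character_def)
  define D where "D = char_delta chi"
  define C where "C = of_nat q ^ D * (-\<i>) ^ D * of_real (real q powr (- (1/2 + real D))) * dft q chi 1"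
  have "theta q chi (of_real (1 / x)) = C * of_real (x powr (1/2 + real D)) * cnj (theta q chi (of_real x))" if x: "x > 0" for x
  proof -
    have "(of_nat q * complex_of_real (1 / x)) powr (-1/2 - of_nat D) = of_real (real q / x) powr of_real (- (1/2 + real D))"
      by simp
    also have "\<dots> = of_real ((real q / x) powr (- (1/2 + real D)))" using q x by (intro powr_of_real) auto
    also have "(real q / x) powr (- (1/2 + real D)) = real q powr (- (1/2 + real D)) * x powr (1/2 + real D)"
      using q x by (simp add: powr_divide powr_minus field_simps)
    finally have p: "(of_nat q * complex_of_real (1 / x)) powr (-1/2 - of_nat D) = of_real (real q powr (- (1/2 + real D))) * of_real (x powr (1/2 + real D))"
      by simp
    have "(\<Sum>\<^sub>\<infinity>m. of_int m ^ D * dft q chi m * exp (- (of_real pi / (of_nat q * of_real (1 / x))) * (of_int m)\<^sup>2)) =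
       (\<Sum>\<^sub>\<infinity>m. dft q chi 1 * cnj (of_int m ^ D * chi m * exp (- (of_real pi * (of_real x / of_nat q)) * (of_int m)\<^sup>2)))"
    proof (rule infsum_cong)
      fix m :: int
      have "complex_of_real pi / (of_nat q * of_real (1 / x)) = of_real pi * (of_real x / of_nat q)" by simp
      thus "of_int m ^ D * dft q chi m * exp (- (of_real pi / (of_nat q * of_real (1 / x))) * (of_int m)\<^sup>2) =
         dft q chi 1 * cnj (of_int m ^ D * chi m * exp (- (of_real pi * (of_real x / of_nat q)) * (of_int m)\<^sup>2))"
        unfolding dft_primitive[OF prim, of m] by (simp add: exp_cnj mult_ac)
    qed
    also have "\<dots> = dft q chi 1 * cnj (theta q chi (of_real x))"
      unfolding infsum_cmult_right' theta_def D_def[symmetric] by (simp only: infsum_cnj)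
    finally have s: "(\<Sum>\<^sub>\<infinity>m. of_int m ^ D * dft q chi m * exp (- (of_real pi / (of_nat q * of_real (1 / x))) * (of_int m)\<^sup>2)) = dft q chi 1 * cnj (theta q chi (of_real x))" .
    have "Re (complex_of_real (1 / x)) > 0" using x by simp
    from theta_transform[OF chi this] show ?thesis
      unfolding D_def[symmetric] p s C_def by (simp only: mult_ac)
  qed
  thus ?thesis unfolding D_def by blast
qed

lemma sector_decay_power:
  assumes T: "sector_decay T" and k: "k \<ge> 1"
  shows "sector_decay (\<lambda>x. T x ^ k)"
  unfolding sector_decay_def
proof (intro conjI allI impI)
  show "(\<lambda>x. T x ^ k) holomorphic_on {x. Re x > 0}"
    using T by (auto simp: sector_decay_def intro!: holomorphic_intros)
  fix \<sigma> p :: real assume "\<sigma> > 0"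
  then obtain C where C: "\<forall>x. x \<noteq> 0 \<and> \<sigma> * norm x \<le> Re x \<longrightarrow> norm (T x) \<le> C * norm x powr (p / real k)"
    using T unfolding sector_decay_def by meson
  have "norm (T x ^ k) \<le> C ^ k * norm x powr p" if x: "x \<noteq> 0 \<and> \<sigma> * norm x \<le> Re x" for x
  proof -
    have "norm (T x) ^ k \<le> (C * norm x powr (p / real k)) ^ k"
      using C x by (intro power_mono) auto
    also have "\<dots> = C ^ k * norm x powr p"
    proof -
      have "(norm x powr (p / real k)) ^ k = norm x powr (real k * (p / real k))"
        using k x by (intro powr_power) auto
      thus ?thesis using k by (simp add: power_mult_distrib)
    qed
    finally show ?thesis by (simp add: norm_power)
  qed
  thus "\<exists>C. \<forall>x. x \<noteq> 0 \<and> \<sigma> * norm x \<le> Re x \<longrightarrow> norm (T x ^ k) \<le> C * norm x powr p" by blast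
qed

text \<open>The k-th power decays k times as fast; only the rate of a single factor is recorded, so
  the region for z is the same for all k.\<close>

lemma cusp_decay_theta_power:
  assumes prim: "primitive_character q chi" and q2: "q \<ge> 2"
    and q4: "even_character chi \<Longrightarrow> \<not> [q = 0] (mod 4)" and k: "k \<ge> 1"
  shows "cusp_decay (pi / (4 * real q)) (\<lambda>x. theta q chi x ^ k)"
  unfolding cusp_decay_def
proof (intro allI impI)
  fix K' \<sigma> :: real assume K': "0 \<le> K' \<and> K' < pi / (4 * real q)" and \<sigma>: "\<sigma> > 0"
  have "\<exists>C. \<forall>\<epsilon>. \<epsilon> \<noteq> 0 \<and> norm \<epsilon> \<le> 1 \<and> \<sigma> * norm \<epsilon> \<le> Re \<epsilon> \<longrightarrow>
     norm (theta q chi (\<i> + \<epsilon>)) \<le> C * exp (- K' * Re (1 / \<epsilon>))"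
    by (rule theta_cusp_decay[OF prim q2]) (fact q4, fact conjunct2[OF K'], fact \<sigma>)
  then obtain C where C: "\<forall>\<epsilon>. \<epsilon> \<noteq> 0 \<and> norm \<epsilon> \<le> 1 \<and> \<sigma> * norm \<epsilon> \<le> Re \<epsilon> \<longrightarrow>
     norm (theta q chi (\<i> + \<epsilon>)) \<le> C * exp (- K' * Re (1 / \<epsilon>))"
    by (elim exE) (rule that, assumption)
  have "norm (theta q chi (\<i> + \<epsilon>) ^ k) \<le> C ^ k * exp (- K' * Re (1 / \<epsilon>))" if e: "\<epsilon> \<noteq> 0 \<and> norm \<epsilon> \<le> 1 \<and> \<sigma> * norm \<epsilon> \<le> Re \<epsilon>" for \<epsilon>
  proof -
    have b: "norm (theta q chi (\<i> + \<epsilon>)) \<le> C * exp (- K' * Re (1 / \<epsilon>))" using C e by blast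
    have C0: "C \<ge> 0" using order_trans[OF norm_ge_zero b] by (simp add: zero_le_mult_iff)
    have "\<sigma> / norm \<epsilon> \<le> Re (1 / \<epsilon>)" using cone_inverse[of \<epsilon> \<sigma>] e by blast
    hence "Re (1 / \<epsilon>) \<ge> 0" using \<sigma> by (meson divide_nonneg_nonneg less_imp_le norm_ge_zero order_trans)
    hence K0: "K' * Re (1 / \<epsilon>) \<ge> 0" using K' by simp
    have "norm (theta q chi (\<i> + \<epsilon>)) ^ k \<le> (C * exp (- K' * Re (1 / \<epsilon>))) ^ k" by (intro power_mono b) auto
    also have "\<dots> = C ^ k * exp (real k * (- K' * Re (1 / \<epsilon>)))" by (simp only: power_mult_distrib exp_of_nat_mult)
    also have "\<dots> \<le> C ^ k * exp (- K' * Re (1 / \<epsilon>))"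
    proof (intro mult_left_mono)
      have "1 * (K' * Re (1 / \<epsilon>)) \<le> real k * (K' * Re (1 / \<epsilon>))" using k K0 by (intro mult_right_mono) auto
      thus "exp (real k * (- K' * Re (1 / \<epsilon>))) \<le> exp (- K' * Re (1 / \<epsilon>))" by simp
    qed (use C0 in simp)
    finally show ?thesis by (simp add: norm_power)
  qed
  thus "\<exists>C. \<forall>\<epsilon>. \<epsilon> \<noteq> 0 \<and> norm \<epsilon> \<le> 1 \<and> \<sigma> * norm \<epsilon> \<le> Re \<epsilon> \<longrightarrow> norm (theta q chi (\<i> + \<epsilon>) ^ k) \<le> C * exp (- K' * Re (1 / \<epsilon>))" by blast
qed

text \<open>The substitution y -> - y exchanges x and 1 / x, and b - s is the conjugate of s on this
  line. The conclusion confines all values of the Mellin transform on the line to one real line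
  through 0, if they are not all 0.\<close>

lemma mellin_critical_line:
  assumes dec: "sector_decay T"
    and T: "\<And>x. x > 0 \<Longrightarrow> T (of_real (1 / x)) = C * of_real (x powr b) * cnj (T (of_real x))"
  shows "mellin T (of_real (b / 2) + \<i> * of_real t) = C * cnj (mellin T (of_real (b / 2) + \<i> * of_real t))"
proof -
  define s where "s = complex_of_real (b / 2) + \<i> * of_real t"
  have r: "ray 0 y = of_real (exp y)" for y by (simp add: ray_def exp_of_real)
  have "mellin T s = \<bar>- 1\<bar> *\<^sub>R (LBINT y. exp (s * of_real (0 + (- 1) * y)) * T (ray 0 (0 + (- 1) * y)))"
    unfolding mellin_def by (rule lborel_integral_real_affine) simp
  also have "\<dots> = (LBINT y. C * cnj (exp (s * of_real y) * T (ray 0 y)))"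
  proof -
    have "exp (s * of_real (0 + (- 1) * y)) * T (ray 0 (0 + (- 1) * y)) = C * cnj (exp (s * of_real y) * T (ray 0 y))" for y
    proof -
      have "T (ray 0 (0 + (- 1) * y)) = T (of_real (1 / exp y))" by (simp add: r exp_minus inverse_eq_divide)
      also have "\<dots> = C * of_real (exp y powr b) * cnj (T (ray 0 y))" unfolding r by (rule T) simp
      also have "of_real (exp y powr b) = exp (complex_of_real (b * y))" by (simp only: powr_def exp_of_real) simp
      finally have "exp (s * of_real (0 + (- 1) * y)) * T (ray 0 (0 + (- 1) * y)) = C * (exp (s * of_real (- y)) * exp (of_real (b * y))) * cnj (T (ray 0 y))"
        by simp
      also have "exp (s * of_real (- y)) * exp (of_real (b * y)) = cnj (exp (s * of_real y))"
        unfolding exp_add[symmetric] exp_cnj by (rule arg_cong[of _ _ exp]) (simp add: s_def complex_eq_iff algebra_simps)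
      finally show ?thesis by simp
    qed
    thus ?thesis by simp
  qed
  also have "\<dots> = C * cnj (mellin T s)"
  proof -
    have "integrable lborel (\<lambda>y. exp (s * of_real y) * T (ray 0 y))"
      using integrable_euler_ray[OF dec, of 0 s 0] by (simp add: euler_def)
    from integral_bounded_linear[OF bounded_linear_cnj this]
    show ?thesis unfolding mellin_def by (simp only: integral_mult_right_zero)
  qed
  finally show ?thesis by (simp only: s_def)
qed

subsection \<open>Kummer functions and the Gamma integral\<close>

text \<open>The Cauchy product of the two series; the inner sum is the Chu-Vandermonde identity for
  Pochhammer symbols.\<close>

lemma kummer_transformation:
  assumes \<beta>: "\<beta> > (0::real)"
  shows "kummer_1F1 (of_real \<beta> - a) (of_real \<beta>) u = exp u * kummer_1F1 a (of_real \<beta>) (- u)"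
proof -
  define b where "b = complex_of_real \<beta>"
  have bnz: "pochhammer b n \<noteq> 0" for n unfolding b_def by (rule pochhammer_of_real_nonzero[OF \<beta>])
  define x where "x = (\<lambda>i. pochhammer a i / pochhammer b i * (- u) ^ i / fact i)"
  define y where "y = (\<lambda>i. u ^ i /\<^sub>R fact i)"
  have sx: "summable (\<lambda>i. norm (x i))" unfolding x_def b_def by (rule summable_kummer[OF \<beta>])
  have sy: "summable (\<lambda>i. norm (y i))" unfolding y_def by (rule summable_norm_exp)
  have cp: "(\<Sum>k. x k) * (\<Sum>k. y k) = (\<Sum>n. \<Sum>i\<le>n. x i * y (n - i))" by (rule Cauchy_product[OF sx sy])
  have "(\<Sum>i\<le>n. x i * y (n - i)) = pochhammer (b - a) n / pochhammer b n * u ^ n / fact n" for n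
  proof -
    \<comment> \<open>Reversing the order of the factors. It moves the index i out of the
      denominator \<open>pochhammer b i\<close>, as the Vandermonde sum requires.\<close>
    have poch_neg: "pochhammer (1 - c - of_nat m) m = (-1) ^ m * pochhammer c m" for c :: complex and m
      using pochhammer_minus[of "c + of_nat m - 1" m] by (simp add: algebra_simps)
    have t: "x i * y (n - i) = u ^ n / (pochhammer b n * fact n) * ((-1) ^ n * (of_nat (n choose i) * pochhammer a i * pochhammer (1 - b - of_nat n) (n - i)))" if i: "i \<le> n" for i
    proof -
      have "pochhammer b n = pochhammer b i * pochhammer (b + of_nat i) (n - i)" by (rule pochhammer_product[OF i])
      moreover have "pochhammer (1 - b - of_nat n) (n - i) = (-1) ^ (n - i) * pochhammer (b + of_nat i) (n - i)"
        using poch_neg[of "b + of_nat i" "n - i"] i by (simp add: algebra_simps of_nat_diff)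
      ultimately have p1: "pochhammer (1 - b - of_nat n) (n - i) = (-1) ^ (n - i) * (pochhammer b n / pochhammer b i)"
        using bnz by simp
      have sg: "(-1 :: complex) ^ n * (-1) ^ (n - i) = (-1) ^ i"
      proof -
        have "(-1 :: complex) ^ n = (-1) ^ i * (-1) ^ (n - i)" using i by (simp flip: power_add)
        thus ?thesis by (simp add: mult.assoc flip: power_mult_distrib)
      qed
      have ch: "of_nat (n choose i) = (fact n / (fact i * fact (n - i)) :: complex)"
        using i by (rule binomial_fact)
      have un: "u ^ n = u ^ i * u ^ (n - i)" using i by (simp flip: power_add)
      have alg: "(v * w) / (pb * f) * (e1 * (f / (fi * fk) * pa * (e2 * (pb / pi)))) = (e1 * e2) * (pa / pi) * (v / fi) * (w / fk)"
        if "pb \<noteq> 0" "f \<noteq> 0" for e1 e2 pb pi pa f fi fk v w :: complex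
        using that by (simp add: field_simps)
      have "u ^ n / (pochhammer b n * fact n) * ((-1) ^ n * (of_nat (n choose i) * pochhammer a i * pochhammer (1 - b - of_nat n) (n - i)))
         = (-1) ^ i * (pochhammer a i / pochhammer b i) * (u ^ i / fact i) * (u ^ (n - i) / fact (n - i))"
        unfolding p1 ch un alg[OF bnz fact_nonzero] sg ..
      also have "\<dots> = x i * y (n - i)"
        by (simp add: x_def y_def power_minus[of u i] scaleR_conv_of_real divide_inverse mult_ac)
      finally show ?thesis ..
    qed
    have "(\<Sum>i\<le>n. x i * y (n - i)) = u ^ n / (pochhammer b n * fact n) * ((-1) ^ n * (\<Sum>i\<le>n. of_nat (n choose i) * pochhammer a i * pochhammer (1 - b - of_nat n) (n - i)))"
      unfolding sum_distrib_left by (intro sum.cong refl t) simp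
    also have "(\<Sum>i\<le>n. of_nat (n choose i) * pochhammer a i * pochhammer (1 - b - of_nat n) (n - i)) = pochhammer (a + (1 - b - of_nat n)) n"
      by (rule pochhammer_binomial_sum[symmetric])
    also have "a + (1 - b - of_nat n) = 1 - (b - a) - of_nat n" by simp
    also have "(-1) ^ n * pochhammer (1 - (b - a) - of_nat n) n = pochhammer (b - a) n"
      unfolding poch_neg by (simp add: mult.assoc[symmetric] flip: power_mult_distrib)
    finally show ?thesis by simp
  qed
  hence "(\<Sum>k. x k) * (\<Sum>k. y k) = kummer_1F1 (b - a) b u" unfolding cp by (simp add: kummer_1F1_def)
  moreover have "(\<Sum>k. y k) = exp u" by (simp add: y_def exp_def)
  moreover have "(\<Sum>k. x k) = kummer_1F1 a b (- u)" by (simp add: x_def kummer_1F1_def)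
  ultimately show ?thesis by (simp add: b_def mult.commute)
qed

section \<open>Termwise integration and the Gamma integral\<close>

lemma integral_infsum:
  fixes f :: "'a \<Rightarrow> real \<Rightarrow> complex"
  assumes A: "countable A" and f: "\<And>n. n \<in> A \<Longrightarrow> integrable lborel (f n)" and W: "integrable lborel W"
    and bd: "\<And>F y. finite F \<Longrightarrow> F \<subseteq> A \<Longrightarrow> (\<Sum>n\<in>F. norm (f n y)) \<le> W y"
  shows "(LBINT y. \<Sum>\<^sub>\<infinity>n\<in>A. f n y) = (\<Sum>\<^sub>\<infinity>n\<in>A. LBINT y. f n y)"
proof (cases "finite A")
  case True
  thus ?thesis using f by (simp add: Bochner_Integration.integral_sum)
next
  case False
  define e where "e = from_nat_into A"
  have e: "bij_betw e UNIV A" unfolding e_def by (rule bij_betw_from_nat_into[OF A False])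
  have eA: "e n \<in> A" for n using e by (auto simp: bij_betw_def)
  have inj: "inj e" using e by (simp add: bij_betw_def)
  have sums: "(\<Sum>n<N. norm (f (e n) y)) \<le> W y" for N y
  proof -
    have "(\<Sum>n<N. norm (f (e n) y)) = (\<Sum>n\<in>e ` {..<N}. norm (f n y))"
      by (subst sum.reindex) (auto intro: inj_on_subset[OF inj])
    also have "\<dots> \<le> W y" by (rule bd) (use eA in auto)
    finally show ?thesis .
  qed
  have int: "integrable lborel (f (e n))" for n by (rule f[OF eA])
  have pt: "summable (\<lambda>n. norm (f (e n) y))" for y
    by (rule summableI_nonneg_bounded[where x = "W y"]) (use sums in auto)
  have it: "summable (\<lambda>n. LBINT y. norm (f (e n) y))"
  proof (rule summableI_nonneg_bounded[where x = "LBINT y. W y"])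
    fix N
    have "(\<Sum>n<N. LBINT y. norm (f (e n) y)) = (LBINT y. \<Sum>n<N. norm (f (e n) y))"
      by (rule Bochner_Integration.integral_sum[symmetric]) (intro integrable_norm int)
    also have "\<dots> \<le> (LBINT y. W y)"
      by (intro integral_mono W sums Bochner_Integration.integrable_sum integrable_norm int)
    finally show "(\<Sum>n<N. LBINT y. norm (f (e n) y)) \<le> (LBINT y. W y)" .
  qed (simp add: integral_nonneg_AE)
  have inf: "(\<Sum>\<^sub>\<infinity>n\<in>A. g n) = (\<Sum>n. g (e n))" if "summable (\<lambda>n. norm (g (e n)))" for g :: "'a \<Rightarrow> complex"
  proof -
    have "(\<Sum>\<^sub>\<infinity>n\<in>A. g n) = (\<Sum>\<^sub>\<infinity>n. g (e n))"
      using infsum_reindex_bij_betw[OF e, of g] by simp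
    also have "\<dots> = (\<Sum>n. g (e n))"
      by (rule infsumI) (rule norm_summable_imp_has_sum[OF that summable_sums[OF summable_norm_cancel[OF that]]])
    finally show ?thesis .
  qed
  have it': "summable (\<lambda>n. norm (LBINT y. f (e n) y))"
    by (rule summable_comparison_test'[OF it]) (auto intro: integral_norm_bound)
  have "(LBINT y. \<Sum>\<^sub>\<infinity>n\<in>A. f n y) = (LBINT y. \<Sum>n. f (e n) y)"
    using inf[OF pt] by simp
  also have "\<dots> = (\<Sum>n. LBINT y. f (e n) y)"
    by (rule integral_suminf[OF int _ it]) (use pt in auto)
  also have "\<dots> = (\<Sum>\<^sub>\<infinity>n\<in>A. LBINT y. f n y)" by (rule inf[OF it', symmetric])
  finally show ?thesis .
qed

lemma integrable_exp_abs_scaled: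
  assumes "\<mu> > 0"
  shows "integrable lborel (\<lambda>y::real. exp (- \<mu> * \<bar>y\<bar>))"
proof -
  have "integrable lborel (\<lambda>y. exp (- \<bar>0 + \<mu> * y\<bar>))"
    by (rule lborel_integrable_real_affine[OF integrable_exp_abs]) (use assms in simp)
  thus ?thesis using assms by (simp add: abs_mult)
qed

lemma exp_double_exp_bound:
  assumes "\<mu> > 0" "c > (0::real)"
  shows "\<exists>D\<ge>0. \<forall>y. exp (\<mu> * y) * exp (- c * exp y) \<le> D * exp (- \<mu> * \<bar>y\<bar>)"
proof -
  \<comment> \<open>The exponent is 2 \<mu> because one \<mu> cancels the growth exp (\<mu> y) and
    the other provides the decay exp (- \<mu> y).\<close>
  obtain D where D: "D \<ge> 0" "\<forall>t\<ge>1. t powr (2 * \<mu>) * exp (- c * t) \<le> D"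
    using powr_exp_bounded[OF assms(2), of "2 * \<mu>"] by (elim exE conjE) (rule that, assumption+)
  have "exp (\<mu> * y) * exp (- c * exp y) \<le> (D + 1) * exp (- \<mu> * \<bar>y\<bar>)" for y
  proof (cases "y \<ge> 0")
    case True
    have "exp (\<mu> * y) = exp (2 * \<mu> * y) * exp (- \<mu> * y)" by (simp flip: exp_add)
    hence "exp (\<mu> * y) * exp (- c * exp y) = (exp y powr (2 * \<mu>) * exp (- c * exp y)) * exp (- \<mu> * y)"
      by (simp add: powr_def mult_ac)
    also have "\<dots> \<le> D * exp (- \<mu> * y)" using D(2) True by (intro mult_right_mono) auto
    also have "\<dots> \<le> (D + 1) * exp (- \<mu> * y)" by (intro mult_right_mono) auto
    finally show ?thesis using True by simp
  next
    case False
    have "exp (\<mu> * y) * exp (- c * exp y) \<le> exp (\<mu> * y) * 1" using assms by (intro mult_left_mono) auto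
    also have "\<dots> \<le> (D + 1) * exp (\<mu> * y)" using D(1) by simp
    finally show ?thesis using False by simp
  qed
  thus ?thesis using D(1) by (intro exI[of _ "D + 1"]) auto
qed

text \<open>Euler's integral under the substitution t = A exp y, which matches the logarithmic form
  of \<open>mellin\<close>.\<close>

lemma gamma_integral_exp:
  assumes s: "Re s > 0" and A: "A > 0"
  shows "integrable lborel (\<lambda>y. exp (s * of_real y) * of_real (exp (- A * exp y)))"
    and "(LBINT y. exp (s * of_real y) * of_real (exp (- A * exp y))) = Gamma s * of_real A powr (- s)"
proof -
  obtain D where D: "D \<ge> 0" "\<forall>y. exp (Re s * y) * exp (- A * exp y) \<le> D * exp (- Re s * \<bar>y\<bar>)"
    using exp_double_exp_bound[OF s A] by (elim exE conjE) (rule that, assumption+)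
  define h where "h = (\<lambda>y. exp (s * of_real y) * of_real (exp (- A * exp y)))"
  have h_int: "integrable lborel h"
  proof (rule Bochner_Integration.integrable_bound)
    show "integrable lborel (\<lambda>y. D * exp (- Re s * \<bar>y\<bar>))"
      by (intro integrable_mult_right integrable_exp_abs_scaled s)
    have "continuous_on UNIV h" unfolding h_def by (intro continuous_intros)
    thus "h \<in> borel_measurable lborel" by (simp add: borel_measurable_continuous_onI)
    show "AE y in lborel. norm (h y) \<le> norm (D * exp (- Re s * \<bar>y\<bar>))"
    proof (intro AE_I2)
      fix y :: real
      have "norm (h y) = exp (Re s * y) * exp (- A * exp y)" by (simp add: h_def norm_mult)
      also have "\<dots> \<le> D * exp (- Re s * \<bar>y\<bar>)" using D(2) by blast
      also have "\<dots> \<le> norm (D * exp (- Re s * \<bar>y\<bar>))" by simp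
      finally show "norm (h y) \<le> norm (D * exp (- Re s * \<bar>y\<bar>))" .
    qed
  qed
  thus "integrable lborel (\<lambda>y. exp (s * of_real y) * of_real (exp (- A * exp y)))" by (simp add: h_def)
  define f where "f = (\<lambda>t. complex_of_real t powr (s - 1) / of_real (exp t))"
  define g where "g = (\<lambda>y. A * exp y)"
  have g0: "g y > 0" for y using A by (simp add: g_def)
  have gf: "g y *\<^sub>R f (g y) = of_real A powr s * h y" for y
  proof -
    have gnz: "complex_of_real (g y) \<noteq> 0" using g0[of y] by simp
    have "of_real (g y) * complex_of_real (g y) powr (s - 1) = complex_of_real (g y) powr s"
      using gnz by (simp add: powr_diff)
    also have "\<dots> = of_real A powr s * of_real (exp y) powr s"
      unfolding g_def of_real_mult using A by (intro powr_times_real) auto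
    also have "complex_of_real (exp y) powr s = exp (s * of_real y)"
      by (simp add: powr_def exp_of_real[symmetric] flip: Ln_of_real)
    finally have p: "of_real (g y) * complex_of_real (g y) powr (s - 1) = of_real A powr s * exp (s * of_real y)" .
    have "g y *\<^sub>R f (g y) = (of_real (g y) * complex_of_real (g y) powr (s - 1)) / of_real (exp (g y))"
      by (simp add: f_def scaleR_conv_of_real)
    also have "\<dots> = of_real A powr s * h y"
      unfolding p by (simp add: h_def g_def exp_minus divide_inverse)
    finally show ?thesis .
  qed
  have f_int: "set_integrable lborel {0<..} f"
  proof -
    have "set_integrable lebesgue {0<..} f"
      unfolding f_def by (rule absolutely_integrable_Gamma_integral'[OF s])
    moreover have "(\<lambda>x. indicator {0<..} x *\<^sub>R f x) \<in> borel_measurable lborel"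
      unfolding f_def by measurable
    ultimately show ?thesis unfolding set_integrable_def by (simp add: integrable_completion)
  qed
  have "(LBINT y=0..\<infinity>. f y) = (LBINT y=-\<infinity>..\<infinity>. g y *\<^sub>R f (g y))"
  proof (rule interval_integral_substitution_integrable)
    show "DERIV g x :> g x" for x unfolding g_def by (auto intro!: derivative_eq_intros)
    show "isCont f (g x)" for x unfolding f_def using g0[of x] by (intro continuous_intros) auto
    show "isCont g x" for x unfolding g_def by (intro continuous_intros)
    show "0 \<le> g x" for x using g0[of x] by simp
    have "(g \<longlongrightarrow> 0) at_bot" unfolding g_def using A by real_asymp
    hence "((\<lambda>x. ereal (g x)) \<longlongrightarrow> ereal 0) at_bot" by (rule tendsto_ereal)
    thus "((ereal \<circ> g \<circ> real_of_ereal) \<longlongrightarrow> 0) (at_right (- \<infinity>))"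
      unfolding ereal_tendsto_simps1 by (simp add: o_def zero_ereal_def)
    have "filterlim g at_top at_top" unfolding g_def using A by real_asymp
    thus "((ereal \<circ> g \<circ> real_of_ereal) \<longlongrightarrow> \<infinity>) (at_left \<infinity>)"
      unfolding ereal_tendsto_simps1 by (simp add: ereal_tendsto_simps2)
    show "set_integrable lborel (einterval (- \<infinity>) \<infinity>) (\<lambda>x. g x *\<^sub>R f (g x))"
      unfolding gf using h_int by (simp add: set_integrable_def)
    show "set_integrable lborel (einterval 0 \<infinity>) f"
      using f_int by (simp add: einterval_def zero_ereal_def greaterThan_def)
  qed simp
  also have "(LBINT y=-\<infinity>..\<infinity>. g y *\<^sub>R f (g y)) = of_real A powr s * (LBINT y. h y)"
    unfolding gf by (simp add: interval_lebesgue_integral_def set_lebesgue_integral_def)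
  also have "(LBINT y=0..\<infinity>. f y) = (LINT y:{0<..}|lborel. f y)"
    by (simp add: interval_lebesgue_integral_def einterval_def zero_ereal_def greaterThan_def)
  also have "\<dots> = integral {0<..} f" by (rule set_borel_integral_eq_integral(2)[OF f_int])
  also have "\<dots> = Gamma s" unfolding f_def by (rule integral_unique[OF Gamma_integral_complex'[OF s]])
  finally have G: "Gamma s = of_real A powr s * (LBINT y. h y)" .
  have "complex_of_real A powr (- s) * of_real A powr s = 1" using A by (simp add: powr_minus)
  hence "(LBINT y. h y) = Gamma s * of_real A powr (- s)" unfolding G by (simp add: mult_ac)
  thus "(LBINT y. exp (s * of_real y) * of_real (exp (- A * exp y))) = Gamma s * of_real A powr (- s)"
    by (simp add: h_def)
qed

section \<open>Gaussian sums without the term at 0\<close>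

lemma sum_exp_abs_int_le:
  assumes r: "r > (0::real)" and J: "finite J" "0 \<notin> J"
  shows "(\<Sum>n\<in>J. exp (- r * \<bar>of_int n :: real\<bar>)) \<le> 2 / r"
proof -
  obtain N :: nat where N: "\<And>n. n \<in> J \<Longrightarrow> \<bar>n\<bar> \<le> int N"
  proof -
    have "\<bar>n\<bar> \<le> int (nat (\<Sum>m\<in>J. \<bar>m\<bar>))" if "n \<in> J" for n
      using member_le_sum[of n J abs] that J(1) by simp
    thus ?thesis using that by blast
  qed
  define q where "q = exp (- r)"
  have q: "0 < q" "q < 1" using r by (auto simp: q_def)
  have geo: "(\<Sum>n\<in>{1..N}. q ^ n) \<le> 1 / r"
  proof -
    have "(\<Sum>n\<in>{1..N}. q ^ n) = q * (\<Sum>n<N. q ^ n)"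
      unfolding sum_distrib_left by (rule sum.reindex_bij_witness[of _ Suc "\<lambda>n. n - 1"]) (auto simp: power_eq_if)
    also have "\<dots> \<le> q * (1 / (1 - q))"
    proof (rule mult_left_mono)
      have "(\<Sum>n<N. q ^ n) = (1 - q ^ N) / (1 - q)" using q by (simp add: sum_gp_strict)
      also have "\<dots> \<le> 1 / (1 - q)" using q by (intro divide_right_mono) auto
      finally show "(\<Sum>n<N. q ^ n) \<le> 1 / (1 - q)" .
    qed (use q in simp)
    also have "\<dots> \<le> 1 / r"
    proof -
      have "exp r - 1 \<ge> r" using exp_ge_add_one_self[of r] by linarith
      moreover have "1 - q = q * (exp r - 1)" by (simp add: q_def right_diff_distrib flip: exp_add)
      ultimately have "1 - q \<ge> q * r" using q by simp
      thus ?thesis using q r by (simp add: field_simps)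
    qed
    finally show ?thesis .
  qed
  have "(\<Sum>n\<in>J. exp (- r * \<bar>of_int n :: real\<bar>)) \<le> (\<Sum>n\<in>int ` {1..N} \<union> (\<lambda>n. - int n) ` {1..N}. exp (- r * \<bar>of_int n :: real\<bar>))"
  proof (rule sum_mono2)
    show "J \<subseteq> int ` {1..N} \<union> (\<lambda>n. - int n) ` {1..N}"
    proof
      fix n assume n: "n \<in> J"
      hence n0: "n \<noteq> 0" using J by auto
      show "n \<in> int ` {1..N} \<union> (\<lambda>n. - int n) ` {1..N}"
      proof (cases "n > 0")
        case True
        hence "n = int (nat n)" "nat n \<in> {1..N}" using N[OF n] by auto
        thus ?thesis by blast
      next
        case False
        hence "n = - int (nat (- n))" "nat (- n) \<in> {1..N}" using N[OF n] n0 by auto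
        thus ?thesis by blast
      qed
    qed
  qed auto
  also have "\<dots> = (\<Sum>n\<in>int ` {1..N}. exp (- r * \<bar>of_int n :: real\<bar>)) + (\<Sum>n\<in>(\<lambda>n. - int n) ` {1..N}. exp (- r * \<bar>of_int n :: real\<bar>))"
    by (rule sum.union_disjoint) auto
  also have "(\<Sum>n\<in>int ` {1..N}. exp (- r * \<bar>of_int n :: real\<bar>)) = (\<Sum>n\<in>{1..N}. q ^ n)"
    by (subst sum.reindex) (auto simp: q_def inj_on_def exp_of_nat_mult[symmetric] mult.commute)
  also have "(\<Sum>n\<in>(\<lambda>n. - int n) ` {1..N}. exp (- r * \<bar>of_int n :: real\<bar>)) = (\<Sum>n\<in>{1..N}. q ^ n)"
    by (subst sum.reindex) (auto simp: q_def inj_on_def exp_of_nat_mult[symmetric] mult.commute)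
  also have "(\<Sum>n\<in>{1..N}. q ^ n) + (\<Sum>n\<in>{1..N}. q ^ n) \<le> 1 / r + 1 / r" by (intro add_mono geo)
  finally show ?thesis by simp
qed

text \<open>With y = |n| sqrt c each term is at most exp (1 - y) up to a power of c, which leaves a
  geometric series. The power of c has the true order as c tends to 0; it fixes the half-plane in
  which the L-series is treated.\<close>

lemma sum_power_gauss_le:
  assumes c: "c > (0::real)" and d: "d \<le> 1" and J: "finite J" "0 \<notin> J"
  shows "(\<Sum>n\<in>J. \<bar>of_int n\<bar> ^ d * exp (- c * (of_int n)\<^sup>2)) \<le> 2 * exp 1 * c powr (- (1 + real d) / 2)"
proof -
  have "\<bar>of_int n\<bar> ^ d * exp (- c * (of_int n)\<^sup>2) \<le> exp 1 * c powr (- real d / 2) * exp (- sqrt c * \<bar>of_int n\<bar>)" for n :: int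
  proof -
    define y where "y = \<bar>of_int n\<bar> * sqrt c"
    have y0: "y \<ge> 0" using c by (simp add: y_def)
    have y2: "y\<^sup>2 = c * (of_int n)\<^sup>2" using c by (simp add: y_def power_mult_distrib)
    have "y ^ d \<le> exp y"
    proof (cases "d = 0")
      case False
      hence "d = 1" using d by simp
      thus ?thesis using exp_ge_add_one_self[of y] by (simp only: power_one_right)
    qed (use y0 in simp)
    hence "y ^ d * exp (- y\<^sup>2) \<le> exp y * exp (- y\<^sup>2)" by (intro mult_right_mono) auto
    also have "\<dots> \<le> exp (1 - y)"
    proof -
      have "0 \<le> (y - 1)\<^sup>2" by simp
      hence "y - y\<^sup>2 \<le> 1 - y" by (simp add: power2_eq_square algebra_simps)
      thus ?thesis by (simp flip: exp_add)
    qed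
    finally have A: "c powr (- real d / 2) * (y ^ d * exp (- y\<^sup>2)) \<le> c powr (- real d / 2) * exp (1 - y)" by (intro mult_left_mono) auto
    have B: "c powr (- real d / 2) * y ^ d = \<bar>of_int n\<bar> ^ d"
    proof -
      have "sqrt c ^ d = c powr (real d / 2)"
        using c by (simp add: powr_half_sqrt[symmetric] powr_power)
      hence "c powr (- real d / 2) * sqrt c ^ d = 1" using c by (simp flip: powr_add)
      thus ?thesis by (simp add: y_def power_mult_distrib mult_ac)
    qed
    have C: "exp (1 - y) = exp 1 * exp (- sqrt c * \<bar>of_int n\<bar>)" by (simp add: y_def mult.commute flip: exp_add)
    have "\<bar>of_int n\<bar> ^ d * exp (- c * (of_int n)\<^sup>2) = c powr (- real d / 2) * (y ^ d * exp (- y\<^sup>2))"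
      unfolding y2 mult.assoc[symmetric] B by simp
    also note A
    also have "c powr (- real d / 2) * exp (1 - y) = exp 1 * c powr (- real d / 2) * exp (- sqrt c * \<bar>of_int n\<bar>)"
      unfolding C by (simp only: mult_ac)
    finally show ?thesis .
  qed
  hence "(\<Sum>n\<in>J. \<bar>of_int n\<bar> ^ d * exp (- c * (of_int n)\<^sup>2)) \<le> (\<Sum>n\<in>J. exp 1 * c powr (- real d / 2) * exp (- sqrt c * \<bar>of_int n\<bar>))"
    by (intro sum_mono)
  also have "\<dots> = exp 1 * c powr (- real d / 2) * (\<Sum>n\<in>J. exp (- sqrt c * \<bar>of_int n\<bar>))" by (simp add: sum_distrib_left)
  also have "\<dots> \<le> exp 1 * c powr (- real d / 2) * (2 / sqrt c)"
    using c J by (intro mult_left_mono sum_exp_abs_int_le) auto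
  also have "2 / sqrt c = 2 * c powr (- (1/2))" using c by (simp add: powr_minus_divide powr_half_sqrt)
  also have "exp 1 * c powr (- real d / 2) * (2 * c powr (- (1/2))) = 2 * exp 1 * (c powr (- real d / 2) * c powr (- (1/2)))" by (simp only: mult_ac)
  also have "c powr (- real d / 2) * c powr (- (1/2)) = c powr (- (1 + real d) / 2)"
    unfolding powr_add[symmetric] by (rule arg_cong[of _ _ "\<lambda>x. c powr x"]) (simp add: field_simps)
  finally show ?thesis .
qed

subsection \<open>Continuation of the L-series\<close>

text \<open>Termwise Mellin transform of the k-fold product series. The majorant is obtained
  coordinatewise: a finite set of tuples lies in a power of a finite set of integers, over which the
  sum of products is a product of sums.\<close>

lemma mellin_theta_power:
  assumes chi: "dirichlet_character q chi" and q2: "q \<ge> 2" and k: "k \<ge> 1"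
    and s: "Re s > real k / 2 * (1 + real (char_delta chi))"
  shows "mellin (\<lambda>x. theta q chi x ^ k) s = Gamma s * of_real (pi / real q) powr (- s) * Lk_series k chi s"
proof -
  have q: "real q > 0" "q > 0" using q2 by auto
  have per: "\<And>n. chi (n + int q) = chi n" using chi by (auto simp: dirichlet_character_def)
  have chi0: "chi 0 = 0" using chi q2 by (simp add: dirichlet_character_def)
  define D where "D = char_delta chi"
  have D: "D \<le> 1" unfolding D_def by (rule char_delta_le)
  define w where "w = (\<lambda>n::int. of_int n ^ D * chi n)"
  have w0: "w 0 = 0" by (simp add: w_def chi0)
  define g where "g = (\<lambda>y (n::int). w n * exp (- (of_real pi * (ray 0 y / of_nat q)) * (of_int n)\<^sup>2))"
  have r: "ray 0 y = of_real (exp y)" for y by (simp add: ray_def exp_of_real)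
  have g_real: "g y n = w n * of_real (exp (- (pi / real q * (of_int n)\<^sup>2) * exp y))" for y n
    unfolding g_def r by (simp add: exp_of_real[symmetric] mult_ac)
  define PE where "PE = ({..<k} \<rightarrow>\<^sub>E (UNIV :: int set))"
  define P where "P = (\<lambda>n. \<Prod>i<k. w (n i))"
  define N where "N = (\<lambda>n::nat \<Rightarrow> int. \<Sum>i<k. (n i)\<^sup>2)"
  define f where "f = (\<lambda>n y. exp (s * of_real y) * (\<Prod>i<k. g y (n i)))"
  \<comment> \<open>Each coordinate grows at most like exp (- a y) as y tends to minus infinity, so
    k coordinates require Re s > k a, which is the assumed half-plane.\<close>
  define a where "a = (1 + real D) / 2"
  define \<mu> where "\<mu> = Re s - real k * a"
  have \<mu>: "\<mu> > 0" using s by (simp add: \<mu>_def a_def D_def)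
  have "0 \<le> real k * a" by (simp add: a_def)
  hence s0: "Re s > 0" using \<mu> by (simp add: \<mu>_def)
  have g_sum: "(\<lambda>n. norm (g y n)) summable_on UNIV" for y
  proof -
    have "Re (ray 0 y / of_nat q) > 0" using q by (simp add: r)
    from abs_summable_periodic_gauss[of q chi "ray 0 y / of_nat q" D, OF q(2) per this]
    show ?thesis by (simp add: g_def w_def)
  qed
  have T: "theta q chi (ray 0 y) ^ k = (\<Sum>\<^sub>\<infinity>n\<in>PE. \<Prod>i<k. g y (n i))" for y
  proof -
    have "(\<Sum>\<^sub>\<infinity>n\<in>PE. \<Prod>i<k. g y (n i)) = (\<Prod>i<k. infsum (g y) UNIV)"
      unfolding PE_def by (rule infsum_prod_PiE_abs[of "{..<k}" "\<lambda>_. g y" "\<lambda>_. UNIV"]) (use g_sum in auto)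
    thus ?thesis by (simp add: theta_def g_def w_def D_def)
  qed
  \<comment> \<open>Half of pi / q: since n^2 \<ge> 1, one half provides the decay exp (- c exp y)
    for large y, the other half makes the sum over n converge.\<close>
  define c where "c = pi / (2 * real q)"
  have c: "c > 0" using q by (simp add: c_def)
  have J_bound: "(\<Sum>n\<in>J. norm (g y n)) \<le> exp (- c * exp y) * (2 * exp 1 * (c * exp y) powr (- a))" if J: "finite J" for J y
  proof -
    have "(\<Sum>n\<in>J. norm (g y n)) = (\<Sum>n\<in>J - {0}. norm (g y n))"
      using J by (intro sum.mono_neutral_right) (auto simp: g_def w0)
    also have "\<dots> \<le> (\<Sum>n\<in>J - {0}. exp (- c * exp y) * (\<bar>of_int n\<bar> ^ D * exp (- (c * exp y) * (of_int n)\<^sup>2)))"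
    proof (rule sum_mono)
      fix n assume "n \<in> J - {0}"
      hence "(1::int) \<le> n\<^sup>2" by (metis DiffD2 int_one_le_iff_zero_less singletonI zero_less_power2)
      hence n2: "1 \<le> (real_of_int n)\<^sup>2" by (metis of_int_1_le_iff of_int_power)
      have "norm (g y n) = \<bar>of_int n\<bar> ^ D * norm (chi n) * exp (- (pi / real q * (of_int n)\<^sup>2) * exp y)"
        unfolding g_real w_def norm_mult norm_power by simp
      also have "\<dots> \<le> \<bar>of_int n\<bar> ^ D * 1 * exp (- (pi / real q * (of_int n)\<^sup>2) * exp y)"
        by (intro mult_right_mono mult_left_mono norm_dirichlet_character_le[OF chi]) auto
      also have "pi / real q = c + c" using q by (simp add: c_def field_simps)
      also have "\<bar>of_int n\<bar> ^ D * 1 * exp (- ((c + c) * (of_int n)\<^sup>2) * exp y) \<le> \<bar>of_int n\<bar> ^ D * (exp (- c * exp y) * exp (- (c * exp y) * (of_int n)\<^sup>2))"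
      proof -
        have "c * exp y * 1 \<le> c * exp y * (of_int n)\<^sup>2" using c n2 by (intro mult_left_mono) auto
        hence "exp (- ((c + c) * (of_int n)\<^sup>2) * exp y) \<le> exp (- c * exp y) * exp (- (c * exp y) * (of_int n)\<^sup>2)"
          unfolding exp_add[symmetric] by (simp add: algebra_simps)
        thus ?thesis by (simp add: mult_left_mono)
      qed
      finally show "norm (g y n) \<le> exp (- c * exp y) * (\<bar>of_int n\<bar> ^ D * exp (- (c * exp y) * (of_int n)\<^sup>2))"
        by (simp only: mult_ac)
    qed
    also have "\<dots> = exp (- c * exp y) * (\<Sum>n\<in>J - {0}. \<bar>of_int n\<bar> ^ D * exp (- (c * exp y) * (of_int n)\<^sup>2))"
      by (rule sum_distrib_left[symmetric])
    also have "\<dots> \<le> exp (- c * exp y) * (2 * exp 1 * (c * exp y) powr (- (1 + real D) / 2))"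
      using c D J by (intro mult_left_mono sum_power_gauss_le) auto
    also have "- (1 + real D) / 2 = - a" by (simp add: a_def field_simps)
    finally show ?thesis .
  qed
  have kc: "real k * c > 0" using k c by simp
  obtain B where B: "B \<ge> 0" "\<forall>y. exp (\<mu> * y) * exp (- (real k * c) * exp y) \<le> B * exp (- \<mu> * \<bar>y\<bar>)"
    using exp_double_exp_bound[OF \<mu> kc] by (elim exE conjE) (rule that, assumption+)
  define K where "K = (2 * exp 1 * c powr (- a)) ^ k"
  define W where "W = (\<lambda>y. K * B * exp (- \<mu> * \<bar>y\<bar>))"
  have W_int: "integrable lborel W" unfolding W_def by (intro integrable_mult_right integrable_exp_abs_scaled \<mu>)
  have bd: "(\<Sum>n\<in>F. norm (f n y)) \<le> W y" if F: "finite F" "F \<subseteq> PE" for F y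
  proof -
    define J where "J = (\<Union>n\<in>F. n ` {..<k})"
    have J: "finite J" using F by (auto simp: J_def)
    have FJ: "F \<subseteq> ({..<k} \<rightarrow>\<^sub>E J)" using F(2) by (auto simp: PE_def J_def PiE_def Pi_def extensional_def)
    have "(\<Sum>n\<in>F. norm (f n y)) = exp (Re s * y) * (\<Sum>n\<in>F. \<Prod>i<k. norm (g y (n i)))"
      unfolding sum_distrib_left by (intro sum.cong refl) (simp add: f_def norm_mult prod_norm)
    also have "(\<Sum>n\<in>F. \<Prod>i<k. norm (g y (n i))) \<le> (\<Sum>n\<in>({..<k} \<rightarrow>\<^sub>E J). \<Prod>i<k. norm (g y (n i)))"
      using FJ J by (intro sum_mono2 finite_PiE prod_nonneg) auto
    also have "\<dots> = (\<Prod>i<k. \<Sum>n\<in>J. norm (g y n))"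
      using prod_sum_PiE[of "{..<k}" "\<lambda>_. J" "\<lambda>_ n. norm (g y n)"] J by simp
    also have "\<dots> = (\<Sum>n\<in>J. norm (g y n)) ^ k" by simp
    also have "\<dots> \<le> (exp (- c * exp y) * (2 * exp 1 * (c * exp y) powr (- a))) ^ k"
      by (intro power_mono J_bound J sum_nonneg) auto
    also have "\<dots> = K * (exp (- (real k * a) * y) * exp (- (real k * c) * exp y))"
    proof -
      have "(c * exp y) powr (- a) = c powr (- a) * exp (- a * y)"
      proof -
        have "exp y powr (- a) = exp (- a * y)" by (simp add: powr_def)
        thus ?thesis by (simp only: powr_mult)
      qed
      moreover have "exp (- a * y) ^ k = exp (- (real k * a) * y)" by (simp add: exp_of_nat_mult[symmetric] mult_ac)
      moreover have "exp (- c * exp y) ^ k = exp (- (real k * c) * exp y)" by (simp add: exp_of_nat_mult[symmetric] mult_ac)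
      ultimately show ?thesis by (simp add: K_def power_mult_distrib mult_ac)
    qed
    finally have "(\<Sum>n\<in>F. norm (f n y)) \<le> exp (Re s * y) * (K * (exp (- (real k * a) * y) * exp (- (real k * c) * exp y)))"
      by (simp add: mult_left_mono)
    also have "\<dots> = K * ((exp (Re s * y) * exp (- (real k * a) * y)) * exp (- (real k * c) * exp y))" by (simp only: mult_ac)
    also have "exp (Re s * y) * exp (- (real k * a) * y) = exp (\<mu> * y)"
      unfolding exp_add[symmetric] by (simp add: \<mu>_def algebra_simps)
    also have "K * (exp (\<mu> * y) * exp (- (real k * c) * exp y)) \<le> K * (B * exp (- \<mu> * \<bar>y\<bar>))"
      using B(2) by (intro mult_left_mono) (auto simp: K_def)
    finally show ?thesis by (simp add: W_def mult.assoc)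
  qed
  have f_eq: "f n y = P n * (exp (s * of_real y) * of_real (exp (- (pi / real q * of_int (N n)) * exp y)))" for n y
  proof -
    have "(\<Prod>i<k. g y (n i)) = P n * (\<Prod>i<k. of_real (exp (- (pi / real q * (of_int (n i))\<^sup>2) * exp y)))"
      unfolding g_real P_def by (rule prod.distrib)
    also have "(\<Prod>i<k. complex_of_real (exp (- (pi / real q * (of_int (n i))\<^sup>2) * exp y))) = of_real (exp (\<Sum>i<k. - (pi / real q * (of_int (n i))\<^sup>2) * exp y))"
      by (simp add: exp_sum)
    also have "(\<Sum>i<k. - (pi / real q * (of_int (n i))\<^sup>2) * exp y) = - (pi / real q * of_int (N n)) * exp y"
      by (simp add: N_def sum_distrib_left sum_distrib_right sum_negf)
    finally show ?thesis by (simp add: f_def mult_ac)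
  qed
  \<comment> \<open>Only the zero tuple has N n \<le> 0, and its coefficient vanishes by chi 0 = 0;
    so the formula in \<open>f_int\<close> holds there with both sides 0, although the Gamma
    integral does not apply.\<close>
  have P0: "P n = 0" if "N n \<le> 0" for n
  proof -
    have "(\<Sum>i<k. (n i)\<^sup>2) = 0" using that by (intro antisym sum_nonneg) (auto simp: N_def)
    hence "n 0 = 0" using k by (subst (asm) sum_nonneg_eq_0_iff) auto
    thus ?thesis using k w0 unfolding P_def by (intro prod_zero) (auto intro!: bexI[of _ 0])
  qed
  have f_int: "integrable lborel (f n) \<and> (LBINT y. f n y) = Gamma s * of_real (pi / real q) powr (- s) * (P n / of_int (N n) powr s)" for n
  proof (cases "N n \<le> 0")
    case True
    have "f n = (\<lambda>y. 0)" by (intro ext) (simp add: f_eq P0[OF True])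
    thus ?thesis by (simp add: P0[OF True])
  next
    case False
    hence A: "pi / real q * of_int (N n) > 0" using q by simp
    note G = gamma_integral_exp[OF s0 A]
    have "complex_of_real (pi / real q * of_int (N n)) powr (- s) = of_real (pi / real q) powr (- s) * of_real (of_int (N n)) powr (- s)"
      unfolding of_real_mult using q False by (intro powr_times_real) auto
    also have "complex_of_real (of_int (N n)) powr (- s) = 1 / of_int (N n) powr s" by (simp add: powr_minus_divide)
    finally have p: "complex_of_real (pi / real q * of_int (N n)) powr (- s) = of_real (pi / real q) powr (- s) * (1 / of_int (N n) powr s)" .
    have "integrable lborel (\<lambda>y. P n * (exp (s * of_real y) * of_real (exp (- (pi / real q * of_int (N n)) * exp y))))"
      by (intro integrable_mult_right G(1))
    moreover have "(LBINT y. P n * (exp (s * of_real y) * of_real (exp (- (pi / real q * of_int (N n)) * exp y)))) = Gamma s * of_real (pi / real q) powr (- s) * (P n / of_int (N n) powr s)"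
      unfolding integral_mult_right_zero G(2) p by simp
    ultimately show ?thesis by (simp only: f_eq[abs_def])
  qed
  have "mellin (\<lambda>x. theta q chi x ^ k) s = (LBINT y. \<Sum>\<^sub>\<infinity>n\<in>PE. f n y)"
    unfolding mellin_def T f_def by (simp only: infsum_cmult_right')
  also have "\<dots> = (\<Sum>\<^sub>\<infinity>n\<in>PE. LBINT y. f n y)"
    by (rule integral_infsum[OF _ _ W_int bd]) (use f_int in \<open>auto simp: PE_def intro!: countable_PiE\<close>)
  also have "\<dots> = (\<Sum>\<^sub>\<infinity>n\<in>PE. Gamma s * of_real (pi / real q) powr (- s) * (P n / of_int (N n) powr s))"
    using f_int by simp
  also have "\<dots> = Gamma s * of_real (pi / real q) powr (- s) * (\<Sum>\<^sub>\<infinity>n\<in>PE. P n / of_int (N n) powr s)"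
    by (rule infsum_cmult_right')
  also have "(\<Sum>\<^sub>\<infinity>n\<in>PE. P n / of_int (N n) powr s) = Lk_series k chi s"
    by (simp only: Lk_series_def PE_def P_def N_def w_def D_def)
  finally show ?thesis .
qed

text \<open>1 / Gamma is entire, so dividing the entire Mellin transform by Gamma gives an entire
  function, which agrees with the series in its half-plane. The identity theorem supplies the
  uniqueness needed to evaluate the definite description.\<close>

lemma Lk_eq_mellin:
  assumes prim: "primitive_character q chi" and q2: "q \<ge> 2" and k: "k \<ge> 1"
  shows "Lk k chi = (\<lambda>s. rGamma s * of_real (pi / real q) powr s * mellin (\<lambda>x. theta q chi x ^ k) s)"
proof -
  have chi: "dirichlet_character q chi" using prim by (simp add: primitive_character_def)
  define L where "L = (\<lambda>s. rGamma s * of_real (pi / real q) powr s * mellin (\<lambda>x. theta q chi x ^ k) s)"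
  define H where "H = {s. Re s > real k / 2 * (1 + real (char_delta chi))}"
  have pq: "complex_of_real (pi / real q) \<noteq> 0" using q2 by simp
  have L_holo: "L holomorphic_on UNIV"
    unfolding L_def
    by (intro holomorphic_intros mellin_holomorphic sector_decay_power theta_sector_decay prim q2 k)
  have L_eq: "L s = Lk_series k chi s" if "s \<in> H" for s
  proof -
    have sH: "Re s > real k / 2 * (1 + real (char_delta chi))" using that by (simp add: H_def)
    moreover have "0 \<le> real k / 2 * (1 + real (char_delta chi))" by simp
    ultimately have "Re s > 0" by linarith
    hence "s \<notin> \<int>\<^sub>\<le>\<^sub>0" by (auto elim!: nonpos_Ints_cases)
    hence "rGamma s * Gamma s = 1" by (simp add: rGamma_inverse_Gamma Gamma_eq_zero_iff)
    moreover have "complex_of_real (pi / real q) powr s * of_real (pi / real q) powr (- s) = 1"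
      using pq by (simp add: powr_minus)
    moreover have "L s = (rGamma s * Gamma s) * (of_real (pi / real q) powr s * of_real (pi / real q) powr (- s)) * Lk_series k chi s"
      unfolding L_def mellin_theta_power[OF chi q2 k sH] by (simp only: mult_ac)
    ultimately show ?thesis by simp
  qed
  have H: "open H" "H \<noteq> {}"
  proof -
    show "open H" unfolding H_def by (rule open_halfspace_Re_gt)
    have "of_real (real k / 2 * (1 + real (char_delta chi)) + 1) \<in> H" by (simp add: H_def)
    thus "H \<noteq> {}" by blast
  qed
  have "(THE L. L holomorphic_on UNIV \<and> (\<forall>s. Re s > real k / 2 * (1 + real (char_delta chi)) \<longrightarrow> L s = Lk_series k chi s)) = L"
  proof (rule the_equality)
    show "L holomorphic_on UNIV \<and> (\<forall>s. Re s > real k / 2 * (1 + real (char_delta chi)) \<longrightarrow> L s = Lk_series k chi s)"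
      using L_holo L_eq by (simp add: H_def)
    fix M assume M: "M holomorphic_on UNIV \<and> (\<forall>s. Re s > real k / 2 * (1 + real (char_delta chi)) \<longrightarrow> M s = Lk_series k chi s)"
    show "M = L"
    proof
      fix s show "M s = L s"
        by (rule analytic_continuation_open[OF H(1) open_UNIV H(2) connected_UNIV subset_UNIV])
           (use M L_holo L_eq in \<open>auto simp: H_def\<close>)
    qed
  qed
  thus ?thesis by (simp only: Lk_def L_def)
qed

text \<open>Re s > 0 avoids the poles of Gamma, where the product in \<open>eta_k\<close> takes the
  conventional value 0. The critical line lies in this half-plane.\<close>

lemma eta_k_eq_mellin:
  assumes prim: "primitive_character q chi" and q2: "q \<ge> 2" and k: "k \<ge> 1" and s: "Re s > 0"
  shows "eta_k q k chi s = mellin (\<lambda>x. theta q chi x ^ k) s"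
proof -
  have "s \<notin> \<int>\<^sub>\<le>\<^sub>0" using s by (auto elim!: nonpos_Ints_cases)
  hence "Gamma s * rGamma s = 1" by (simp add: rGamma_inverse_Gamma Gamma_eq_zero_iff)
  moreover have "complex_of_real (pi / real q) powr (- s) * of_real (pi / real q) powr s = 1"
    using q2 by (simp add: powr_minus)
  moreover have "eta_k q k chi s = (Gamma s * rGamma s) * (of_real (pi / real q) powr (- s) * of_real (pi / real q) powr s) * mellin (\<lambda>x. theta q chi x ^ k) s"
    unfolding eta_k_def Lk_eq_mellin[OF prim q2 k] by (simp only: mult_ac)
  ultimately show ?thesis by simp
qed

subsection \<open>Zeros of superpositions\<close>

lemma continuous_fourier_transform:
  fixes \<gamma> :: "real \<Rightarrow> complex"
  assumes "integrable lborel \<gamma>"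
  shows "continuous_on UNIV (\<lambda>t. LBINT y. \<gamma> y * exp (\<i> * of_real (t * y)))"
proof (rule continuous_at_imp_continuous_on, rule ballI)
  fix t :: real
  have [measurable]: "\<gamma> \<in> borel_measurable borel" using borel_measurable_integrable[OF assms] by simp
  show "isCont (\<lambda>t. LBINT y. \<gamma> y * exp (\<i> * of_real (t * y))) t"
    unfolding continuous_at_sequentially o_def
  proof (intro allI impI)
    fix X assume X: "X \<longlonglongrightarrow> t"
    show "(\<lambda>n. LBINT y. \<gamma> y * exp (\<i> * of_real (X n * y))) \<longlonglongrightarrow> (LBINT y. \<gamma> y * exp (\<i> * of_real (t * y)))"
    proof (rule integral_dominated_convergence[where w = "\<lambda>y. norm (\<gamma> y)"])
      show "AE y in lborel. (\<lambda>n. \<gamma> y * exp (\<i> * of_real (X n * y))) \<longlonglongrightarrow> \<gamma> y * exp (\<i> * of_real (t * y))"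
        by (intro AE_I2 tendsto_intros X)
    qed (use assms in \<open>auto simp: norm_mult\<close>)
  qed
qed

text \<open>Shifting \<open>t\<close> by \<open>\<lambda>\<close> multiplies the inverse Fourier transform of \<open>\<Phi> t * exp (\<alpha> * t)\<close> by
  \<open>exp (- \<lambda> * \<alpha>) * exp (\<i> * \<lambda> * y)\<close>, so a superposition of shifts amounts to a bounded multiplier.\<close>
lemma superposition_transform:
  fixes \<Phi> :: "real \<Rightarrow> complex" and \<gamma> :: "real \<Rightarrow> complex" and c lam :: "nat \<Rightarrow> real"
  assumes c: "summable (\<lambda>j. \<bar>c j\<bar>)" and lam: "\<And>j. \<bar>lam j\<bar> \<le> \<Lambda>"
    and \<gamma>: "continuous_on UNIV \<gamma>" "\<And>y. norm (\<gamma> y) \<le> B * exp (- \<bar>y\<bar>)"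
    and \<Phi>: "\<And>t. (LBINT y. \<gamma> y * exp (\<i> * of_real (t * y))) = exp (of_real (\<alpha> * t)) * \<Phi> t"
    and \<alpha>: "\<bar>\<alpha>\<bar> \<le> A"
  defines "H \<equiv> \<lambda>y. \<Sum>j. of_real (c j * exp (- lam j * \<alpha>)) * exp (\<i> * of_real (lam j * y))"
  shows "continuous_on UNIV (\<lambda>y. H y * \<gamma> y)"
    and "norm (H y * \<gamma> y) \<le> (\<Sum>j. \<bar>c j\<bar>) * exp (\<Lambda> * A) * norm (\<gamma> y)"
    and "(LBINT y. H y * \<gamma> y * exp (\<i> * of_real (t * y))) = exp (of_real (\<alpha> * t)) * (\<Sum>j. of_real (c j) * \<Phi> (t + lam j))"
    and "summable (\<lambda>j. of_real (c j) * \<Phi> (t + lam j))"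
proof -
  define h where "h = (\<lambda>j y. complex_of_real (c j * exp (- lam j * \<alpha>)) * exp (\<i> * of_real (lam j * y)))"
  define E where "E = exp (\<Lambda> * A)"
  have \<Lambda>0: "\<Lambda> \<ge> 0" using order_trans[OF abs_ge_zero lam[of 0]] .
  have A0: "A \<ge> 0" using order_trans[OF abs_ge_zero \<alpha>] .
  have hB: "norm (h j y) \<le> \<bar>c j\<bar> * E" for j y
  proof -
    have "- lam j * \<alpha> \<le> \<bar>lam j\<bar> * \<bar>\<alpha>\<bar>" by (metis abs_ge_self abs_mult abs_minus_cancel mult_minus_left)
    also have "\<dots> \<le> \<Lambda> * A" using lam \<alpha> \<Lambda>0 by (intro mult_mono) auto
    finally have "exp (- lam j * \<alpha>) \<le> E" by (simp add: E_def)
    thus ?thesis by (simp add: h_def norm_mult abs_mult mult_left_mono)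
  qed
  have cE: "summable (\<lambda>j. \<bar>c j\<bar> * E)" by (intro summable_mult2 c)
  have h_sum: "summable (\<lambda>j. norm (h j y))" for y
    by (rule summable_comparison_test'[OF cE]) (use hB in simp)
  have H_h: "H y = (\<Sum>j. h j y)" for y by (simp add: H_def h_def)
  have ul: "uniform_limit UNIV (\<lambda>n y. \<Sum>j<n. h j y) (\<lambda>y. \<Sum>j. h j y) sequentially"
    by (rule Weierstrass_m_test[OF _ cE]) (rule hB)
  have H_cont: "continuous_on UNIV H" unfolding H_h[abs_def]
    by (rule uniform_limit_theorem[OF _ ul]) (auto simp: h_def intro!: always_eventually continuous_intros)
  show "continuous_on UNIV (\<lambda>y. H y * \<gamma> y)" by (intro continuous_intros H_cont \<gamma>)
  have HB: "norm (H y) \<le> (\<Sum>j. \<bar>c j\<bar>) * E" for y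
  proof -
    have "norm (H y) \<le> (\<Sum>j. norm (h j y))" unfolding H_h by (rule summable_norm[OF h_sum])
    also have "\<dots> \<le> (\<Sum>j. \<bar>c j\<bar> * E)" by (intro suminf_le hB h_sum cE)
    also have "\<dots> = (\<Sum>j. \<bar>c j\<bar>) * E" by (rule suminf_mult2[OF c, symmetric])
    finally show ?thesis .
  qed
  show "norm (H y * \<gamma> y) \<le> (\<Sum>j. \<bar>c j\<bar>) * exp (\<Lambda> * A) * norm (\<gamma> y)"
    unfolding norm_mult E_def[symmetric] by (intro mult_right_mono HB) auto
  have \<gamma>_int: "integrable lborel \<gamma>" by (rule integrable_exp_abs_bound[OF \<gamma>])
  define f where "f = (\<lambda>j y. h j y * \<gamma> y * exp (\<i> * of_real (t * y)))"
  have f_norm: "norm (f j y) \<le> \<bar>c j\<bar> * E * norm (\<gamma> y)" for j y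
    unfolding f_def norm_mult using hB[of j y] by (simp add: mult_right_mono)
  have f_int: "integrable lborel (f j)" for j
  proof (rule integrable_exp_abs_bound)
    show "continuous_on UNIV (f j)" unfolding f_def h_def by (intro continuous_intros \<gamma>)
    fix y
    have "norm (f j y) \<le> \<bar>c j\<bar> * E * (B * exp (- \<bar>y\<bar>))"
      by (rule order_trans[OF f_norm]) (intro mult_left_mono \<gamma>, simp add: E_def)
    thus "norm (f j y) \<le> (\<bar>c j\<bar> * E * B) * exp (- \<bar>y\<bar>)" by (simp add: mult.assoc)
  qed
  have f_sum: "summable (\<lambda>j. norm (f j y))" for y
    by (rule summable_comparison_test'[OF summable_mult2[OF cE, of "norm (\<gamma> y)"]]) (use f_norm in simp)
  have f_isum: "summable (\<lambda>j. LBINT y. norm (f j y))"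
  proof (rule summable_comparison_test'[OF summable_mult2[OF cE, of "LBINT y. norm (\<gamma> y)"]])
    fix j
    have "(LBINT y. norm (f j y)) \<le> (LBINT y. \<bar>c j\<bar> * E * norm (\<gamma> y))"
      by (intro integral_mono integrable_norm f_int f_norm integrable_mult_right \<gamma>_int)
    thus "norm (LBINT y. norm (f j y)) \<le> \<bar>c j\<bar> * E * (LBINT y. norm (\<gamma> y))"
      by (simp add: integral_nonneg_AE)
  qed
  have f_val: "(LBINT y. f j y) = exp (of_real (\<alpha> * t)) * (of_real (c j) * \<Phi> (t + lam j))" for j
  proof -
    have "f j y = of_real (c j * exp (- lam j * \<alpha>)) * (\<gamma> y * exp (\<i> * of_real ((t + lam j) * y)))" for y
    proof -
      have "exp (\<i> * of_real ((t + lam j) * y)) = exp (\<i> * of_real (lam j * y)) * exp (\<i> * of_real (t * y))"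
        unfolding exp_add[symmetric] by (simp add: algebra_simps)
      thus ?thesis by (simp add: f_def h_def mult_ac)
    qed
    hence "(LBINT y. f j y) = of_real (c j * exp (- lam j * \<alpha>)) * (LBINT y. \<gamma> y * exp (\<i> * of_real ((t + lam j) * y)))"
      by (simp only: integral_mult_right_zero)
    also have "\<dots> = of_real (c j) * (exp (of_real (- lam j * \<alpha>)) * exp (of_real (\<alpha> * (t + lam j)))) * \<Phi> (t + lam j)"
      unfolding \<Phi> of_real_mult[of "c j"] exp_of_real[symmetric] by (simp only: mult_ac)
    also have "exp (of_real (- lam j * \<alpha>)) * exp (of_real (\<alpha> * (t + lam j))) = exp (complex_of_real (\<alpha> * t))"
      unfolding exp_add[symmetric] by (simp add: algebra_simps)
    finally show ?thesis by (simp only: mult_ac)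
  qed
  have "(\<lambda>j. LBINT y. f j y) sums (LBINT y. \<Sum>j. f j y)"
    by (rule sums_integral[OF f_int _ f_isum]) (use f_sum in auto)
  hence sums: "(\<lambda>j. exp (of_real (\<alpha> * t)) * (of_real (c j) * \<Phi> (t + lam j))) sums (LBINT y. \<Sum>j. f j y)"
    unfolding f_val .
  have "(\<lambda>j. exp (- of_real (\<alpha> * t)) * (exp (of_real (\<alpha> * t)) * (of_real (c j) * \<Phi> (t + lam j)))) sums (exp (- of_real (\<alpha> * t)) * (LBINT y. \<Sum>j. f j y))"
    by (rule sums_mult[OF sums])
  thus summ: "summable (\<lambda>j. of_real (c j) * \<Phi> (t + lam j))"
    by (simp add: sums_iff mult.assoc[symmetric] flip: exp_add)
  have "(\<Sum>j. f j y) = H y * \<gamma> y * exp (\<i> * of_real (t * y))" for y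
  proof -
    have "(\<Sum>j. h j y * (\<gamma> y * exp (\<i> * of_real (t * y)))) = H y * (\<gamma> y * exp (\<i> * of_real (t * y)))"
      unfolding H_h by (rule suminf_mult2[OF summable_norm_cancel[OF h_sum], symmetric])
    thus ?thesis by (simp add: f_def mult.assoc)
  qed
  hence "(LBINT y. H y * \<gamma> y * exp (\<i> * of_real (t * y))) = (\<Sum>j. exp (of_real (\<alpha> * t)) * (of_real (c j) * \<Phi> (t + lam j)))"
    using sums by (simp add: sums_iff)
  thus "(LBINT y. H y * \<gamma> y * exp (\<i> * of_real (t * y))) = exp (of_real (\<alpha> * t)) * (\<Sum>j. of_real (c j) * \<Phi> (t + lam j))"
    by (simp add: suminf_mult[OF summ])
qed

text \<open>\<open>kummer_transformation\<close> makes exp (\<alpha> t) * \<Phi> t the Fourier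
  transform of an explicit \<open>\<gamma>\<close>, and \<open>superposition_transform\<close> makes
  exp (\<alpha> t) * F t that of G = H * \<gamma>. Inversion at 0 identifies the moments with values
  of G at y = 0, to which \<open>kop_flat\<close> applies. Dividing by D turns F into a real
  function.\<close>

lemma infinite_zeros_superposition:
  fixes T :: "complex \<Rightarrow> complex" and c lam :: "nat \<Rightarrow> real" and z :: complex
  assumes T: "sector_decay T" and cusp: "cusp_decay K T" and K: "K > 0" and b: "b > 0"
    and z: "\<bar>Re z\<bar> < sqrt (2 * K)" "\<bar>Im z\<bar> < sqrt (2 * K)"
    and c: "summable (\<lambda>j. \<bar>c j\<bar>)" and lam: "\<And>j. \<bar>lam j\<bar> \<le> \<Lambda>"
  defines "s \<equiv> \<lambda>t::real. of_real (b / 2) + \<i> * of_real t"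
  defines "\<Phi> \<equiv> \<lambda>t. mellin T (s t) * (kummer_1F1 (of_real b - s t) (of_real b) (z\<^sup>2 / 4) + kummer_1F1 (s t) (of_real b) ((cnj z)\<^sup>2 / 4))"
  assumes real: "\<And>t. \<Phi> t = D * of_real (\<phi> t)" and D: "D \<noteq> 0"
  shows "infinite {t. (\<Sum>j. of_real (c j) * \<Phi> (t + lam j)) = 0}"
proof -
  define F where "F = (\<lambda>t. \<Sum>j. of_real (c j) * \<Phi> (t + lam j))"
  \<comment> \<open>The parameters of \<open>kop\<close> for the two summands: the first is brought
    to the form 1F1 (s; b; - u1) by Kummer's transformation, the second has this form already with -
    u2.\<close>
  define u1 where "u1 = z\<^sup>2 / 4"
  define u2 where "u2 = - ((cnj z)\<^sup>2 / 4)"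
  \<comment> \<open>The prefactor removes the constant phase exp (- \<i> b \<alpha> / 2) from exp (-
    \<i> s \<alpha>) and leaves exp (\<alpha> t).\<close>
  define \<gamma> where "\<gamma> = (\<lambda>\<alpha> y. exp (\<i> * of_real (b * \<alpha> / 2)) * (exp u1 * (exp (of_real (b / 2) * of_real y) * kop b u1 T (ray \<alpha> y)) + exp (of_real (b / 2) * of_real y) * kop b u2 T (ray \<alpha> y)))"
  have \<gamma>_cont: "continuous_on UNIV (\<gamma> \<alpha>)" if "\<bar>\<alpha>\<bar> < pi / 2" for \<alpha>
    unfolding \<gamma>_def by (intro continuous_intros kop_ray(1)[OF T that b])
  have \<gamma>_bound: "\<exists>B. \<forall>y. norm (\<gamma> \<alpha> y) \<le> B * exp (- \<bar>y\<bar>)" if \<alpha>: "\<bar>\<alpha>\<bar> < pi / 2" for \<alpha>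
  proof -
    obtain B1 where B1: "\<forall>y. norm (exp (of_real (b / 2) * of_real y) * kop b u1 T (ray \<alpha> y)) \<le> B1 * exp (- \<bar>y\<bar>)"
      using kop_ray(2)[OF T \<alpha> b, of "of_real (b / 2)" u1] by (elim exE) (rule that, assumption)
    obtain B2 where B2: "\<forall>y. norm (exp (of_real (b / 2) * of_real y) * kop b u2 T (ray \<alpha> y)) \<le> B2 * exp (- \<bar>y\<bar>)"
      using kop_ray(2)[OF T \<alpha> b, of "of_real (b / 2)" u2] by (elim exE) (rule that, assumption)
    have "norm (\<gamma> \<alpha> y) \<le> (norm (exp u1) * B1 + B2) * exp (- \<bar>y\<bar>)" for y
    proof -
      have "norm (\<gamma> \<alpha> y) \<le> norm (exp u1 * (exp (of_real (b / 2) * of_real y) * kop b u1 T (ray \<alpha> y))) + norm (exp (of_real (b / 2) * of_real y) * kop b u2 T (ray \<alpha> y))"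
        unfolding \<gamma>_def norm_mult[of "exp (\<i> * of_real (b * \<alpha> / 2))"] norm_exp_i_times mult_1_left by (rule norm_triangle_ineq)
      also have "\<dots> \<le> norm (exp u1) * (B1 * exp (- \<bar>y\<bar>)) + B2 * exp (- \<bar>y\<bar>)"
        unfolding norm_mult[of "exp u1"] by (intro add_mono mult_left_mono B1[rule_format] B2[rule_format]) auto
      finally show ?thesis by (simp add: algebra_simps)
    qed
    thus ?thesis by blast
  qed
  have \<gamma>_FT: "(LBINT y. \<gamma> \<alpha> y * exp (\<i> * of_real (t * y))) = exp (of_real (\<alpha> * t)) * \<Phi> t" if \<alpha>: "\<bar>\<alpha>\<bar> < pi / 2" for \<alpha> t
  proof -
    define k where "k = (\<lambda>u y. exp (s t * of_real y) * kop b u T (ray \<alpha> y))"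
    have k_int: "integrable lborel (k u)" for u
    proof -
      obtain B where B: "\<forall>y. norm (exp (s t * of_real y) * kop b u T (ray \<alpha> y)) \<le> B * exp (- \<bar>y\<bar>)"
        using kop_ray(2)[OF T \<alpha> b, of "s t" u] by (elim exE) (rule that, assumption)
      show ?thesis unfolding k_def by (rule integrable_exp_abs_bound[OF kop_ray(1)[OF T \<alpha> b] B[rule_format]])
    qed
    have split: "\<gamma> \<alpha> y * exp (\<i> * of_real (t * y)) = exp (\<i> * of_real (b * \<alpha> / 2)) * (exp u1 * k u1 y + k u2 y)" for y
    proof -
      have "exp (s t * of_real y) = exp (of_real (b / 2) * of_real y) * exp (\<i> * of_real (t * y))"
        unfolding exp_add[symmetric] by (simp add: s_def algebra_simps)
      thus ?thesis by (simp add: \<gamma>_def k_def algebra_simps)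
    qed
    have "(LBINT y. \<gamma> \<alpha> y * exp (\<i> * of_real (t * y))) = exp (\<i> * of_real (b * \<alpha> / 2)) * (exp u1 * (LBINT y. k u1 y) + (LBINT y. k u2 y))"
      unfolding split integral_mult_right_zero
      by (subst Bochner_Integration.integral_add) (use k_int in auto)
    also have "\<dots> = (exp (\<i> * of_real (b * \<alpha> / 2)) * exp (- s t * \<i> * of_real \<alpha>)) * mellin T (s t) *
        (exp u1 * kummer_1F1 (s t) (of_real b) (- u1) + kummer_1F1 (s t) (of_real b) (- u2))"
      unfolding k_def kop_ray(3)[OF T \<alpha> b] by (simp only: ring_distribs mult_ac)
    also have "exp (\<i> * of_real (b * \<alpha> / 2)) * exp (- s t * \<i> * of_real \<alpha>) = exp (of_real (\<alpha> * t))"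
      unfolding exp_add[symmetric] by (rule arg_cong[of _ _ exp]) (simp add: s_def complex_eq_iff algebra_simps)
    also have "exp u1 * kummer_1F1 (s t) (of_real b) (- u1) = kummer_1F1 (of_real b - s t) (of_real b) u1"
      by (rule kummer_transformation[OF b, symmetric])
    finally show ?thesis by (simp only: \<Phi>_def u1_def u2_def minus_minus mult.assoc)
  qed
  define H where "H = (\<lambda>\<alpha> y. \<Sum>j. of_real (c j * exp (- lam j * \<alpha>)) * exp (\<i> * of_real (lam j * y)))"
  define G where "G = (\<lambda>\<alpha> y. H \<alpha> y * \<gamma> \<alpha> y)"
  define CH where "CH = (\<Sum>j. \<bar>c j\<bar>) * exp (\<Lambda> * (pi / 2))"
  have CH: "CH \<ge> 0" unfolding CH_def by (intro mult_nonneg_nonneg suminf_nonneg c) auto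
  have G: "continuous_on UNIV (G \<alpha>)" "\<And>y. norm (G \<alpha> y) \<le> CH * norm (\<gamma> \<alpha> y)"
    "\<And>t. (LBINT y. G \<alpha> y * exp (\<i> * of_real (t * y))) = exp (of_real (\<alpha> * t)) * F t"
    "\<And>t. summable (\<lambda>j. of_real (c j) * \<Phi> (t + lam j))" "\<exists>B. \<forall>y. norm (G \<alpha> y) \<le> B * exp (- \<bar>y\<bar>)"
    if \<alpha>: "\<bar>\<alpha>\<bar> < pi / 2" for \<alpha>
  proof -
    obtain B where B: "\<forall>y. norm (\<gamma> \<alpha> y) \<le> B * exp (- \<bar>y\<bar>)"
      using \<gamma>_bound[OF \<alpha>] by (elim exE) (rule that, assumption)
    note st = superposition_transform[OF c lam \<gamma>_cont[OF \<alpha>] B[rule_format] \<gamma>_FT[OF \<alpha>] less_imp_le[OF \<alpha>]]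
    show "continuous_on UNIV (G \<alpha>)" unfolding G_def H_def by (rule st(1))
    show G2: "norm (G \<alpha> y) \<le> CH * norm (\<gamma> \<alpha> y)" for y unfolding G_def H_def CH_def by (rule st(2))
    show "(LBINT y. G \<alpha> y * exp (\<i> * of_real (t * y))) = exp (of_real (\<alpha> * t)) * F t" for t
      unfolding G_def H_def F_def by (rule st(3))
    show "summable (\<lambda>j. of_real (c j) * \<Phi> (t + lam j))" for t by (rule st(4))
    have "norm (G \<alpha> y) \<le> (CH * B) * exp (- \<bar>y\<bar>)" for y
      using order_trans[OF G2 mult_left_mono[OF B[rule_format] CH]] by (simp add: mult.assoc)
    thus "\<exists>B. \<forall>y. norm (G \<alpha> y) \<le> B * exp (- \<bar>y\<bar>)" by blast
  qed
  have G_int: "integrable lborel (G \<alpha>)" if \<alpha>: "\<bar>\<alpha>\<bar> < pi / 2" for \<alpha>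
  proof -
    obtain B where "\<forall>y. norm (G \<alpha> y) \<le> B * exp (- \<bar>y\<bar>)" using G(5)[OF \<alpha>] by (elim exE) (rule that, assumption)
    thus ?thesis by (intro integrable_exp_abs_bound[OF G(1)[OF \<alpha>]]) blast
  qed
  have zero: "\<bar>0::real\<bar> < pi / 2" by simp
  have F_eq: "F t = (LBINT y. G 0 y * exp (\<i> * of_real (t * y)))" for t
    using G(3)[OF zero, of t] by simp
  have F_cont: "continuous_on UNIV F"
    unfolding F_eq[abs_def] by (rule continuous_fourier_transform[OF G_int[OF zero]])
  have F_bound: "exp (\<alpha> * t) * norm (F t) \<le> (LBINT y. norm (G \<alpha> y))" if \<alpha>: "\<bar>\<alpha>\<bar> < pi / 2" for \<alpha> t
  proof -
    have "exp (\<alpha> * t) * norm (F t) = norm (LBINT y. G \<alpha> y * exp (\<i> * of_real (t * y)))"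
      unfolding G(3)[OF \<alpha>] by (simp add: norm_mult)
    also have "\<dots> \<le> (LBINT y. norm (G \<alpha> y * exp (\<i> * of_real (t * y))))" by (rule integral_norm_bound)
    also have "\<dots> = (LBINT y. norm (G \<alpha> y))" by (simp add: norm_mult)
    finally show ?thesis .
  qed
  define E where "E = (\<lambda>\<alpha> t. exp (of_real (\<alpha> * t)) * F t)"
  have E_cont: "continuous_on UNIV (E \<alpha>)" for \<alpha> unfolding E_def by (intro continuous_intros F_cont)
  have E_int: "integrable lborel (E \<alpha>)" if \<alpha>: "0 < \<alpha>" "\<alpha> < pi / 2" for \<alpha>
  proof -
    \<comment> \<open>For t > 0 the bound at a rate beyond \<alpha> gives decay of exp (\<alpha> t)
      * F t; for t < 0 boundedness of F suffices since \<alpha> > 0.\<close>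
    define \<alpha>' where "\<alpha>' = (\<alpha> + pi / 2) / 2"
    have \<alpha>': "\<alpha> < \<alpha>'" "\<bar>\<alpha>'\<bar> < pi / 2" using \<alpha> by (auto simp: \<alpha>'_def)
    define \<mu> where "\<mu> = min \<alpha> (\<alpha>' - \<alpha>)"
    have \<mu>: "\<mu> > 0" using \<alpha> \<alpha>' by (simp add: \<mu>_def)
    define B where "B = (LBINT y. norm (G \<alpha>' y)) + (LBINT y. norm (G 0 y))"
    have B0: "(LBINT y. norm (G \<alpha>' y)) \<ge> 0" "(LBINT y. norm (G 0 y)) \<ge> 0" by (simp_all add: integral_nonneg_AE)
    have bd: "norm (E \<alpha> t) \<le> B * exp (- \<mu> * \<bar>t\<bar>)" for t
    proof (cases "t \<ge> 0")
      case True
      have "norm (E \<alpha> t) = exp (- (\<alpha>' - \<alpha>) * t) * (exp (\<alpha>' * t) * norm (F t))"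
        unfolding mult.assoc[symmetric] exp_add[symmetric] by (simp add: E_def norm_mult algebra_simps)
      also have "\<dots> \<le> exp (- \<mu> * t) * B"
      proof (rule mult_mono)
        have "\<mu> * t \<le> (\<alpha>' - \<alpha>) * t" using True by (intro mult_right_mono) (auto simp: \<mu>_def)
        hence "- (\<alpha>' - \<alpha>) * t \<le> - \<mu> * t" by linarith
        thus "exp (- (\<alpha>' - \<alpha>) * t) \<le> exp (- \<mu> * t)" by (simp only: exp_le_cancel_iff)
        show "exp (\<alpha>' * t) * norm (F t) \<le> B" using F_bound[OF \<alpha>'(2), of t] B0(2) unfolding B_def by linarith
      qed auto
      finally show ?thesis using True by (simp add: mult.commute)
    next
      case False
      have "norm (E \<alpha> t) = exp (\<alpha> * t) * norm (F t)" by (simp add: E_def norm_mult)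
      also have "\<dots> \<le> exp (\<mu> * t) * B"
      proof (rule mult_mono)
        have "\<alpha> * t \<le> \<mu> * t" using False by (intro mult_right_mono_neg) (auto simp: \<mu>_def)
        thus "exp (\<alpha> * t) \<le> exp (\<mu> * t)" by simp
        have "norm (F t) \<le> (LBINT y. norm (G 0 y))" using F_bound[OF zero, of t] by simp
        thus "norm (F t) \<le> B" using B0(1) unfolding B_def by linarith
      qed auto
      finally show ?thesis using False by (simp add: mult.commute)
    qed
    show ?thesis
    proof (rule Bochner_Integration.integrable_bound)
      show "integrable lborel (\<lambda>t. B * exp (- \<mu> * \<bar>t\<bar>))" by (intro integrable_mult_right integrable_exp_abs_scaled \<mu>)
      show "E \<alpha> \<in> borel_measurable lborel" using borel_measurable_continuous_onI[OF E_cont] by simp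
      show "AE t in lborel. norm (E \<alpha> t) \<le> norm (B * exp (- \<mu> * \<bar>t\<bar>))"
        using order_trans[OF bd abs_ge_self] by (intro AE_I2) simp
    qed
  qed
  \<comment> \<open>The moment of rate \<alpha> equals, up to 2 pi, the function
    \<open>G \<alpha>\<close> at y = 0, that is at the point exp (\<i> \<alpha>).\<close>
  have E_val: "(LBINT t. E \<alpha> t) = 2 * pi * G \<alpha> 0" if \<alpha>: "0 < \<alpha>" "\<alpha> < pi / 2" for \<alpha>
  proof -
    have \<alpha>': "\<bar>\<alpha>\<bar> < pi / 2" using \<alpha> by simp
    obtain B where B: "\<forall>y. norm (G \<alpha> y) \<le> B * exp (- \<bar>y\<bar>)" using G(5)[OF \<alpha>'] by (elim exE) (rule that, assumption)
    have "B \<ge> 0" using order_trans[OF norm_ge_zero B[rule_format, of 0]] by simp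
    hence "B * exp (- \<bar>y\<bar>) \<le> B * 1" for y by (intro mult_left_mono) auto
    hence B': "norm (G \<alpha> y) \<le> B" for y using order_trans[OF B[rule_format, of y]] by simp
    show ?thesis
      by (rule fourier_inversion_0[OF G_int[OF \<alpha>'] G(1)[OF \<alpha>'] B' E_int[OF \<alpha>]]) (simp only: E_def G(3)[OF \<alpha>'])
  qed
  define f where "f = (\<lambda>t. \<Sum>j. c j * \<phi> (t + lam j))"
  have F_f: "F t = D * of_real (f t)" for t
  proof -
    have "summable (\<lambda>j. 1 / D * (of_real (c j) * \<Phi> (t + lam j)))" by (intro summable_mult G(4)[OF zero])
    hence "summable (\<lambda>j. complex_of_real (c j * \<phi> (t + lam j)))" using D by (simp add: real)
    hence sr: "summable (\<lambda>j. c j * \<phi> (t + lam j))" by (simp only: summable_complex_of_real)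
    have "F t = (\<Sum>j. D * complex_of_real (c j * \<phi> (t + lam j)))"
      unfolding F_def real by (simp add: mult_ac)
    also have "\<dots> = D * (\<Sum>j. complex_of_real (c j * \<phi> (t + lam j)))"
      by (rule suminf_mult) (simp only: summable_complex_of_real sr)
    also have "(\<Sum>j. complex_of_real (c j * \<phi> (t + lam j))) = of_real (f t)"
      unfolding f_def by (rule suminf_of_real[OF sr, symmetric])
    finally show ?thesis .
  qed
  have f_eq: "f t = Re (F t / D)" for t using D by (simp add: F_f)
  have fE: "complex_of_real (f t * exp (\<alpha> * t)) = E \<alpha> t / D" for \<alpha> t
    using D by (simp add: E_def F_f exp_of_real[symmetric])
  have z': "\<bar>Re (\<i> * cnj z)\<bar> < sqrt (2 * K)" "\<bar>Im (\<i> * cnj z)\<bar> < sqrt (2 * K)" using z by simp_all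
  have flat: "\<exists>C c h0. c > 0 \<and> h0 > 0 \<and> (\<forall>h. 0 < h \<and> h < h0 \<longrightarrow> norm (kop b (v\<^sup>2 / 4) T (ray (pi / 2 - h) 0)) \<le> C * exp (- c / h))"
    if v: "\<bar>Re v\<bar> < sqrt (2 * K)" "\<bar>Im v\<bar> < sqrt (2 * K)" for v
  proof -
    from saddle_condition[OF v K] obtain K' \<rho> c0 where sc: "0 < K'" "K' < K" "0 < \<rho>" "\<rho> < 1" "c0 > 0"
      "\<forall>\<kappa>. norm \<kappa> = \<rho> \<longrightarrow> Re ((1 - \<kappa>) * (\<i> * (v\<^sup>2 / 4) / \<kappa> - of_real K')) \<le> - c0"
      by (elim exE conjE) (rule that, assumption+)
    show ?thesis
      by (rule kop_flat[OF _ cusp b sc(1-5) sc(6)[rule_format]])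
         (use T in \<open>auto simp: sector_decay_def\<close>)
  qed
  from flat[OF z, folded u1_def] obtain C1 c1 h1 where f1: "c1 > 0" "h1 > 0" "\<forall>h. 0 < h \<and> h < h1 \<longrightarrow> norm (kop b u1 T (ray (pi / 2 - h) 0)) \<le> C1 * exp (- c1 / h)"
    by blast
  \<comment> \<open>Thus the second summand is the flatness statement for \<i> cnj z, whose real and
    imaginary parts are those of z exchanged.\<close>
  have u2: "(\<i> * cnj z)\<^sup>2 / 4 = u2" by (simp add: u2_def power_mult_distrib)
  from flat[OF z', unfolded u2] obtain C2 c2 h2 where f2: "c2 > 0" "h2 > 0" "\<forall>h. 0 < h \<and> h < h2 \<longrightarrow> norm (kop b u2 T (ray (pi / 2 - h) 0)) \<le> C2 * exp (- c2 / h)"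
    by blast
  define c' where "c' = min c1 c2"
  define \<alpha>0 where "\<alpha>0 = max 0 (pi / 2 - min h1 h2)"
  define C where "C = 2 * pi * CH * (norm (exp u1) * \<bar>C1\<bar> + \<bar>C2\<bar>) / norm D"
  have "infinite {t. f t = 0}"
  proof (rule infinite_zeros_of_flat_moments)
    show "continuous_on UNIV f" unfolding f_eq[abs_def] using D by (intro continuous_intros F_cont) auto
    show "integrable lborel (\<lambda>t. f t * exp (\<alpha> * t))" if "0 < \<alpha>" "\<alpha> < pi / 2" for \<alpha>
    proof -
      have "integrable lborel (\<lambda>t. E \<alpha> t / D)" using E_int[OF that] by simp
      hence "integrable lborel (\<lambda>t. complex_of_real (f t * exp (\<alpha> * t)))" by (simp only: fE)
      thus ?thesis by (simp only: complex_of_real_integrable_eq)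
    qed
    show "c' > 0" using f1 f2 by (simp add: c'_def)
    have "min h1 h2 > 0" using f1(2) f2(2) by simp
    thus "\<alpha>0 < pi / 2" using pi_gt_zero unfolding \<alpha>0_def by (simp only: max_less_iff_conj) linarith
    fix \<alpha> assume \<alpha>: "\<alpha>0 < \<alpha>" "\<alpha> < pi / 2"
    define h where "h = pi / 2 - \<alpha>"
    have h: "0 < h" "h < h1" "h < h2" "\<alpha> = pi / 2 - h" using \<alpha> by (auto simp: h_def \<alpha>0_def)
    have \<alpha>': "0 < \<alpha>" "\<bar>\<alpha>\<bar> < pi / 2" using \<alpha> by (auto simp: \<alpha>0_def)
    have k1: "norm (kop b u1 T (ray \<alpha> 0)) \<le> \<bar>C1\<bar> * exp (- c' / h)"
    proof -
      have "norm (kop b u1 T (ray \<alpha> 0)) \<le> C1 * exp (- c1 / h)" using f1(3) h by blast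
      also have "\<dots> \<le> \<bar>C1\<bar> * exp (- c' / h)" using h by (intro mult_mono) (auto simp: c'_def divide_right_mono)
      finally show ?thesis .
    qed
    have k2: "norm (kop b u2 T (ray \<alpha> 0)) \<le> \<bar>C2\<bar> * exp (- c' / h)"
    proof -
      have "norm (kop b u2 T (ray \<alpha> 0)) \<le> C2 * exp (- c2 / h)" using f2(3) h by blast
      also have "\<dots> \<le> \<bar>C2\<bar> * exp (- c' / h)" using h by (intro mult_mono) (auto simp: c'_def divide_right_mono)
      finally show ?thesis .
    qed
    have "norm (\<gamma> \<alpha> 0) = norm (exp u1 * kop b u1 T (ray \<alpha> 0) + kop b u2 T (ray \<alpha> 0))"
      by (simp add: \<gamma>_def norm_mult)
    also have "\<dots> \<le> norm (exp u1) * (\<bar>C1\<bar> * exp (- c' / h)) + \<bar>C2\<bar> * exp (- c' / h)"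
      by (rule order_trans[OF norm_triangle_ineq]) (unfold norm_mult, intro add_mono mult_left_mono k1 k2, simp)
    finally have g0: "norm (\<gamma> \<alpha> 0) \<le> (norm (exp u1) * \<bar>C1\<bar> + \<bar>C2\<bar>) * exp (- c' / h)" by (simp add: algebra_simps)
    have "complex_of_real (LBINT t. f t * exp (\<alpha> * t)) = (LBINT t. E \<alpha> t / D)"
      unfolding fE[symmetric] by (rule integral_complex_of_real[symmetric])
    also have "\<dots> = 2 * pi * G \<alpha> 0 / D" using E_val[OF \<alpha>'(1) \<alpha>(2)] by simp
    finally have "norm (complex_of_real (LBINT t. f t * exp (\<alpha> * t))) = norm (2 * pi * G \<alpha> 0 / D)" by (rule arg_cong)
    hence "\<bar>LBINT t. f t * exp (\<alpha> * t)\<bar> = 2 * pi * norm (G \<alpha> 0) / norm D"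
      by (simp only: norm_of_real) (simp add: norm_mult norm_divide)
    also have "\<dots> \<le> 2 * pi * (CH * ((norm (exp u1) * \<bar>C1\<bar> + \<bar>C2\<bar>) * exp (- c' / h))) / norm D"
      using D by (intro divide_right_mono mult_left_mono order_trans[OF G(2)[OF \<alpha>'(2)] mult_left_mono[OF g0 CH]]) auto
    also have "\<dots> = C * exp (- c' / (pi / 2 - \<alpha>))" by (simp add: C_def h_def)
    finally show "\<bar>LBINT t. f t * exp (\<alpha> * t)\<bar> \<le> C * exp (- c' / (pi / 2 - \<alpha>))" .
  qed
  moreover have "{t. f t = 0} = {t. F t = 0}" using D by (simp only: F_f mult_eq_0_iff of_real_eq_0_iff simp_thms)
  ultimately show ?thesis unfolding F_def by metis
qed

section \<open>Conjugation symmetry and the conclusion\<close>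

lemma cnj_pochhammer: "cnj (pochhammer a n) = pochhammer (cnj a) n"
  by (induction n) (simp_all add: pochhammer_Suc)

lemma cnj_kummer_1F1:
  assumes "\<beta> > (0::real)"
  shows "cnj (kummer_1F1 a (of_real \<beta>) u) = kummer_1F1 (cnj a) (of_real \<beta>) (cnj u)"
proof -
  have "cnj (kummer_1F1 a (of_real \<beta>) u) = (\<Sum>n. cnj (pochhammer a n / pochhammer (of_real \<beta>) n * u ^ n / fact n))"
    unfolding kummer_1F1_def
    by (rule bounded_linear.suminf[OF bounded_linear_cnj summable_norm_cancel[OF summable_kummer[OF assms]]])
  thus ?thesis by (simp add: kummer_1F1_def cnj_pochhammer)
qed

theorem theorem1p3:
  fixes q k :: nat and chi :: "int \<Rightarrow> complex" and c lam :: "nat \<Rightarrow> real" and z :: complex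
  assumes "q \<ge> 2"
    and "primitive_character q chi"
    and "even_character chi \<Longrightarrow> \<not> [q = 0] (mod 4)"
    and "k \<ge> 1"
    and "summable (\<lambda>j. \<bar>c j\<bar>)"
    and "bounded (range lam)"
    and "inj lam"
    and "Sup (range lam) \<in> range lam"
    and "Inf (range lam) \<in> range lam"
    and "z \<in> D_region q"
  shows "infinite {s. Re s = real k / 2 * (1 / 2 + real (char_delta chi)) \<and>
                      F_fun q c lam z k chi s = 0}"
proof -
  note q2 = assms(1) and prim = assms(2) and k = assms(4)
  define b where "b = real k * (1 / 2 + real (char_delta chi))"
  have b: "b > 0" using k by (simp add: b_def add_pos_nonneg)
  define T where "T = (\<lambda>x. theta q chi x ^ k)"
  have T: "sector_decay T" unfolding T_def by (rule sector_decay_power[OF theta_sector_decay[OF prim q2] k])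
  \<comment> \<open>The decay rate of the theta series at \<i>; sqrt (2 K) is the half side of the
    given square.\<close>
  define K where "K = pi / (4 * real q)"
  have K: "K > 0" using q2 by (simp add: K_def)
  have cusp: "cusp_decay K T" unfolding T_def K_def by (rule cusp_decay_theta_power[OF prim q2 _ k]) (fact assms(3))
  have z: "\<bar>Re z\<bar> < sqrt (2 * K)" "\<bar>Im z\<bar> < sqrt (2 * K)"
    using assms(10) by (simp_all add: D_region_def K_def)
  obtain \<Lambda> where lam: "\<And>j. \<bar>lam j\<bar> \<le> \<Lambda>" using assms(6) unfolding bounded_iff by auto
  define s where "s = (\<lambda>t::real. of_real (b / 2) + \<i> * of_real t)"
  define M where "M = (\<lambda>t. mellin T (s t))"
  define A where "A = (\<lambda>t. kummer_1F1 (of_real b - s t) (of_real b) (z\<^sup>2 / 4))"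
  define A' where "A' = (\<lambda>t. kummer_1F1 (s t) (of_real b) ((cnj z)\<^sup>2 / 4))"
  have A': "A' t = cnj (A t)" for t
  proof -
    have "cnj (of_real b - s t) = s t" by (simp add: s_def complex_eq_iff)
    thus ?thesis unfolding A_def A'_def cnj_kummer_1F1[OF b] by simp
  qed
  have F_line: "F_fun q c lam z k chi (s t) = (\<Sum>j. of_real (c j) * (M (t + lam j) * (A (t + lam j) + A' (t + lam j))))" for t
  proof -
    have s1: "s t + \<i> * of_real (lam j) = s (t + lam j)" for j by (simp add: s_def algebra_simps)
    have s2: "of_real b - s t - \<i> * of_real (lam j) = of_real b - s (t + lam j)" for j by (simp add: s_def algebra_simps)
    \<comment> \<open>On the line b - cnj s = s, so both Kummer functions depend on t and lam j only
      through t + lam j, as a superposition of shifts requires.\<close>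
    have s3: "of_real b - cnj (s t) + \<i> * of_real (lam j) = s (t + lam j)" for j by (simp add: s_def complex_eq_iff)
    have "eta_k q k chi (s (t + lam j)) = M (t + lam j)" for j
      unfolding M_def T_def by (rule eta_k_eq_mellin[OF prim q2 k]) (use b in \<open>simp add: s_def\<close>)
    thus ?thesis
      unfolding F_fun_def Let_def b_def[symmetric] s1 s2 s3 A_def A'_def by (simp only: mult.assoc)
  qed
  have "infinite {t. (\<Sum>j. of_real (c j) * (M (t + lam j) * (A (t + lam j) + A' (t + lam j)))) = 0}"
  proof (cases "\<forall>t. M t = 0")
    \<comment> \<open>If \<open>M\<close> vanishes identically, so does the sum. Otherwise one
      nonzero value M t0 supplies the constant that rotates everything to the real axis.\<close>
    case True
    thus ?thesis by (simp add: infinite_UNIV_char_0)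
  next
    case False
    then obtain t0 where t0: "M t0 \<noteq> 0" by blast
    obtain C0 where C0: "\<forall>x>0. theta q chi (of_real (1 / x)) = C0 * of_real (x powr (1/2 + real (char_delta chi))) * cnj (theta q chi (of_real x))"
      using theta_functional_equation[OF prim] by (elim exE) (rule that, assumption)
    have "T (of_real (1 / x)) = C0 ^ k * of_real (x powr b) * cnj (T (of_real x))" if x: "x > 0" for x
    proof -
      have "(x powr (1/2 + real (char_delta chi))) ^ k = x powr b"
        using x k by (simp add: b_def powr_power mult.commute)
      thus ?thesis unfolding T_def C0[rule_format, OF x] by (simp add: power_mult_distrib flip: of_real_power)
    qed
    hence fe: "M t = C0 ^ k * cnj (M t)" for t
      unfolding M_def s_def by (rule mellin_critical_line[OF T])
    have C0nz: "C0 ^ k \<noteq> 0" using fe[of t0] t0 by (metis mult_zero_left)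
    define \<phi> where "\<phi> = (\<lambda>t. Re (M t / M t0) * (2 * Re (A t)))"
    \<comment> \<open>M t and M t0 are the same multiple of their conjugates, so their quotient is
      real.\<close>
    have M_real: "M t = M t0 * of_real (Re (M t / M t0))" for t
    proof -
      have "cnj (M t / M t0) = (C0 ^ k * cnj (M t)) / (C0 ^ k * cnj (M t0))"
        by (simp only: complex_cnj_divide mult_divide_mult_cancel_left[OF C0nz])
      also have "\<dots> = M t / M t0" by (simp only: fe[symmetric])
      finally have "M t / M t0 \<in> \<real>" by (simp only: Reals_cnj_iff)
      hence "M t / M t0 = of_real (Re (M t / M t0))" by (simp only: of_real_Re)
      hence "M t0 * (M t / M t0) = M t0 * of_real (Re (M t / M t0))" by (rule arg_cong)
      thus ?thesis using t0 by simp
    qed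
    have "M t * (A t + A' t) = M t0 * of_real (\<phi> t)" for t
    proof -
      have "A t + A' t = of_real (2 * Re (A t))" unfolding A' by (rule complex_add_cnj)
      thus ?thesis by (subst M_real) (simp add: \<phi>_def)
    qed
    thus ?thesis unfolding M_def A_def A'_def s_def
      by (intro infinite_zeros_superposition[OF T cusp K b z assms(5) lam]) (use t0 in \<open>auto simp: M_def s_def\<close>)
  qed
  moreover have "inj s" by (auto simp: inj_def s_def)
  ultimately have "infinite (s ` {t. (\<Sum>j. of_real (c j) * (M (t + lam j) * (A (t + lam j) + A' (t + lam j)))) = 0})"
    by (simp add: finite_image_iff inj_on_subset)
  moreover have "s ` {t. (\<Sum>j. of_real (c j) * (M (t + lam j) * (A (t + lam j) + A' (t + lam j)))) = 0}
     \<subseteq> {s. Re s = real k / 2 * (1 / 2 + real (char_delta chi)) \<and> F_fun q c lam z k chi s = 0}"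
    by (auto simp: F_line) (simp add: s_def b_def)
  ultimately show ?thesis using finite_subset by blast
qed

end
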